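(* The distortion exponent achieved by the list decoding (LD) scheme is $$\Delta_{ld}(b,\nu)=\max\left\{\nu,\; b\,\frac{\Phi_k+k\Upsilon_k+\nu}{\Upsilon_k+b}\right\}\quad\text{for } b\in\left[\frac{\Phi_{k+1}+\nu}{k+1},\frac{\Phi_k+\nu}{k}\right),\ k=0,1,\dots,M_*-1$$ (for $k=0$ the right endpoint is $+\infty$).
   Context: All logarithms are base 2. Let $M_t,M_r\ge1$ be integers, $M^*=\max\{M_t,M_r\}$, $M_*=\min\{M_t,M_r\}$. A block $S^m$ of i.i.d. $\mathcal{CN}(0,1)$ source samples is sent over one block of $n$ uses of the MIMO channel $\mathbf Y_i=\sqrt{\rho/M_t}\,\mathbf H\mathbf x_i+\mathbf N_i$, where $\rho>0$ is the SNR, $\mathbf H\in\mathbb C^{M_r\times M_t}$ has i.i.d. $\mathcal{CN}(0,1)$ entries, constant over the block, $\mathbf N_i\sim\mathcal{CN}(0,\mathbf I)$ i.i.d., under the power constraint $\sum_i\mathrm{Tr}\,\mathbb E[\mathbf X_i^H\mathbf X_i]\le nM_t$. The receiver also observes $T^m=\sqrt{\rho_s}\Gamma_cS^m+Z^m$ with $\Gamma_c\sim\mathcal{CN}(0,1)$ constant over the block and unit-variance Gaussian noise $Z^m$; $\Gamma=|\Gamma_c|^2$ has density $e^{-\gamma}$, $\gamma\ge0$. All random quantities are independent; the receiver knows $\mathbf H,\gamma$, the transmitter only their distributions. $b=n/m$ is the bandwidth ratio, and $\rho_s\doteq\rho^{\nu}$ with $\nu\ge0$ ($f\doteq g$ means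 $\lim_{\rho\to\infty}\log f/\log g=1$). The distortion exponent of an expected distortion $\mathbb E[D]$ is $-\lim_{\rho\to\infty}\log\mathbb E[D]/\log\rho$. Define $D_d(R,\gamma)=(\rho_s\gamma+2^R)^{-1}$. LD scheme: the source is quantized with a Gaussian test channel $W=S+Q$ at rate $bR$ (no binning), the quantization index is sent with an i.i.d. Gaussian channel codebook, and the receiver decodes by list decoding the channel output and selecting the unique list element jointly typical with $T^m$; the source is reconstructed by MMSE from the decoded codeword and $T^m$, or from $T^m$ alone on failure. For rate $R\ge0$ and a fixed arbitrarily small $\epsilon>0$ its outage event is $\mathcal O_{ld}=\{(\mathbf H,\gamma):\log(1+\frac{2^{bR-\epsilon}-1}{\gamma\rho_s+1})\ge b\log\det(\mathbf I+\frac{\rho}{M_*}\mathbf H\mathbf H^H)\}$ and its expected distortion is $ED_{ld}(R)=\mathbb E[D_d(bR,\Gamma)\mathbf 1_{\mathcal O_{ld}^c}+D_d(0,\Gamma)\mathbf 1_{\mathcal O_{ld}}]$. The distortion exponent achieved by LD is the supremum over $r\ge0$ of the distortion exponent of $ED_{ld}(r\log\rho)$. For $k=0,\dots,M_*$: $\Phi_k=(M^*-k)(M_*-k)$, $\Upsilon_k=M^*+M_*-2k-1$. *)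

theory Defs
  imports "HOL-Analysis.Analysis"
begin

text \<open>Conventions. Logarithms are base 2 (log 2). The channel matrix H has M_r rows and
M_t columns; it is an element of complex^'t^'r with M_t = CARD('t), M_r = CARD('r).\<close>

definition Mmax :: "'t::finite itself \<Rightarrow> 'r::finite itself \<Rightarrow> nat" where
  "Mmax tt rr = max CARD('t) CARD('r)"

definition Mmin :: "'t::finite itself \<Rightarrow> 'r::finite itself \<Rightarrow> nat" where
  "Mmin tt rr = min CARD('t) CARD('r)"

definition Phi :: "nat \<Rightarrow> nat \<Rightarrow> nat \<Rightarrow> real" where
  "Phi Ms ms k = (real Ms - real k) * (real ms - real k)"

definition Ups :: "nat \<Rightarrow> nat \<Rightarrow> nat \<Rightarrow> real" where
  "Ups Ms ms k = real Ms + real ms - 2 * real k - 1"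

definition hconj :: "complex^'t^'r \<Rightarrow> complex^'r^'t" where
  "hconj H = (\<chi> i j. cnj (H $ j $ i))"

text \<open>Density of a matrix with i.i.d. CN(0,1) entries w.r.t. Lebesgue measure on C^(M_r x M_t):
  prod_{ij} (1/pi) exp(-|h_ij|^2).\<close>
definition cgauss_density :: "complex^'t::finite^'r::finite \<Rightarrow> real" where
  "cgauss_density H = (1 / pi) ^ (CARD('t) * CARD('r)) * exp (- (norm H)\<^sup>2)"

definition Dd :: "real \<Rightarrow> real \<Rightarrow> real \<Rightarrow> real" where
  "Dd rs R \<gamma> = 1 / (rs * \<gamma> + 2 powr R)"

text \<open>Outage event of the LD scheme at SNR rho, side-info SNR rs, rate R, slack eps.\<close>
definition outage_ld :: "real \<Rightarrow> real \<Rightarrow> real \<Rightarrow> real \<Rightarrow> real \<Rightarrow>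
    complex^'t::finite^'r::finite \<Rightarrow> real \<Rightarrow> bool" where
  "outage_ld b \<rho> rs \<epsilon> R H \<gamma> \<longleftrightarrow>
     log 2 (1 + (2 powr (b * R - \<epsilon>) - 1) / (\<gamma> * rs + 1))
       \<ge> b * log 2 (Re (det (mat 1 + (\<rho> / real (min CARD('t) CARD('r))) *\<^sub>R (H ** hconj H))))"

definition ED_ld :: "'t::finite itself \<Rightarrow> 'r::finite itself \<Rightarrow>
    real \<Rightarrow> real \<Rightarrow> real \<Rightarrow> real \<Rightarrow> real \<Rightarrow> real" where
  "ED_ld tt rr b \<rho> rs \<epsilon> R =
     (\<integral>H. (cgauss_density (H :: complex^'t^'r)) *
        (\<integral>\<gamma>. indicator {0..} \<gamma> * exp (- \<gamma>) *
            (if outage_ld b \<rho> rs \<epsilon> R H \<gamma> then Dd rs 0 \<gamma> else Dd rs (b * R) \<gamma>) \<partial>lborel)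
      \<partial>lborel)"

definition exponent_exists :: "(real \<Rightarrow> real) \<Rightarrow> bool" where
  "exponent_exists f \<longleftrightarrow> (\<exists>e. ((\<lambda>\<rho>. - log 2 (f \<rho>) / log 2 \<rho>) \<longlongrightarrow> e) at_top)"

definition distortion_exponent :: "(real \<Rightarrow> real) \<Rightarrow> real" where
  "distortion_exponent f = Lim at_top (\<lambda>\<rho>. - log 2 (f \<rho>) / log 2 \<rho>)"

definition LD_exponent :: "'t::finite itself \<Rightarrow> 'r::finite itself \<Rightarrow>
    real \<Rightarrow> (real \<Rightarrow> real) \<Rightarrow> real \<Rightarrow> real" where
  "LD_exponent tt rr b rs \<epsilon> =
     (SUP r\<in>{0..}. distortion_exponent (\<lambda>\<rho>. ED_ld tt rr b \<rho> (rs \<rho>) \<epsilon> (r * log 2 \<rho>)))"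

end

theory Submission
  imports Defs
begin

text \<open>With \<open>\<rho>\<^sub>s = \<rho>\<^sup>\<nu>\<close>, the contribution of the successfully decoded blocks to the expected distortion
decays with exponent \<open>max (b r) \<nu>\<close>. For the blocks in outage the best trade-off is
\<open>\<gamma> \<approx> \<rho>\<^sup>-\<^sup>\<nu>\<close>: all smaller exponents of \<open>\<gamma>\<close> cost the same, and this one makes the
side information useless, so that outage becomes the event that \<open>det (I + \<rho> H H\<^sup>*)\<close> is at most
\<open>\<rho>\<^sup>r\<close>. Its probability decays with the diversity-multiplexing exponent \<open>d(r)\<close> of Zheng and Tse.
Hence rate \<open>r\<close> achieves \<open>min (max (b r) \<nu>) (\<nu> + d(r))\<close>, and the supremum is attained where
\<open>b r = \<nu> + d(r)\<close>; the condition on \<open>b\<close> says that this point lies in \<open>[k, k + 1]\<close>, where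
\<open>d\<close> is linear with slope \<open>-\<Upsilon>\<^sub>k\<close>.

The exponent \<open>d(r)\<close> is obtained without eigenvalue densities. One step of Gaussian elimination with
pivot \<open>a\<close> changes \<open>det (I + x H H\<^sup>*)\<close> by the factor \<open>max 1 (x |a|\<^sup>2)\<close> up to constants, and if \<open>a\<close>
is the largest of all entries, then its size confines all \<open>L = m + n - 1\<close> entries of the pivot row and
column, an event of volume about \<open>|a|\<^sup>2\<^sup>L\<close>. The remaining entries, shifted by a function of the pivot
row and column, form an independent \<open>(m - 1) \<times> (n - 1)\<close> problem. A Chernoff bound with parameter
\<open>s = \<Upsilon>\<^sub>k\<close> then gives the upper bound on the probability, and prescribing the sizes of the pivots
the lower bound.\<close>

section \<open>Determinants and Schur complements\<close>

text \<open>The comparisons under elimination rest on Cauchy--Binet: up to a factorial, the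
  determinant is the sum of the squared moduli of the maximal minors of the block matrix (I | sqrt x
  H). All terms are nonnegative, so the determinant has the size of its largest minor up to a
  constant, and an elimination step can be followed minor by minor. The obstacle in the
  probabilistic part is that the Schur complement separates from the pivot row and column by
  translation invariance, which the Gaussian measure does not have. The integrals are therefore
  taken against Lebesgue measure, with all entries bounded. The Gaussian density returns at the end:
  it is dominated by a series of indicators of boxes of radius n + 1 with weights exp (-n), and it
  is bounded below by a constant on the bounded events that serve for the lower bound. The
  asymptotic estimates carry an arbitrarily small loss \<delta> in the exponent. It pays for the
  logarithms that appear at critical exponents and for shifting the rate slightly, which absorbs
  constant factors in the threshold such as the one due to \<epsilon>.\<close>

lemma det_matrix_mul_expand:
  fixes A :: "'a::comm_ring_1^'m::finite^'n::finite" and B :: "'a^'n^'m"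
  shows "det (A ** B) = (\<Sum>f\<in>UNIV. (\<Prod>j\<in>UNIV. B $ f j $ j) * det (\<chi> i j. A $ i $ f j))"
proof -
  have "det (A ** B) = det (transpose (A ** B))"
    by (simp add: det_transpose)
  also have "\<dots> = (\<Sum>p | p permutes UNIV. of_int (sign p) *
      (\<Prod>j\<in>UNIV. \<Sum>k\<in>UNIV. A $ p j $ k * B $ k $ j))"
    by (simp add: det_def transpose_def matrix_matrix_mult_def)
  also have "\<dots> = (\<Sum>p | p permutes UNIV. of_int (sign p) *
      (\<Sum>f\<in>UNIV. \<Prod>j\<in>UNIV. A $ p j $ f j * B $ f j $ j))"
    by (subst prod_sum_PiE) (auto simp: PiE_UNIV_domain)
  also have "\<dots> = (\<Sum>f\<in>UNIV. \<Sum>p | p permutes UNIV. of_int (sign p) *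
      (\<Prod>j\<in>UNIV. A $ p j $ f j * B $ f j $ j))"
    by (simp add: sum_distrib_left) (rule sum.swap)
  also have "\<dots> = (\<Sum>f\<in>UNIV. (\<Prod>j\<in>UNIV. B $ f j $ j) * det (transpose (\<chi> i j. A $ i $ f j)))"
    by (simp add: det_def transpose_def sum_distrib_left prod.distrib mult_ac)
  finally show ?thesis
    by (simp add: det_transpose)
qed

text \<open>Cauchy--Binet with the sum over all maps from rows to columns: every column subset is counted
\<open>n!\<close> times, and maps that are not injective contribute 0.\<close>

lemma det_mul_hconj:
  fixes A :: "complex^'m::finite^'n::finite"
  shows "det (A ** hconj A) =
    of_real ((\<Sum>f\<in>UNIV. (cmod (det (\<chi> i j. A $ i $ f j)))\<^sup>2) / fact CARD('n))"
proof -
  define M where "M f = det (\<chi> i j. A $ i $ f j)" for f :: "'n \<Rightarrow> 'm"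
  define S where "S = det (A ** hconj A)"
  have S: "S = (\<Sum>f\<in>UNIV. (\<Prod>j\<in>UNIV. cnj (A $ j $ f j)) * M f)"
    unfolding S_def M_def by (subst det_matrix_mul_expand) (simp add: hconj_def)
  \<comment> \<open>Replacing \<open>f\<close> by \<open>f \<circ> p\<close> permutes the columns of
    the minor, hence the sign. Summed over all \<open>p\<close>, the products of conjugated entries
    become the conjugate of \<open>M f\<close>.\<close>
  have perm: "S = (\<Sum>f\<in>UNIV. of_int (sign p) * (\<Prod>j\<in>UNIV. cnj (A $ j $ f (p j))) * M f)"
    if p: "p permutes UNIV" for p
  proof -
    have M_comp: "M (f \<circ> p) = of_int (sign p) * M f" for f
      using det_permute_columns[OF p, of "\<chi> i j. A $ i $ f j"] by (simp add: M_def)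
    have bij: "bij_betw (\<lambda>f. f \<circ> p) (UNIV :: ('n \<Rightarrow> 'm) set) UNIV"
      by (rule bij_betwI[where g = "\<lambda>f. f \<circ> inv p"])
         (auto simp: o_assoc[symmetric] permutes_inv_o[OF p])
    show ?thesis
      unfolding S by (subst sum.reindex_bij_betw[OF bij, symmetric]) (simp add: M_comp mult_ac)
  qed
  have "of_nat (fact CARD('n)) * S = (\<Sum>p | p permutes (UNIV :: 'n set). S)"
    by (simp add: card_permutations)
  also have "\<dots> = (\<Sum>p | p permutes (UNIV :: 'n set).
      \<Sum>f\<in>UNIV. of_int (sign p) * (\<Prod>j\<in>UNIV. cnj (A $ j $ f (p j))) * M f)"
    by (intro sum.cong refl perm) auto
  also have "\<dots> = (\<Sum>f\<in>UNIV. \<Sum>p | p permutes (UNIV :: 'n set).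
      of_int (sign p) * (\<Prod>j\<in>UNIV. cnj (A $ j $ f (p j))) * M f)"
    by (rule sum.swap)
  also have "\<dots> = (\<Sum>f\<in>UNIV. cnj (M f) * M f)"
    by (simp add: M_def det_def sum_distrib_right)
  also have "\<dots> = of_real (\<Sum>f\<in>UNIV. (cmod (M f))\<^sup>2)"
    unfolding of_real_sum by (intro sum.cong refl) (metis complex_norm_square mult.commute)
  finally show ?thesis
    unfolding S_def[symmetric] M_def[symmetric] by (simp add: field_simps)
qed

section \<open>The outage determinant as a sum of squared minors\<close>

definition gram_det :: "real \<Rightarrow> complex^'t::finite^'r::finite \<Rightarrow> real" where
  "gram_det x H = Re (det (mat 1 + x *\<^sub>R (H ** hconj H)))"

text \<open>The block matrix (I | sqrt x H). Its product with its conjugate transpose is the matrix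
  inside \<open>gram_det\<close>, so Cauchy--Binet applies to it.\<close>

definition aug :: "real \<Rightarrow> complex^'t::finite^'r::finite \<Rightarrow> complex^('r + 't)^'r" where
  "aug x H = (\<chi> i y. case y of Inl l \<Rightarrow> (if l = i then 1 else 0) | Inr j \<Rightarrow> of_real (sqrt x) * H $ i $ j)"

text \<open>Selections \<open>f\<close> are arbitrary maps, neither ordered nor injective, so that
  exchanging a column is a plain function update.\<close>

definition aug_minor :: "real \<Rightarrow> complex^'t::finite^'r::finite \<Rightarrow> ('r \<Rightarrow> 'r + 't) \<Rightarrow> complex" where
  "aug_minor x H f = det (\<chi> i j. aug x H $ i $ f j)"

lemma aug_simps [simp]:
  "aug x H $ i $ Inl l = (if l = i then 1 else 0)"
  "aug x H $ i $ Inr j = of_real (sqrt x) * H $ i $ j"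
  by (simp_all add: aug_def)

lemma sum_UNIV_Plus:
  fixes g :: "'a::finite + 'b::finite \<Rightarrow> 'c::comm_monoid_add"
  shows "sum g UNIV = (\<Sum>a\<in>UNIV. g (Inl a)) + (\<Sum>b\<in>UNIV. g (Inr b))"
  by (subst UNIV_Plus_UNIV[symmetric], subst sum.Plus) auto

lemma aug_mul_hconj:
  fixes H :: "complex^'t::finite^'r::finite"
  assumes "x \<ge> 0"
  shows "aug x H ** hconj (aug x H) = mat 1 + x *\<^sub>R (H ** hconj H)"
proof -
  have "of_real (sqrt x) * of_real (sqrt x) = complex_of_real x"
    using assms by (simp flip: of_real_mult)
  hence eq: "of_real (sqrt x) * a * (of_real (sqrt x) * b) = of_real x * (a * b)" for a b :: complex
    by (metis mult.assoc mult.left_commute)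
  show ?thesis
    by (simp add: vec_eq_iff matrix_matrix_mult_def hconj_def sum_UNIV_Plus mat_def eq
        scaleR_conv_of_real[where 'a=complex] flip: sum_distrib_left)
       (auto simp: if_distrib[of cnj] if_distrib[of "\<lambda>z. _ * z"] cong: if_cong)
qed

lemma gram_det_eq:
  fixes H :: "complex^'t::finite^'r::finite"
  assumes "x \<ge> 0"
  shows "gram_det x H = (\<Sum>f\<in>UNIV. (cmod (aug_minor x H f))\<^sup>2) / fact CARD('r)"
  unfolding gram_det_def aug_mul_hconj[OF assms, symmetric] det_mul_hconj aug_minor_def
  by (rule Re_complex_of_real)

lemma gram_det_ge_minor:
  fixes H :: "complex^'t::finite^'r::finite"
  assumes "x \<ge> 0"
  shows "gram_det x H \<ge> (cmod (aug_minor x H f))\<^sup>2 / fact CARD('r)"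
  unfolding gram_det_eq[OF assms]
  by (intro divide_right_mono member_le_sum) auto

lemma gram_det_le_minors:
  fixes H :: "complex^'t::finite^'r::finite"
  assumes "x \<ge> 0" "\<And>f. cmod (aug_minor x H f) \<le> B"
  shows "gram_det x H \<le> real CARD('r \<Rightarrow> 'r + 't) * B\<^sup>2"
proof -
  have "(\<Sum>f\<in>UNIV. (cmod (aug_minor x H f))\<^sup>2) \<le> (\<Sum>f\<in>(UNIV :: ('r \<Rightarrow> 'r + 't) set). B\<^sup>2)"
    by (intro sum_mono power_mono assms) auto
  also have "\<dots> = real CARD('r \<Rightarrow> 'r + 't) * B\<^sup>2" by simp
  finally have "gram_det x H \<le> real CARD('r \<Rightarrow> 'r + 't) * B\<^sup>2 / fact CARD('r)"
    unfolding gram_det_eq[OF assms(1)] by (intro divide_right_mono) auto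
  also have "\<dots> \<le> real CARD('r \<Rightarrow> 'r + 't) * B\<^sup>2 / 1"
    by (intro divide_left_mono) (auto simp: fact_ge_1)
  finally show ?thesis by simp
qed

lemma gram_det_nonneg: "x \<ge> 0 \<Longrightarrow> gram_det x H \<ge> 0"
  by (simp add: gram_det_eq sum_nonneg)

text \<open>The identity block is itself a minor, of value 1. The bound yields positivity and turns
  constants into multiples of the determinant.\<close>

lemma gram_det_ge_inverse_fact:
  fixes H :: "complex^'t::finite^'r::finite"
  assumes "x \<ge> 0"
  shows "gram_det x H \<ge> 1 / fact CARD('r)"
proof -
  have "(\<chi> i j. aug x H $ i $ Inl j) = mat 1"
    by (simp add: vec_eq_iff mat_def)
  hence "aug_minor x H Inl = 1"
    by (simp add: aug_minor_def)
  thus ?thesis using gram_det_ge_minor[OF assms, of H Inl] by simp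
qed

lemma gram_det_pos: "x \<ge> 0 \<Longrightarrow> gram_det x H > 0"
  by (rule less_le_trans[OF _ gram_det_ge_inverse_fact]) simp_all

lemma inj_of_aug_minor_nonzero:
  assumes "aug_minor x H f \<noteq> 0"
  shows "inj f"
proof (rule injI, rule ccontr)
  fix i j assume "f i = f j" "i \<noteq> j"
  hence "aug_minor x H f = 0"
    unfolding aug_minor_def by (intro det_identical_columns) (auto simp: column_def vec_eq_iff)
  thus False using assms by simp
qed

section \<open>One elimination step and its effect on the determinant\<close>

lemma cmod_det_le:
  fixes A :: "complex^'n::finite^'n"
  assumes "\<And>i j. cmod (A $ i $ j) \<le> B"
  shows "cmod (det A) \<le> fact CARD('n) * B ^ CARD('n)"
proof -
  have "cmod (det A) \<le> (\<Sum>p | p permutes (UNIV :: 'n set). cmod (of_int (sign p) * (\<Prod>i\<in>UNIV. A $ i $ p i)))"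
    unfolding det_def by (rule norm_sum)
  also have "\<dots> \<le> (\<Sum>p | p permutes (UNIV :: 'n set). B ^ CARD('n))"
  proof (rule sum_mono)
    fix p :: "'n \<Rightarrow> 'n"
    have "cmod (of_int (sign p) * (\<Prod>i\<in>UNIV. A $ i $ p i)) = (\<Prod>i\<in>UNIV. cmod (A $ i $ p i))"
      by (simp add: norm_mult sign_def prod_norm)
    also have "\<dots> \<le> (\<Prod>i\<in>(UNIV :: 'n set). B)"
      by (intro prod_mono) (auto intro: assms)
    finally show "cmod (of_int (sign p) * (\<Prod>i\<in>UNIV. A $ i $ p i)) \<le> B ^ CARD('n)" by simp
  qed
  finally show ?thesis by (simp add: card_permutations)
qed

text \<open>The index types stay fixed during elimination: for a nonzero pivot, row \<open>p\<close>
  and column \<open>q\<close> of the result vanish instead of being deleted. For a zero pivot,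
  division by zero leaves the matrix unchanged.\<close>

definition schur :: "'r \<Rightarrow> 't \<Rightarrow> complex^'t::finite^'r::finite \<Rightarrow> complex^'t^'r" where
  "schur p q H = (\<chi> i j. H $ i $ j - H $ i $ q * H $ p $ j / H $ p $ q)"

text \<open>As a left factor it adds multiples of row \<open>k\<close> to the other rows; its
  transpose as a right factor does the same with columns. Its determinant is \<open>c k\<close>, so
  identities between matrices become identities between minors.\<close>

definition replace_col :: "'n \<Rightarrow> ('n \<Rightarrow> complex) \<Rightarrow> complex^'n::finite^'n" where
  "replace_col k c = (\<chi> i j. if j = k then c i else if i = j then 1 else 0)"

lemma det_replace_col:
  fixes k :: "'n::finite"
  shows "det (replace_col k c) = c k"
  using cramer_lemma[of k "mat 1 :: complex^'n^'n" "\<chi> i. c i"]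
  unfolding matrix_vector_mul_lid det_I by (simp add: replace_col_def mat_def cong: if_cong)

lemma det_transpose_replace_col: "det (transpose (replace_col k c)) = c k"
  by (simp add: det_transpose det_replace_col)

lemma replace_col_mul_nth:
  "(replace_col k c ** X) $ i $ j = c i * X $ k $ j + (if i = k then 0 else X $ i $ j)"
proof -
  have "(replace_col k c ** X) $ i $ j =
      (\<Sum>l\<in>UNIV. (if l = k then c i * X $ k $ j else 0) + (if l = i then (if i = k then 0 else X $ i $ j)
          else 0))"
    unfolding matrix_matrix_mult_def replace_col_def vec_lambda_beta by (rule sum.cong) auto
  thus ?thesis by (simp add: sum.distrib)
qed

lemma mul_transpose_replace_col_nth:
  "(X ** transpose (replace_col k c)) $ i $ j = X $ i $ k * c j + (if j = k then 0 else X $ i $ j)"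
proof -
  have "(X ** transpose (replace_col k c)) $ i $ j =
      (\<Sum>l\<in>UNIV. (if l = k then X $ i $ k * c j else 0) + (if l = j then (if j = k then 0 else X $ i $ j)
          else 0))"
    unfolding matrix_matrix_mult_def replace_col_def transpose_def vec_lambda_beta by (rule sum.cong) auto
  thus ?thesis by (simp add: sum.distrib)
qed

text \<open>Multiplication by \<open>L\<close> sends column \<open>j\<close> of \<open>H\<close> to
  column \<open>j\<close> of the Schur complement plus \<open>H $ p $ j\<close> times the unit
  vector e_p. On the right-hand side e_p stands in position \<open>i\<close>, so these multiples are
  produced by the column operation \<open>c\<close>, and column \<open>q\<close> becomes a multiple
  of e_p. The condition \<open>fj\<close> keeps e_p, the one unit vector that \<open>L\<close>
  changes, out of the other positions.\<close>

lemma aug_minor_pivot: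
  fixes H :: "complex^'t::finite^'r::finite"
  assumes a: "H $ p $ q \<noteq> 0" and fi: "f i = Inl p" and fj: "\<And>j. j \<noteq> i \<Longrightarrow> f j \<noteq> Inl p"
  shows "aug_minor x H (f(i := Inr q)) = of_real (sqrt x) * H $ p $ q * aug_minor x (schur p q H) f"
proof -
  define L where "L = replace_col p (\<lambda>l. if l = p then 1 else - H $ l $ q / H $ p $ q)"
  define c where "c j = (if j = i then of_real (sqrt x) * H $ p $ q else
      (case f j of Inl _ \<Rightarrow> 0 | Inr j' \<Rightarrow> of_real (sqrt x) * H $ p $ j'))" for j
  have "L ** (\<chi> l j. aug x H $ l $ (f(i := Inr q)) j) =
        (\<chi> l j. aug x (schur p q H) $ l $ f j) ** transpose (replace_col i c)"
    unfolding vec_eq_iff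
  proof (intro allI)
    fix l j
    show "(L ** (\<chi> l j. aug x H $ l $ (f(i := Inr q)) j)) $ l $ j =
        ((\<chi> l j. aug x (schur p q H) $ l $ f j) ** transpose (replace_col i c)) $ l $ j"
    proof (cases "j = i")
      case True
      thus ?thesis using a
        by (simp add: L_def replace_col_mul_nth mul_transpose_replace_col_nth fi c_def)
    next
      case False
      thus ?thesis using a fj[OF False]
        by (cases "f j")
           (auto simp: L_def replace_col_mul_nth mul_transpose_replace_col_nth fi c_def schur_def field_simps)
    qed
  qed
  from arg_cong[OF this, of det]
  have "det L * aug_minor x H (f(i := Inr q)) = aug_minor x (schur p q H) f * c i"
    unfolding aug_minor_def det_mul det_transpose_replace_col .
  thus ?thesis by (simp add: L_def det_replace_col c_def)
qed

lemma cmod_schur_le: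
  fixes H :: "complex^'t::finite^'r::finite"
  assumes le: "\<And>i j. cmod (H $ i $ j) \<le> cmod (H $ p $ q)"
  shows "cmod (schur p q H $ i $ j) \<le> 2 * cmod (H $ p $ q)"
proof (cases "H $ p $ q = 0")
  case True
  hence "H $ i $ j = 0" for i j using le[of i j] by simp
  thus ?thesis by (simp add: schur_def)
next
  case False
  have "cmod (schur p q H $ i $ j) \<le> cmod (H $ i $ j) + cmod (H $ i $ q * H $ p $ j / H $ p $ q)"
    unfolding schur_def by (simp add: norm_triangle_ineq4)
  also have "cmod (H $ i $ q * H $ p $ j / H $ p $ q) \<le> cmod (H $ p $ q) * cmod (H $ p $ q) / cmod (H $
      p $ q)"
    unfolding norm_mult norm_divide
    by (intro divide_right_mono mult_mono le) auto
  also have "cmod (H $ i $ j) \<le> cmod (H $ p $ q)" by (rule le)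
  finally show ?thesis using False by simp
qed

text \<open>For a large pivot, take the map \<open>f\<close> with the largest minor of the Schur complement. It uses
the unit vector \<open>e\<^sub>p\<close>, because row \<open>p\<close> of the Schur complement is zero; exchanging \<open>e\<^sub>p\<close> for column
\<open>q\<close> of \<open>H\<close> gains the factor \<open>sqrt x * a\<close>. For a small pivot all entries are bounded.\<close>

lemma gram_det_schur_le:
  fixes H :: "complex^'t::finite^'r::finite"
  assumes x: "x \<ge> 0" and le: "\<And>i j. cmod (H $ i $ j) \<le> cmod (H $ p $ q)"
  shows "gram_det x (schur p q H) * max 1 (x * (cmod (H $ p $ q))\<^sup>2)
           \<le> fact CARD('r) * real CARD('r \<Rightarrow> 'r + 't) * (fact CARD('r) * 2 ^ CARD('r))\<^sup>2 * gram_det x H"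
proof (cases "sqrt x * cmod (H $ p $ q) \<le> 1")
  case True
  define a where "a = H $ p $ q"
  have "(sqrt x * cmod a)\<^sup>2 \<le> 1"
    using True x by (intro power_le_one) (auto simp: a_def)
  hence max1: "max 1 (x * (cmod (H $ p $ q))\<^sup>2) = 1"
    using x by (simp add: power_mult_distrib a_def)
  have "cmod (aug x (schur p q H) $ i $ y) \<le> 2" for i y
  proof (cases y)
    case (Inr j)
    have "sqrt x * cmod (schur p q H $ i $ j) \<le> sqrt x * (2 * cmod a)"
      using x unfolding a_def by (intro mult_left_mono cmod_schur_le le) auto
    thus ?thesis using True x by (simp add: Inr norm_mult a_def)
  qed auto
  hence "cmod (aug_minor x (schur p q H) f) \<le> fact CARD('r) * 2 ^ CARD('r)" for f
    unfolding aug_minor_def by (intro cmod_det_le) auto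
  from gram_det_le_minors[OF x this]
  have "gram_det x (schur p q H) \<le> real CARD('r \<Rightarrow> 'r + 't) * (fact CARD('r) * 2 ^ CARD('r))\<^sup>2" .
  \<comment> \<open>Since the determinant of \<open>H\<close> is at least
    \<open>1 / fact CARD('r)\<close>, a constant bound is also a multiple of it.\<close>
  also have "\<dots> \<le> real CARD('r \<Rightarrow> 'r + 't) * (fact CARD('r) * 2 ^ CARD('r))\<^sup>2 * (fact CARD('r) * gram_det x H)"
    using gram_det_ge_inverse_fact[OF x, of H]
      mult_left_mono[of 1 "fact CARD('r) * gram_det x H" "real CARD('r \<Rightarrow> 'r + 't) * (fact CARD('r) * 2 ^
          CARD('r))\<^sup>2"]
    by (simp add: field_simps)
  finally show ?thesis by (simp add: max1 mult_ac)
next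
  case False
  define a where "a = H $ p $ q"
  have a: "a \<noteq> 0" using False by (auto simp: a_def)
  have "1 ^ 2 < (sqrt x * cmod a)\<^sup>2"
    using False by (intro power_strict_mono) (auto simp: a_def)
  hence max2: "max 1 (x * (cmod (H $ p $ q))\<^sup>2) = x * (cmod a)\<^sup>2"
    using x by (simp add: power_mult_distrib a_def)
  define m where "m f = cmod (aug_minor x (schur p q H) f)" for f
  have "Max (range m) \<in> range m" by (rule Max_in) auto
  then obtain f where "Max (range m) = m f" by (rule imageE)
  hence f: "m g \<le> m f" for g using Max_ge[of "range m" "m g"] by simp
  have D: "gram_det x (schur p q H) \<le> real CARD('r \<Rightarrow> 'r + 't) * (m f)\<^sup>2"
    by (rule gram_det_le_minors[OF x]) (use f in \<open>auto simp: m_def\<close>)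
  have "gram_det x (schur p q H) > 0"
    by (rule gram_det_pos[OF x])
  hence m0: "m f \<noteq> 0" using D by auto
  have inj: "inj f" using m0 inj_of_aug_minor_nonzero[of x "schur p q H" f] by (auto simp: m_def)
  obtain i where i: "f i = Inl p"
  proof (rule ccontr)
    assume "\<not> thesis"
    hence ne: "f i \<noteq> Inl p" for i using that by blast
    have z: "aug x (schur p q H) $ p $ f j = 0" for j
      using ne[of j] a by (cases "f j") (auto simp: schur_def a_def)
    have "aug_minor x (schur p q H) f = 0"
      unfolding aug_minor_def by (rule det_zero_row(1)[of p]) (simp add: row_def vec_eq_iff z)
    thus False using m0 by (simp add: m_def)
  qed
  have "aug_minor x H (f(i := Inr q)) = of_real (sqrt x) * a * aug_minor x (schur p q H) f"
    unfolding a_def by (rule aug_minor_pivot) (use a i inj in \<open>auto simp: a_def inj_def\<close>)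
  hence "(cmod (aug_minor x H (f(i := Inr q))))\<^sup>2 = x * (cmod a)\<^sup>2 * (m f)\<^sup>2"
    using x by (simp add: norm_mult m_def power_mult_distrib)
  hence "x * (cmod a)\<^sup>2 * (m f)\<^sup>2 \<le> fact CARD('r) * gram_det x H"
    using gram_det_ge_minor[OF x, of H "f(i := Inr q)"] by (simp add: field_simps)
  have "gram_det x (schur p q H) * (x * (cmod a)\<^sup>2) \<le> real CARD('r \<Rightarrow> 'r + 't) * (m f)\<^sup>2 * (x * (cmod a)\<^sup>2)"
    using x by (intro mult_right_mono D) auto
  also have "\<dots> = real CARD('r \<Rightarrow> 'r + 't) * (x * (cmod a)\<^sup>2 * (m f)\<^sup>2)" by simp
  also have "\<dots> \<le> real CARD('r \<Rightarrow> 'r + 't) * (fact CARD('r) * gram_det x H)"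
    by (intro mult_left_mono) (fact, simp)
  \<comment> \<open>The inserted factor is at least 1; it makes both cases end with the same
    constant.\<close>
  also have "\<dots> \<le> real CARD('r \<Rightarrow> 'r + 't) * (fact CARD('r) * gram_det x H) * (fact CARD('r) * 2 ^ CARD('r))\<^sup>2"
    using gram_det_nonneg[OF x, of H] one_le_power[of "fact CARD('r) * 2 ^ CARD('r) :: real" 2]
      mult_left_mono[of 1 "(fact CARD('r) * 2 ^ CARD('r))\<^sup>2" "real CARD('r \<Rightarrow> 'r + 't) * (fact CARD('r) *
          gram_det x H)"]
    by (simp add: mult_ge1_I fact_ge_1 del: of_nat_mult)
  finally show ?thesis unfolding max2 by (simp add: mult_ac)
qed

text \<open>Converse of the previous estimate. Each minor of \<open>H\<close> expands into minors of
  the Schur complement with coefficients from a matrix \<open>M\<close>, all of whose rows are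
  bounded except the one belonging to e_p. The factor 2 in the hypotheses leaves room for a pivot
  that is only known up to a factor 2.\<close>

lemma gram_det_le_schur:
  fixes H :: "complex^'t::finite^'r::finite"
  assumes x: "x \<ge> 0" and a: "H $ p $ q \<noteq> 0"
    and col: "\<And>i. cmod (H $ i $ q) \<le> 2 * cmod (H $ p $ q)"
    and row: "\<And>j. cmod (H $ p $ j) \<le> 2 * cmod (H $ p $ q)"
  shows "gram_det x H \<le> (real CARD('r \<Rightarrow> 'r + 't))\<^sup>2 * 4 ^ CARD('r)
           * max 1 (x * (cmod (H $ p $ q))\<^sup>2) * gram_det x (schur p q H)"
proof -
  define X where "X = max 1 (sqrt x * cmod (H $ p $ q))"
  define L where "L = replace_col p (\<lambda>l. if l = p then 1 else - H $ l $ q / H $ p $ q)"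
  define b where "b y = (if y = Inl p then 2 * X else 2)" for y :: "'r + 't"
  define S where "S = (\<Sum>g\<in>UNIV. (cmod (aug_minor x (schur p q H) g))\<^sup>2)"
  define N where "N = real CARD('r \<Rightarrow> 'r + 't)"
  have X1: "X \<ge> 1" by (simp add: X_def)
  have minor_le: "cmod (aug_minor x H f) \<le> (\<Sum>g\<in>UNIV. 2 ^ CARD('r) * X * cmod (aug_minor x (schur p q H)
      g))" for f
  proof -
    \<comment> \<open>Coefficients of the columns of \<open>L ** aug x H\<close> in the columns of
      \<open>aug x (schur p q H)\<close>: a column of \<open>H\<close> yields the same column of the
      complement plus a multiple of e_p, and e_p itself yields the quotients of the pivot column by
      the pivot.\<close>
    define M :: "complex^'r^('r + 't)" where
      "M = (\<chi> y j. case f j of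
          Inl p' \<Rightarrow> if p' = p then (case y of Inl l \<Rightarrow> if l = p then 1 else - H $ l $ q / H $ p $ q | Inr _ \<Rightarrow> 0)
                   else (if y = Inl p' then 1 else 0)
        | Inr j' \<Rightarrow> if y = Inl p then of_real (sqrt x) * H $ p $ j' else if y = Inr j' then 1 else 0)"
    have "L ** (\<chi> l j. aug x H $ l $ f j) = aug x (schur p q H) ** M"
      unfolding vec_eq_iff
    proof (intro allI)
      fix l j
      have "(aug x (schur p q H) ** M) $ l $ j = M $ Inl l $ j +
          (\<Sum>k\<in>UNIV. of_real (sqrt x) * schur p q H $ l $ k * M $ Inr k $ j)"
        by (simp add: matrix_matrix_mult_def sum_UNIV_Plus if_distrib[of "\<lambda>z. z * _"] cong: if_cong)
      also have "(\<Sum>k\<in>UNIV. of_real (sqrt x) * schur p q H $ l $ k * M $ Inr k $ j) =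
          (case f j of Inl _ \<Rightarrow> 0 | Inr k \<Rightarrow> of_real (sqrt x) * schur p q H $ l $ k)"
        by (cases "f j") (simp_all add: M_def if_distrib[of "\<lambda>z. _ * z"] cong: if_cong)
      also have "M $ Inl l $ j + \<dots> = (L ** (\<chi> l j. aug x H $ l $ f j)) $ l $ j"
        using a by (cases "f j") (auto simp: M_def L_def replace_col_mul_nth schur_def field_simps)
      finally show "(L ** (\<chi> l j. aug x H $ l $ f j)) $ l $ j = (aug x (schur p q H) ** M) $ l $ j" ..
    qed
    from arg_cong[OF this, of det]
    have "det L * aug_minor x H f = det (aug x (schur p q H) ** M)"
      unfolding aug_minor_def det_mul .
    also have "det L = 1" by (simp add: L_def det_replace_col)
    finally have eq: "aug_minor x H f = (\<Sum>g\<in>UNIV. (\<Prod>j\<in>UNIV. M $ g j $ j) * aug_minor x (schur p q H) g)"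
      by (simp add: det_matrix_mul_expand aug_minor_def)
    have M_le: "cmod (M $ y $ j) \<le> b y" for y j
    proof -
      have "sqrt x * cmod (H $ p $ j') \<le> 2 * X" for j'
      proof -
        have "sqrt x * cmod (H $ p $ j') \<le> sqrt x * (2 * cmod (H $ p $ q))"
          using x by (intro mult_left_mono row) auto
        thus ?thesis by (simp add: X_def)
      qed
      moreover have "cmod (H $ l $ q / H $ p $ q) \<le> 2" for l
        using col[of l] a by (simp add: norm_divide divide_simps)
      ultimately show ?thesis using X1 x
        by (cases "f j"; cases y) (auto simp: M_def b_def norm_mult norm_divide)
    qed
    have "cmod ((\<Prod>j\<in>UNIV. M $ g j $ j) * aug_minor x (schur p q H) g)
         \<le> 2 ^ CARD('r) * X * cmod (aug_minor x (schur p q H) g)" for g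
    proof (cases "aug_minor x (schur p q H) g = 0")
      case False
      \<comment> \<open>An injective \<open>g\<close> selects e_p at most once, so the large factor
        \<open>X\<close> enters with exponent at most 1.\<close>
      hence inj: "inj g" by (rule inj_of_aug_minor_nonzero)
      have "cmod (\<Prod>j\<in>UNIV. M $ g j $ j) \<le> (\<Prod>j\<in>UNIV. b (g j))"
        unfolding prod_norm[symmetric] by (intro prod_mono) (auto intro: M_le)
      also have "\<dots> = (\<Prod>j\<in>(UNIV::'r set). 2 * (if g j = Inl p then X else 1))"
        by (intro prod.cong) (auto simp: b_def)
      also have "\<dots> = 2 ^ CARD('r) * (\<Prod>j\<in>(UNIV::'r set). (if g j = Inl p then X else 1))"
        by (simp add: prod.distrib)
      also have "(\<Prod>j\<in>(UNIV::'r set). (if g j = Inl p then X else 1)) = X ^ card {j. g j = Inl p}"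
        by (simp add: prod.If_cases)
      also have "\<dots> \<le> X ^ 1"
      proof (rule power_increasing)
        show "card {j. g j = Inl p} \<le> 1"
          using card_inj_on_le[OF inj_on_subset[OF inj], of "{j. g j = Inl p}" "{Inl p}"] by auto
      qed (rule X1)
      finally show ?thesis by (simp add: norm_mult mult_right_mono)
    qed auto
    thus ?thesis unfolding eq by (intro order.trans[OF norm_sum] sum_mono)
  qed
  have minor2: "(cmod (aug_minor x H f))\<^sup>2 \<le> 4 ^ CARD('r) * X\<^sup>2 * (N * S)" for f
  proof -
    have "(cmod (aug_minor x H f))\<^sup>2 \<le> (\<Sum>g\<in>UNIV. 2 ^ CARD('r) * X * cmod (aug_minor x (schur p q H) g))\<^sup>2"
      by (intro power_mono minor_le) auto
    also have "\<dots> = (2 ^ CARD('r) * X)\<^sup>2 * (\<Sum>g\<in>UNIV. cmod (aug_minor x (schur p q H) g))\<^sup>2"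
      by (simp add: sum_distrib_left[symmetric] power_mult_distrib)
    also have "\<dots> \<le> (2 ^ CARD('r) * X)\<^sup>2 * (N * S)"
      unfolding N_def S_def
      using sum_squared_le_sum_of_squares[of "\<lambda>g. cmod (aug_minor x (schur p q H) g)" UNIV]
      by (intro mult_left_mono) (simp_all add: mult.commute)
    also have "(2 ^ CARD('r) * X)\<^sup>2 = 4 ^ CARD('r) * X\<^sup>2"
      by (simp add: power_mult_distrib power2_eq_square flip: power_mult_distrib)
    finally show ?thesis .
  qed
  have "gram_det x H \<le> (\<Sum>f\<in>(UNIV :: ('r \<Rightarrow> 'r + 't) set). 4 ^ CARD('r) * X\<^sup>2 * (N * S)) / fact CARD('r)"
    unfolding gram_det_eq[OF x] by (intro divide_right_mono sum_mono minor2) auto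
  also have "\<dots> = N\<^sup>2 * 4 ^ CARD('r) * X\<^sup>2 * (S / fact CARD('r))"
    by (simp add: N_def power2_eq_square)
  also have "S / fact CARD('r) = gram_det x (schur p q H)"
    unfolding S_def gram_det_eq[OF x] ..
  also have "X\<^sup>2 = max 1 ((sqrt x * cmod (H $ p $ q))\<^sup>2)"
  proof (cases "1 \<le> sqrt x * cmod (H $ p $ q)")
    case True
    thus ?thesis using one_le_power[OF True, of 2] by (simp add: X_def max_def)
  next
    case False
    hence "(sqrt x * cmod (H $ p $ q))\<^sup>2 \<le> 1"
      using x by (intro power_le_one) auto
    thus ?thesis using False by (simp add: X_def max_def)
  qed
  also have "(sqrt x * cmod (H $ p $ q))\<^sup>2 = x * (cmod (H $ p $ q))\<^sup>2"
    using x by (simp add: power_mult_distrib)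
  finally show ?thesis unfolding N_def .
qed

section \<open>Integration over the pivot row and column\<close>

text \<open>Products over arbitrary index sets, because the sub-problems of the elimination live on
  shrinking sets of entries.\<close>

abbreviation cprod :: "'i set \<Rightarrow> ('i \<Rightarrow> complex) measure" where
  "cprod I \<equiv> Pi\<^sub>M I (\<lambda>_. lborel)"

lemma product_sigma_finite_lborel: "product_sigma_finite (\<lambda>_. lborel :: complex measure)"
  by standard

lemma nn_integral_cprod_translate:
  assumes I: "finite I" and g [measurable]: "g \<in> borel_measurable (cprod I)"
  shows "(\<integral>\<^sup>+x. g (\<lambda>i\<in>I. x i + c i) \<partial>cprod I) = (\<integral>\<^sup>+x. g x \<partial>cprod I)"
proof -
  interpret product_sigma_finite "\<lambda>_. lborel :: complex measure"
    by (rule product_sigma_finite_lborel)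
  define f where "f = (\<lambda>x. \<lambda>i\<in>I. x i + c i :: complex)"
  have [measurable]: "f \<in> measurable (cprod I) (cprod I)"
    unfolding f_def by measurable
  have "distr (cprod I) (cprod I) f = cprod I"
  proof (rule PiM_eqI)
    fix A assume A: "\<And>i. i \<in> I \<Longrightarrow> A i \<in> sets (lborel :: complex measure)"
    have A': "(\<lambda>z. z + c i) -` A i \<in> sets lborel" if "i \<in> I" for i
    proof -
      have "(\<lambda>z. z + c i) -` A i \<inter> space lborel \<in> sets lborel"
        by (rule measurable_sets[of _ _ lborel]) (use A[OF that] in auto)
      thus ?thesis by simp
    qed
    have trans: "emeasure lborel ((\<lambda>z. z + c i) -` A i) = emeasure lborel (A i)" if "i \<in> I" for i
    proof -
      have "emeasure lborel (A i) = emeasure (distr lborel borel ((+) (c i))) (A i)"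
        by (simp add: lborel_distr_plus)
      also have "\<dots> = emeasure lborel ((+) (c i) -` A i \<inter> space lborel)"
        by (rule emeasure_distr) (use A[OF that] in auto)
      finally show ?thesis by (simp add: add.commute[of "c i"] vimage_def)
    qed
    have "emeasure (distr (cprod I) (cprod I) f) (Pi\<^sub>E I A) =
        emeasure (cprod I) (f -` Pi\<^sub>E I A \<inter> space (cprod I))"
      by (rule emeasure_distr) (use I A in \<open>auto intro!: sets_PiM_I_finite\<close>)
    also have "f -` Pi\<^sub>E I A \<inter> space (cprod I) = Pi\<^sub>E I (\<lambda>i. (\<lambda>z. z + c i) -` A i)"
      by (auto simp: f_def space_PiM PiE_iff)
    also have "emeasure (cprod I) \<dots> = (\<Prod>i\<in>I. emeasure lborel (A i))"
      using I A' by (subst emeasure_PiM) (auto intro!: prod.cong trans)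
    finally show "emeasure (distr (cprod I) (cprod I) f) (Pi\<^sub>E I A) = (\<Prod>i\<in>I. emeasure lborel (A i))" .
  qed (use I in auto)
  hence "(\<integral>\<^sup>+x. g x \<partial>cprod I) = (\<integral>\<^sup>+x. g x \<partial>distr (cprod I) (cprod I) f)" by simp
  also have "\<dots> = (\<integral>\<^sup>+x. g (f x) \<partial>cprod I)"
    by (rule nn_integral_distr) auto
  finally show ?thesis by (simp add: f_def)
qed

definition cross :: "'r \<Rightarrow> 't \<Rightarrow> 'r set \<Rightarrow> 't set \<Rightarrow> ('r \<times> 't) set" where
  "cross p q S T = {p} \<times> T \<union> S \<times> {q}"

definition minor_idx :: "'r \<Rightarrow> 't \<Rightarrow> 'r set \<Rightarrow> 't set \<Rightarrow> ('r \<times> 't) set" where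
  "minor_idx p q S T = (S - {p}) \<times> (T - {q})"

definition schur_fun :: "'r \<Rightarrow> 't \<Rightarrow> 'r set \<Rightarrow> 't set \<Rightarrow> ('r \<times> 't \<Rightarrow> complex) \<Rightarrow> ('r \<times> 't \<Rightarrow> complex)" where
  "schur_fun p q S T h =
     (\<lambda>y\<in>minor_idx p q S T. h y - h (fst y, q) * h (p, snd y) / h (p, q))"

lemma measurable_schur_fun [measurable]:
  assumes "p \<in> S" "q \<in> T"
  shows "schur_fun p q S T \<in> measurable (cprod (S \<times> T)) (cprod (minor_idx p q S T))"
  unfolding schur_fun_def
proof (rule measurable_restrict)
  fix y assume y: "y \<in> minor_idx p q S T"
  have *: "(\<lambda>h. h z) \<in> borel_measurable (cprod (S \<times> T))" if "z \<in> S \<times> T" for z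
    using measurable_component_singleton[OF that, of "\<lambda>_. lborel"] by simp
  have m: "(\<lambda>h. h y) \<in> borel_measurable (cprod (S \<times> T))"
      "(\<lambda>h. h (fst y, q)) \<in> borel_measurable (cprod (S \<times> T))"
      "(\<lambda>h. h (p, snd y)) \<in> borel_measurable (cprod (S \<times> T))"
      "(\<lambda>h. h (p, q)) \<in> borel_measurable (cprod (S \<times> T))"
    using y assms by (auto intro!: * simp: minor_idx_def)
  show "(\<lambda>h. h y - h (fst y, q) * h (p, snd y) / h (p, q)) \<in> measurable (cprod (S \<times> T)) lborel"
    using m by simp
qed

text \<open>With the pivot row and column fixed, the Schur complement is a translate of the remaining entries.\<close>

lemma nn_integral_cprod_pivot:
  assumes S: "finite S" "p \<in> S" and T: "finite T" "q \<in> T"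
    and F [measurable]: "F \<in> borel_measurable (cprod (cross p q S T))"
    and G [measurable]: "G \<in> borel_measurable (cprod (minor_idx p q S T))"
  shows "(\<integral>\<^sup>+h. F (restrict h (cross p q S T)) * G (schur_fun p q S T h) \<partial>cprod (S \<times> T)) =
     (\<integral>\<^sup>+h. F h \<partial>cprod (cross p q S T)) * (\<integral>\<^sup>+h. G h \<partial>cprod (minor_idx p q S T))"
proof -
  interpret product_sigma_finite "\<lambda>_. lborel :: complex measure"
    by (rule product_sigma_finite_lborel)
  let ?C = "cross p q S T" and ?R = "minor_idx p q S T"
  have un: "S \<times> T = ?C \<union> ?R" and disj: "?C \<inter> ?R = {}" and fin: "finite ?C" "finite ?R"
    using S T by (auto simp: cross_def minor_idx_def)
  have [measurable]: "schur_fun p q S T \<in> measurable (cprod (S \<times> T)) (cprod ?R)"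
    by (rule measurable_schur_fun) fact+
  have [measurable]: "(\<lambda>h. restrict h ?C) \<in> measurable (cprod (S \<times> T)) (cprod ?C)"
    by (rule measurable_restrict_subset) (auto simp: un)
  have "(\<lambda>h. F (restrict h ?C) * G (schur_fun p q S T h)) \<in> borel_measurable (cprod (S \<times> T))"
    by measurable
  hence "(\<integral>\<^sup>+h. F (restrict h ?C) * G (schur_fun p q S T h) \<partial>cprod (S \<times> T)) =
      (\<integral>\<^sup>+x. \<integral>\<^sup>+y. F (restrict (merge ?C ?R (x, y)) ?C) * G (schur_fun p q S T (merge ?C ?R (x, y)))
         \<partial>cprod ?R \<partial>cprod ?C)"
    unfolding un by (rule product_nn_integral_fold[OF disj fin])
  also have "\<dots> = (\<integral>\<^sup>+x. F x * (\<integral>\<^sup>+y. G y \<partial>cprod ?R) \<partial>cprod ?C)"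
  proof (rule nn_integral_cong)
    fix x assume x: "x \<in> space (cprod ?C)"
    define c where "c y = - x (fst y, q) * x (p, snd y) / x (p, q)" for y
    have 1: "restrict (merge ?C ?R (x, y)) ?C = x" for y
      using x disj by (auto simp: merge_def space_PiM PiE_iff extensional_def restrict_def)
    have 2: "schur_fun p q S T (merge ?C ?R (x, y)) = (\<lambda>i\<in>?R. y i + c i)" for y
    proof
      fix i
      show "schur_fun p q S T (merge ?C ?R (x, y)) i = (\<lambda>i\<in>?R. y i + c i) i"
      proof (cases "i \<in> ?R")
        case True
        hence "(fst i, q) \<in> ?C" "(p, snd i) \<in> ?C" "(p, q) \<in> ?C" "i \<notin> ?C"
          using S T by (cases i; simp add: cross_def minor_idx_def)+
        thus ?thesis using True by (simp add: schur_fun_def merge_def c_def)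
      qed (simp add: schur_fun_def)
    qed
    have "(\<integral>\<^sup>+y. F x * G (\<lambda>i\<in>?R. y i + c i) \<partial>cprod ?R) = F x * (\<integral>\<^sup>+y. G (\<lambda>i\<in>?R. y i + c i) \<partial>cprod ?R)"
      by (rule nn_integral_cmult) measurable
    thus "(\<integral>\<^sup>+y. F (restrict (merge ?C ?R (x, y)) ?C) * G (schur_fun p q S T (merge ?C ?R (x, y)))
        \<partial>cprod ?R) =
        F x * (\<integral>\<^sup>+y. G y \<partial>cprod ?R)"
      unfolding 1 2 by (simp add: nn_integral_cprod_translate[OF fin(2) G])
  qed
  also have "\<dots> = (\<integral>\<^sup>+x. F x \<partial>cprod ?C) * (\<integral>\<^sup>+y. G y \<partial>cprod ?R)"
    by (rule nn_integral_multc) measurable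
  finally show ?thesis .
qed

text \<open>The area of the unit disc, kept in the form in which \<open>emeasure_cball\<close>
  states it.\<close>

abbreviation disc_vol :: real where
  "disc_vol \<equiv> unit_ball_vol (real DIM(complex))"

text \<open>For a fixed value \<open>a\<close> of the dominant entry, every other entry ranges over
  the disc of radius \<open>cmod a\<close>. The exponent is one less than the size of the cross; the
  area element of \<open>a\<close> accounts for the missing factor.\<close>

lemma nn_integral_cprod_dominant:
  assumes C: "finite C" "o' \<notin> C" and [measurable]: "\<phi> \<in> borel_measurable borel"
  shows "(\<integral>\<^sup>+x. \<phi> (x o') * indicator {x. \<forall>i\<in>C. cmod (x i) \<le> cmod (x o')} x \<partial>cprod (insert o' C)) =
     (\<integral>\<^sup>+a. \<phi> a * ennreal ((disc_vol * (cmod a)\<^sup>2) ^ card C) \<partial>lborel)"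
proof -
  interpret product_sigma_finite "\<lambda>_. lborel :: complex measure"
    by (rule product_sigma_finite_lborel)
  have comp: "(\<lambda>h. h z) \<in> borel_measurable (cprod (insert o' C))" if "z \<in> insert o' C" for z
    using measurable_component_singleton[OF that, of "\<lambda>_. lborel"] by simp
  have [measurable]: "Measurable.pred (cprod (insert o' C)) (\<lambda>x. \<forall>i\<in>C. cmod (x i) \<le> cmod (x o'))"
    using C by (intro pred_intros_finite) (auto simp: pred_def intro!: borel_measurable_le
        borel_measurable_norm comp)
  have [measurable]: "(\<lambda>h. h o') \<in> borel_measurable (cprod (insert o' C))"
    by (rule comp) simp
  have "(\<lambda>x. \<phi> (x o') * indicator {x. \<forall>i\<in>C. cmod (x i) \<le> cmod (x o')} x)
      \<in> borel_measurable (cprod (insert o' C))"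
    by measurable
  hence "(\<integral>\<^sup>+x. \<phi> (x o') * indicator {x. \<forall>i\<in>C. cmod (x i) \<le> cmod (x o')} x \<partial>cprod (insert o' C)) =
     (\<integral>\<^sup>+a. \<integral>\<^sup>+x. \<phi> ((x(o' := a)) o') * indicator {x. \<forall>i\<in>C. cmod (x i) \<le> cmod (x o')} (x(o' := a))
         \<partial>cprod C \<partial>lborel)"
    by (rule product_nn_integral_insert_rev[OF C])
  also have "\<dots> = (\<integral>\<^sup>+a. \<phi> a * ennreal ((disc_vol * (cmod a)\<^sup>2) ^ card C) \<partial>lborel)"
  proof (rule nn_integral_cong)
    fix a :: complex
    have "(\<integral>\<^sup>+x. \<phi> ((x(o' := a)) o') * indicator {x. \<forall>i\<in>C. cmod (x i) \<le> cmod (x o')} (x(o' := a)) \<partial>cprod C) =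
       (\<integral>\<^sup>+x. \<phi> a * indicator (Pi\<^sub>E C (\<lambda>_. cball 0 (cmod a))) x \<partial>cprod C)"
      using C(2) by (intro nn_integral_cong) (auto simp: indicator_def space_PiM PiE_iff; metis)
    also have "\<dots> = \<phi> a * emeasure (cprod C) (Pi\<^sub>E C (\<lambda>_. cball 0 (cmod a)))"
      using C by (intro nn_integral_cmult_indicator sets_PiM_I_finite) auto
    also have "emeasure (cprod C) (Pi\<^sub>E C (\<lambda>_. cball 0 (cmod a))) = (\<Prod>i\<in>C. ennreal (disc_vol * (cmod a)\<^sup>2))"
      using C by (subst emeasure_PiM) (auto simp: emeasure_cball)
    also have "\<dots> = ennreal ((disc_vol * (cmod a)\<^sup>2) ^ card C)"
      by (simp add: ennreal_power)
    finally show "(\<integral>\<^sup>+x. \<phi> ((x(o' := a)) o') * indicator {x. \<forall>i\<in>C. cmod (x i) \<le> cmod (x o')} (x(o' :=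
        a)) \<partial>cprod C) =
       \<phi> a * ennreal ((disc_vol * (cmod a)\<^sup>2) ^ card C)" .
  qed
  finally show ?thesis .
qed

text \<open>Dyadic decomposition: on the shell between radii B / 2^(n+1) and B / 2^n the integrand
  is at most \<open>w n\<close>, and the area shrinks by a factor 4 per shell. The resulting
  geometric series has ratio \<open>q\<close>, which is below 1 exactly because
  \<open>e > -2\<close>.\<close>

lemma nn_integral_norm_powr_disc_neg:
  assumes e: "-2 < e" "e < 0"
  shows "\<exists>C\<ge>0. \<forall>B\<ge>1. (\<integral>\<^sup>+a. ennreal (indicator (cball 0 B - {0::complex}) a * cmod a powr e) \<partial>lborel) \<le>
      ennreal (C * B\<^sup>2)"
proof -
  define q where "q = 2 powr (- e - 2)"
  have q: "0 < q" "q < 1" using e by (auto simp: q_def powr_less_one)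
  define C where "C = disc_vol * 2 powr (- e) * (1 / (1 - q))"
  have "(\<integral>\<^sup>+a. ennreal (indicator (cball 0 B - {0::complex}) a * cmod a powr e) \<partial>lborel) \<le> ennreal (C * B\<^sup>2)"
    if B: "B \<ge> 1" for B
  proof -
    have suminf_ge: "f n \<le> suminf f" for f :: "nat \<Rightarrow> ennreal" and n
      using sum_le_suminf[of f "{n}"] by simp
    \<comment> \<open>The factor \<open>B powr e\<close> is dropped; it is at most 1 because
      \<open>e < 0\<close> and \<open>B \<ge> 1\<close>.\<close>
    define w :: "nat \<Rightarrow> real" where "w n = (1 / 2 ^ Suc n) powr e" for n
    have ptw: "ennreal (indicator (cball 0 B - {0::complex}) a * cmod a powr e) \<le>
        (\<Sum>n. ennreal (w n) * indicator (cball 0 (B / 2 ^ n)) a)" for a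
    proof (cases "a \<in> cball 0 B - {0}")
      case True
      hence a: "0 < cmod a" "cmod a \<le> B" by auto
      define n where "n = (LEAST n. B / 2 ^ Suc n < cmod a)"
      have "\<exists>n. B / 2 ^ Suc n < cmod a"
      proof -
        obtain n where "(1/2) ^ n < cmod a / B"
          using real_arch_pow_inv[of "cmod a / B" "1/2"] a B by auto
        hence "B / 2 ^ n < cmod a"
          using B by (simp add: field_simps power_one_over)
        moreover have "B / 2 ^ Suc n \<le> B / 2 ^ n" using B by (simp add: field_simps)
        ultimately show ?thesis by (metis order.strict_trans1)
      qed
      hence n1: "B / 2 ^ Suc n < cmod a" unfolding n_def by (rule LeastI_ex)
      have n2: "cmod a \<le> B / 2 ^ n"
      proof (cases n)
        case (Suc m)
        have "\<not> B / 2 ^ Suc m < cmod a"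
          by (rule not_less_Least) (use Suc in \<open>simp add: n_def\<close>)
        thus ?thesis by (simp add: Suc)
      qed (use a in auto)
      have "1 / 2 ^ Suc n \<le> B / 2 ^ Suc n" using B by (intro divide_right_mono) auto
      hence "cmod a powr e \<le> w n"
        unfolding w_def using e n1 by (intro powr_mono2') auto
      hence "ennreal (indicator (cball 0 B - {0::complex}) a * cmod a powr e) \<le> ennreal (w n) *
          indicator (cball 0 (B / 2 ^ n)) a"
        using True n2 by (simp add: ennreal_leI)
      also have "\<dots> \<le> (\<Sum>n. ennreal (w n) * indicator (cball 0 (B / 2 ^ n)) a)"
        by (rule suminf_ge)
      finally show ?thesis .
    qed simp
    have shell: "ennreal (w n) * ennreal (disc_vol * (B / 2 ^ n)\<^sup>2) = ennreal (disc_vol * 2 powr (- e) *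
        B\<^sup>2 * q ^ n)" for n
    proof -
      have "(1 :: real) / 2 ^ Suc n = 2 powr (- real (Suc n))"
        by (subst powr_minus, subst powr_realpow) (auto simp: field_simps)
      hence "w n = 2 powr (- e * real (Suc n))"
        unfolding w_def by (simp only: powr_powr) (simp add: algebra_simps)
      also have "\<dots> = 2 powr (- e) * 2 powr (- e * real n)"
        by (simp add: powr_add[symmetric] algebra_simps)
      finally have w: "w n = 2 powr (- e) * 2 powr (- e * real n)" .
      have qn: "q ^ n = 2 powr (- e * real n) / (2 ^ n)\<^sup>2"
      proof -
        have "q ^ n = 2 powr ((- e - 2) * real n)"
          unfolding q_def by (simp add: powr_powr flip: powr_realpow)
        also have "\<dots> = 2 powr (- e * real n) / 2 powr (real (2 * n))"
          by (simp add: powr_diff[symmetric] algebra_simps)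
        also have "2 powr real (2 * n) = (2 ^ n)\<^sup>2"
          by (subst powr_realpow) (auto simp: power_mult mult.commute power_even_eq)
        finally show ?thesis .
      qed
      show ?thesis
        by (subst ennreal_mult[symmetric]) (auto simp: w qn power_divide)
    qed
    have "(\<integral>\<^sup>+a. ennreal (indicator (cball 0 B - {0::complex}) a * cmod a powr e) \<partial>lborel) \<le>
        (\<integral>\<^sup>+a. (\<Sum>n. ennreal (w n) * indicator (cball 0 (B / 2 ^ n)) (a::complex)) \<partial>lborel)"
      by (intro nn_integral_mono ptw)
    also have "\<dots> = (\<Sum>n. \<integral>\<^sup>+a. ennreal (w n) * indicator (cball 0 (B / 2 ^ n)) (a::complex) \<partial>lborel)"
      by (intro nn_integral_suminf borel_measurable_times_ennreal borel_measurable_const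
          borel_measurable_indicator) auto
    also have "\<dots> = (\<Sum>n. ennreal (w n) * ennreal (disc_vol * (B / 2 ^ n)\<^sup>2))"
      using B by (subst nn_integral_cmult_indicator) (auto simp: emeasure_cball)
    also have "\<dots> = (\<Sum>n. ennreal (disc_vol * 2 powr (- e) * B\<^sup>2 * q ^ n))"
      by (simp only: shell)
    also have "\<dots> = ennreal (disc_vol * 2 powr (- e) * B\<^sup>2 * (1 / (1 - q)))"
      using q by (intro suminf_ennreal_eq sums_mult geometric_sums) auto
    finally show ?thesis by (simp add: C_def mult_ac)
  qed
  thus ?thesis using q by (intro exI[of _ C]) (auto simp: C_def)
qed

lemma nn_integral_norm_powr_disc:
  assumes e: "-2 < e"
  shows "\<exists>C\<ge>0. \<exists>K::nat. \<forall>B\<ge>1. (\<integral>\<^sup>+a. ennreal (indicator (cball 0 B - {0::complex}) a * cmod a powr e)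
      \<partial>lborel) \<le> ennreal (C * B ^ K)"
proof (cases "e < 0")
  case True
  thus ?thesis using nn_integral_norm_powr_disc_neg[OF e True] by blast
next
  case False
  define K where "K = nat \<lceil>e\<rceil>"
  have "(\<integral>\<^sup>+a. ennreal (indicator (cball 0 B - {0::complex}) a * cmod a powr e) \<partial>lborel) \<le> ennreal
      (disc_vol * B ^ (K + 2))"
    if B: "B \<ge> 1" for B
  proof -
    have "cmod a powr e \<le> B ^ K" if "0 < cmod a" "cmod a \<le> B" for a
    proof -
      have "cmod a powr e \<le> B powr e" using that False by (intro powr_mono2) auto
      also have "\<dots> \<le> B powr real K" using B by (intro powr_mono) (auto simp: K_def real_nat_ceiling_ge)
      finally show ?thesis using B by (simp add: powr_realpow)
    qed
    hence "(\<integral>\<^sup>+a. ennreal (indicator (cball 0 B - {0::complex}) a * cmod a powr e) \<partial>lborel) \<le>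
        (\<integral>\<^sup>+a. ennreal (B ^ K) * indicator (cball 0 B) (a :: complex) \<partial>lborel)"
      using B by (intro nn_integral_mono) (auto simp: indicator_def ennreal_leI)
    also have "\<dots> = ennreal (B ^ K) * ennreal (disc_vol * B\<^sup>2)"
      using B by (subst nn_integral_cmult_indicator) (auto simp: emeasure_cball)
    also have "\<dots> = ennreal (disc_vol * B ^ (K + 2))"
      using B by (subst ennreal_mult[symmetric]) (auto simp: power_add power2_eq_square mult_ac)
    finally show ?thesis .
  qed
  thus ?thesis by (intro exI[of _ disc_vol] conjI exI[of _ "K + 2"]) auto
qed

text \<open>For 0 \<le> \<mu> \<le> s, \<open>max 1 y powr (-s)\<close> is at most
  \<open>y powr (-\<mu>)\<close>, which splits off the power of \<open>x\<close>. What remains is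
  \<open>cmod a\<close> to the power 2 L - 2 \<mu>, integrable at the origin in the plane exactly
  when \<mu> < L + 1. Here \<open>L\<close> does not count the pivot.\<close>

lemma nn_integral_pivot_le:
  fixes L :: nat and \<mu> s :: real
  assumes mu: "0 \<le> \<mu>" "\<mu> \<le> s" "\<mu> < real (Suc L)"
  shows "\<exists>C\<ge>0. \<exists>K::nat. \<forall>x>0. \<forall>B\<ge>1.
    (\<integral>\<^sup>+a. ennreal (indicator (cball 0 B) a * max 1 (x * (cmod a)\<^sup>2) powr (- s)) *
        ennreal ((disc_vol * (cmod (a::complex))\<^sup>2) ^ L) \<partial>lborel)
      \<le> ennreal (C * B ^ K * x powr (- \<mu>))"
proof -
  define e where "e = 2 * real L - 2 * \<mu>"
  have "-2 < e" using mu by (simp add: e_def)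
  then obtain C K where C: "C \<ge> 0" and CK: "\<And>B. B \<ge> 1 \<Longrightarrow>
      (\<integral>\<^sup>+a. ennreal (indicator (cball 0 B - {0::complex}) a * cmod a powr e) \<partial>lborel) \<le> ennreal (C * B ^ K)"
    using nn_integral_norm_powr_disc by blast
  have "(\<integral>\<^sup>+a. ennreal (indicator (cball 0 B) a * max 1 (x * (cmod a)\<^sup>2) powr (- s)) *
        ennreal ((disc_vol * (cmod (a::complex))\<^sup>2) ^ L) \<partial>lborel)
      \<le> ennreal (disc_vol ^ L * C * B ^ K * x powr (- \<mu>))" if x: "x > 0" and B: "B \<ge> 1" for x B
  proof -
    have "(\<integral>\<^sup>+a. ennreal (indicator (cball 0 B) a * max 1 (x * (cmod a)\<^sup>2) powr (- s)) *
        ennreal ((disc_vol * (cmod (a::complex))\<^sup>2) ^ L) \<partial>lborel) \<le>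
      (\<integral>\<^sup>+a. ennreal (disc_vol ^ L * x powr (- \<mu>)) *
         ennreal (indicator (cball 0 B - {0::complex}) a * cmod a powr e) \<partial>lborel)"
    proof (rule nn_integral_mono_AE)
      have "AE a in lborel. a \<noteq> (0::complex)"
        by (rule AE_lborel_singleton)
      thus "AE a in lborel. ennreal (indicator (cball 0 B) a * max 1 (x * (cmod a)\<^sup>2) powr (- s)) *
        ennreal ((disc_vol * (cmod (a::complex))\<^sup>2) ^ L) \<le> ennreal (disc_vol ^ L * x powr (- \<mu>)) *
         ennreal (indicator (cball 0 B - {0::complex}) a * cmod a powr e)"
      proof eventually_elim
        case (elim a)
        have "max 1 (x * (cmod a)\<^sup>2) powr (- s) \<le> max 1 (x * (cmod a)\<^sup>2) powr (- \<mu>)"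
          using mu by (intro powr_mono) auto
        also have "\<dots> \<le> (x * (cmod a)\<^sup>2) powr (- \<mu>)"
          using mu x elim by (intro powr_mono2') auto
        also have "\<dots> = (x * cmod a powr 2) powr (- \<mu>)" using elim by simp
        also have "\<dots> = x powr (- \<mu>) * cmod a powr (- 2 * \<mu>)"
          using x by (simp add: powr_mult powr_powr del: powr_numeral)
        finally have 1: "max 1 (x * (cmod a)\<^sup>2) powr (- s) \<le> x powr (- \<mu>) * cmod a powr (- 2 * \<mu>)" .
        have "cmod a powr real (2 * L) = cmod a ^ (2 * L)"
          using elim by (intro powr_realpow) auto
        hence 2: "(disc_vol * (cmod a)\<^sup>2) ^ L = disc_vol ^ L * cmod a powr (2 * real L)"
          by (simp add: power_mult_distrib power_mult)
        have 3: "max 1 (x * (cmod a)\<^sup>2) powr (- s) * (disc_vol * (cmod a)\<^sup>2) ^ L \<le>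
            disc_vol ^ L * x powr (- \<mu>) * cmod a powr e"
        proof -
          have "max 1 (x * (cmod a)\<^sup>2) powr (- s) * (disc_vol * (cmod a)\<^sup>2) ^ L \<le>
             x powr (- \<mu>) * cmod a powr (- 2 * \<mu>) * (disc_vol * (cmod a)\<^sup>2) ^ L"
            by (intro mult_right_mono 1) auto
          also have "\<dots> = disc_vol ^ L * x powr (- \<mu>) * (cmod a powr (2 * real L) * cmod a powr (- 2 * \<mu>))"
            unfolding 2 by (simp add: mult_ac)
          also have "cmod a powr (2 * real L) * cmod a powr (- 2 * \<mu>) = cmod a powr e"
            by (simp add: e_def powr_add[symmetric])
          finally show ?thesis .
        qed
        show ?case
          using 3 elim by (subst (1 2) ennreal_mult[symmetric]) (auto simp: indicator_def intro!: ennreal_leI)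
      qed
    qed
    also have "\<dots> = ennreal (disc_vol ^ L * x powr (- \<mu>)) *
        (\<integral>\<^sup>+a. ennreal (indicator (cball 0 B - {0::complex}) a * cmod a powr e) \<partial>lborel)"
    proof (rule nn_integral_cmult)
      have [measurable]: "cball 0 B - {0::complex} \<in> sets borel" by (intro sets.Diff) auto
      show "(\<lambda>a. ennreal (indicator (cball 0 B - {0::complex}) a * cmod a powr e)) \<in> borel_measurable lborel"
        by measurable
    qed
    also have "\<dots> \<le> ennreal (disc_vol ^ L * x powr (- \<mu>)) * ennreal (C * B ^ K)"
      by (intro mult_left_mono CK B) auto
    also have "\<dots> = ennreal (disc_vol ^ L * C * B ^ K * x powr (- \<mu>))"
      using C B by (subst ennreal_mult[symmetric]) (auto simp: mult_ac)
    finally show ?thesis .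
  qed
  thus ?thesis using C by (intro exI[of _ "disc_vol ^ L * C"] conjI exI[of _ K]) auto
qed

section \<open>Negative moments of the determinant\<close>

text \<open>Padding with zeros keeps all sub-problems in one matrix type, matching the form in which
  \<open>schur\<close> leaves a zero row and column.\<close>

definition mat_of :: "'r set \<Rightarrow> 't set \<Rightarrow> ('r \<times> 't \<Rightarrow> complex) \<Rightarrow> complex^'t::finite^'r::finite" where
  "mat_of S T h = (\<chi> i j. if i \<in> S \<and> j \<in> T then h (i, j) else 0)"

text \<open>The disjunction excludes a zero pivot in a nonzero matrix, where \<open>schur\<close>
  would leave row \<open>p\<close> and column \<open>q\<close> in place.\<close>

lemma schur_mat_of:
  fixes S :: "'r::finite set" and T :: "'t::finite set"
  assumes "p \<in> S" "q \<in> T"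
    and "h (p, q) \<noteq> 0 \<or> (\<forall>i\<in>S \<times> T. h i = 0)"
  shows "schur p q (mat_of S T h) = mat_of (S - {p}) (T - {q}) (schur_fun p q S T h)"
  using assms by (auto simp: vec_eq_iff schur_def mat_of_def schur_fun_def minor_idx_def)

lemma borel_measurable_gram_det:
  fixes M :: "'a \<Rightarrow> complex^'t::finite^'r::finite"
  assumes [measurable]: "\<And>i j. (\<lambda>\<omega>. M \<omega> $ i $ j) \<in> borel_measurable N"
  shows "(\<lambda>\<omega>. gram_det x (M \<omega>)) \<in> borel_measurable N"
proof -
  have "(\<lambda>\<omega>. cnj (M \<omega> $ i $ j)) \<in> borel_measurable N" for i j
    by (rule measurable_compose[OF assms]) (intro borel_measurable_continuous_onI continuous_intros)
  hence [measurable]: "(\<lambda>\<omega>. (mat 1 + x *\<^sub>R (M \<omega> ** hconj (M \<omega>))) $ i $ j) \<in> borel_measurable N" for i j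
    by (simp add: matrix_matrix_mult_def hconj_def)
  show ?thesis
    unfolding gram_det_def det_def by measurable
qed

lemma borel_measurable_gram_det_mat_of:
  "(\<lambda>h. gram_det x (mat_of S T h)) \<in> borel_measurable (cprod (S \<times> T))"
proof (rule borel_measurable_gram_det)
  fix i j
  show "(\<lambda>h. mat_of S T h $ i $ j) \<in> borel_measurable (cprod (S \<times> T))"
    using measurable_component_singleton[of "(i, j)" "S \<times> T" "\<lambda>_. lborel :: complex measure"]
    by (cases "i \<in> S \<and> j \<in> T") (auto simp: mat_of_def)
qed

lemma gram_det_zero [simp]: "gram_det x 0 = 1"
proof -
  have "(0 :: complex^'a^'b) ** X = 0" for X :: "complex^'b^'a"
    by (simp add: matrix_matrix_mult_def vec_eq_iff)
  thus ?thesis by (simp add: gram_det_def)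
qed

text \<open>\<open>\<mu>\<close> is evaluated at the sizes m + n - 1, m + n - 3, ... of the crosses
  removed by successive eliminations. With the successors in the pattern, the size of the current
  cross is \<open>Suc (m + n)\<close>.\<close>

fun pivot_sum :: "(nat \<Rightarrow> real) \<Rightarrow> nat \<Rightarrow> nat \<Rightarrow> real" where
  "pivot_sum \<mu> (Suc m) (Suc n) = \<mu> (Suc (m + n)) + pivot_sum \<mu> m n"
| "pivot_sum \<mu> _ _ = 0"

lemma cross_insert:
  "p \<in> S \<Longrightarrow> q \<in> T \<Longrightarrow> cross p q S T = insert (p, q) (cross p q S T - {(p, q)})"
  by (auto simp: cross_def)

lemma card_cross:
  assumes "finite S" "finite T" "p \<in> S" "q \<in> T" "card S = Suc m" "card T = Suc n"
  shows "card (cross p q S T - {(p, q)}) = m + n" "finite (cross p q S T - {(p, q)})"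
proof -
  have "cross p q S T - {(p, q)} = {p} \<times> (T - {q}) \<union> (S - {p}) \<times> {q}"
    using assms by (auto simp: cross_def)
  moreover have "card \<dots> = card ({p} \<times> (T - {q})) + card ((S - {p}) \<times> {q})"
    using assms by (intro card_Un_disjoint) auto
  ultimately show "card (cross p q S T - {(p, q)}) = m + n"
    using assms by (simp add: card_cartesian_product)
  show "finite (cross p q S T - {(p, q)})" using assms by (auto simp: cross_def)
qed

lemma mat_of_empty:
  fixes S :: "'r::finite set" and T :: "'t::finite set"
  assumes "S \<times> T = {}"
  shows "mat_of S T h = 0"
  using assms by (auto simp: vec_eq_iff mat_of_def)

lemma pred_cmod_le:
  assumes "finite I" "I \<subseteq> J" "\<And>i. i \<in> I \<Longrightarrow> (\<lambda>h. f h i) \<in> borel_measurable (cprod J)"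
  shows "Measurable.pred (cprod J) (\<lambda>h. \<forall>i\<in>I. cmod (h i) \<le> f h i)"
  using assms measurable_component_singleton[of _ J "\<lambda>_. lborel :: complex measure"]
  by (intro pred_intros_finite) (auto simp: pred_def intro!: borel_measurable_le borel_measurable_norm)

lemma gram_det_powr_pivot_le:
  fixes H :: "complex^'t::finite^'r::finite"
  assumes x: "x \<ge> 0" and s: "s \<ge> 0" and le: "\<And>i j. cmod (H $ i $ j) \<le> cmod (H $ p $ q)"
  defines "c \<equiv> fact CARD('r) * real CARD('r \<Rightarrow> 'r + 't) * (fact CARD('r) * 2 ^ CARD('r))\<^sup>2"
  shows "gram_det x H powr (- s) \<le>
    c powr s * (max 1 (x * (cmod (H $ p $ q))\<^sup>2) powr (- s) * gram_det x (schur p q H) powr (- s))"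
proof -
  have c: "c > 0" by (simp add: c_def)
  define D where "D = gram_det x (schur p q H)"
  define X where "X = max 1 (x * (cmod (H $ p $ q))\<^sup>2)"
  have pos: "D > 0" "X > 0" using gram_det_pos[OF x] by (auto simp: D_def X_def)
  have "D * X \<le> c * gram_det x H"
    unfolding D_def X_def c_def by (rule gram_det_schur_le[OF x le])
  hence "gram_det x H powr (- s) \<le> (D * X / c) powr (- s)"
    using c s pos by (intro powr_mono2') (auto simp: field_simps)
  also have "\<dots> = c powr s * (X powr (- s) * D powr (- s))"
    using c pos by (simp add: powr_divide powr_mult powr_minus field_simps)
  finally show ?thesis by (simp add: D_def X_def)
qed

lemma nn_integral_gram_det_powr_empty:
  fixes S :: "'r::finite set" and T :: "'t::finite set"
  assumes "S \<times> T = {}" "x > 0" "e = 0"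
  shows "(\<integral>\<^sup>+h. indicator {h. \<forall>i\<in>S \<times> T. cmod (h i) \<le> B} h *
      ennreal (gram_det x (mat_of S T h) powr (- s)) \<partial>cprod (S \<times> T)) \<le> ennreal (1 * B ^ 0 * x powr (- e))"
  unfolding assms(1) mat_of_empty[OF assms(1)] using assms(2,3)
  by (simp add: product_sigma_finite.nn_integral_empty[OF product_sigma_finite_lborel] space_PiM)

text \<open>Union bound over the position of the largest entry, which serves as the pivot. The bound has
to be polynomial in \<open>B\<close>, because the entries of the Schur complement are only bounded by \<open>2 B\<close> and
the Gaussian tail is later summed over all \<open>B\<close>.\<close>

lemma nn_integral_gram_det_powr_le:
  fixes s :: real and \<mu> :: "nat \<Rightarrow> real"
  assumes mu: "\<And>L. L \<ge> 1 \<Longrightarrow> 0 \<le> \<mu> L \<and> \<mu> L \<le> s \<and> \<mu> L < real L"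
  shows "\<exists>C\<ge>0. \<exists>K::nat. \<forall>(S :: 'r::finite set) (T :: 't::finite set). card S = m \<longrightarrow> card T = n \<longrightarrow>
    (\<forall>x>0. \<forall>B\<ge>1. (\<integral>\<^sup>+h. indicator {h. \<forall>i\<in>S \<times> T. cmod (h i) \<le> B} h *
        ennreal (gram_det x (mat_of S T h) powr (- s)) \<partial>cprod (S \<times> T))
      \<le> ennreal (C * B ^ K * x powr (- pivot_sum \<mu> m n)))"
proof (induction m arbitrary: n)
  case (Suc m n')
  show ?case
  proof (cases n')
    case 0
    thus ?thesis
      by (intro exI[of _ "1::real"] conjI exI[of _ "0::nat"] allI impI nn_integral_gram_det_powr_empty) auto
  next
    case (Suc n)
    have s: "s \<ge> 0" using mu[of 1] by simp
    obtain C1 K1 where C1: "C1 \<ge> 0" and CK1: "\<And>x B. x > 0 \<Longrightarrow> B \<ge> 1 \<Longrightarrow>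
      (\<integral>\<^sup>+a. ennreal (indicator (cball 0 B) a * max 1 (x * (cmod a)\<^sup>2) powr (- s)) *
          ennreal ((disc_vol * (cmod (a::complex))\<^sup>2) ^ (m + n)) \<partial>lborel)
        \<le> ennreal (C1 * B ^ K1 * x powr (- \<mu> (Suc (m + n))))"
      using nn_integral_pivot_le[of "\<mu> (Suc (m + n))" s "m + n"] mu[of "Suc (m + n)"] by auto
    \<comment> \<open>The constants depend on the dimensions alone, so one pair serves every pivot
      position.\<close>
    obtain C2 K2 where C2: "C2 \<ge> 0" and CK2: "\<And>(S :: 'r set) (T :: 't set) x B.
      card S = m \<Longrightarrow> card T = n \<Longrightarrow> x > 0 \<Longrightarrow> B \<ge> 1 \<Longrightarrow>
      (\<integral>\<^sup>+h. indicator {h. \<forall>i\<in>S \<times> T. cmod (h i) \<le> B} h *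
        ennreal (gram_det x (mat_of S T h) powr (- s)) \<partial>cprod (S \<times> T))
      \<le> ennreal (C2 * B ^ K2 * x powr (- pivot_sum \<mu> m n))"
      using Suc.IH[of n] by blast
    define c where "c = fact CARD('r) * real CARD('r \<Rightarrow> 'r + 't) * (fact CARD('r) * 2 ^ CARD('r))\<^sup>2"
    define C where "C = real (Suc m) * real (Suc n) * (c powr s * (C1 * (C2 * 2 ^ K2)))"
    have "(\<integral>\<^sup>+h. indicator {h. \<forall>i\<in>S \<times> T. cmod (h i) \<le> B} h *
        ennreal (gram_det x (mat_of S T h) powr (- s)) \<partial>cprod (S \<times> T))
      \<le> ennreal (C * B ^ (K1 + K2) * x powr (- pivot_sum \<mu> (Suc m) n'))"
      if S: "card S = Suc m" and T: "card T = n'" and x: "x > 0" and B: "B \<ge> 1"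
      for S :: "'r set" and T :: "'t set" and x B
    proof -
      have T': "card T = Suc n" using T Suc by simp
      define \<phi> where "\<phi> a = ennreal (indicator (cball 0 B) a * max 1 (x * (cmod a)\<^sup>2) powr (- s))" for a
          :: complex
      \<comment> \<open>\<open>F\<close> sees only the cross and \<open>G\<close> only the Schur
        complement, so their product integrates to a product: a one-variable pivot integral times
        the smaller problem.\<close>
      define F where "F p q h = \<phi> (h (p, q)) *
        indicator {h. \<forall>i\<in>cross p q S T - {(p, q)}. cmod (h i) \<le> cmod (h (p, q))} h"
        for p q and h :: "'r \<times> 't \<Rightarrow> complex"
      define G where "G p q h = indicator {h. \<forall>i\<in>(S - {p}) \<times> (T - {q}). cmod (h i) \<le> 2 * B} h *
        ennreal (gram_det x (mat_of (S - {p}) (T - {q}) h) powr (- s))" for p q and h :: "'r \<times> 't \<Rightarrow> complex"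
      define FG where "FG = (\<lambda>(p, q) h. F p q (restrict h (cross p q S T)) * G p q (schur_fun p q S T h))"
      have [measurable]: "\<phi> \<in> borel_measurable borel"
        unfolding \<phi>_def
        by (intro measurable_compose[OF _ measurable_ennreal] borel_measurable_times
            borel_measurable_indicator
            powr_real_measurable borel_measurable_max borel_measurable_power borel_measurable_norm) auto
      have F_meas [measurable]: "F p q \<in> borel_measurable (cprod (cross p q S T))" if "p \<in> S" "q \<in> T" for p q
      proof -
        have "(\<lambda>h. h (p, q)) \<in> borel_measurable (cprod (cross p q S T))"
          using measurable_component_singleton[of "(p, q)" "cross p q S T" "\<lambda>_. lborel :: complex
              measure"] that
          by (auto simp: cross_def)
        note [measurable] = this
        have [measurable]: "Measurable.pred (cprod (cross p q S T))
            (\<lambda>h. \<forall>i\<in>cross p q S T - {(p, q)}. cmod (h i) \<le> cmod (h (p, q)))"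
          by (rule pred_cmod_le) auto
        show ?thesis unfolding F_def by measurable
      qed
      have G_meas [measurable]: "G p q \<in> borel_measurable (cprod (minor_idx p q S T))" for p q
      proof -
        have [measurable]: "Measurable.pred (cprod ((S - {p}) \<times> (T - {q})))
            (\<lambda>h. \<forall>i\<in>(S - {p}) \<times> (T - {q}). cmod (h i) \<le> 2 * B)"
          by (rule pred_cmod_le) auto
        note borel_measurable_gram_det_mat_of [measurable]
        show ?thesis unfolding G_def minor_idx_def by measurable
      qed
      have FG_meas: "FG pq \<in> borel_measurable (cprod (S \<times> T))" if "pq \<in> S \<times> T" for pq
      proof (cases pq)
        case (Pair p q)
        hence pq: "p \<in> S" "q \<in> T" using that by auto
        have [measurable]: "(\<lambda>h. restrict h (cross p q S T)) \<in> measurable (cprod (S \<times> T)) (cprod (cross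
            p q S T))"
          by (rule measurable_restrict_subset) (use pq in \<open>auto simp: cross_def\<close>)
        note measurable_schur_fun[OF pq, measurable] F_meas[OF pq, measurable]
        show ?thesis unfolding FG_def Pair prod.case by measurable
      qed
      have FG_int: "(\<integral>\<^sup>+h. FG pq h \<partial>cprod (S \<times> T)) \<le>
          ennreal (C1 * (C2 * 2 ^ K2) * B ^ (K1 + K2) * x powr (- pivot_sum \<mu> (Suc m) n'))" if "pq \<in> S \<times>
              T" for pq
      proof (cases pq)
        case (Pair p q)
        hence pq: "p \<in> S" "q \<in> T" using that by auto
        note card = card_cross[OF finite finite pq S T']
        have "(\<integral>\<^sup>+h. FG pq h \<partial>cprod (S \<times> T)) =
            (\<integral>\<^sup>+h. F p q h \<partial>cprod (cross p q S T)) * (\<integral>\<^sup>+h. G p q h \<partial>cprod (minor_idx p q S T))"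
          unfolding FG_def Pair prod.case
          by (rule nn_integral_cprod_pivot) (use pq in \<open>auto intro: F_meas G_meas\<close>)
        also have "(\<integral>\<^sup>+h. F p q h \<partial>cprod (cross p q S T)) =
            (\<integral>\<^sup>+a. \<phi> a * ennreal ((disc_vol * (cmod (a::complex))\<^sup>2) ^ (m + n)) \<partial>lborel)"
          unfolding F_def card(1)[symmetric]
          by (subst cross_insert[OF pq]) (rule nn_integral_cprod_dominant, use card(2) in auto)
        also have "\<dots> \<le> ennreal (C1 * B ^ K1 * x powr (- \<mu> (Suc (m + n))))"
          unfolding \<phi>_def by (rule CK1[OF x B])
        also have "(\<integral>\<^sup>+h. G p q h \<partial>cprod (minor_idx p q S T)) \<le> ennreal (C2 * (2 * B) ^ K2 * x powr (-
            pivot_sum \<mu> m n))"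
          unfolding G_def minor_idx_def by (rule CK2) (use pq S T' x B in auto)
        finally have "(\<integral>\<^sup>+h. FG pq h \<partial>cprod (S \<times> T)) \<le> ennreal (C1 * B ^ K1 * x powr (- \<mu> (Suc (m + n)))) *
            ennreal (C2 * (2 * B) ^ K2 * x powr (- pivot_sum \<mu> m n))"
          by (simp add: mult_mono mult_right_mono mult_left_mono)
        also have "\<dots> = ennreal (C1 * (C2 * 2 ^ K2) * B ^ (K1 + K2) * x powr (- pivot_sum \<mu> (Suc m) n'))"
          using C1 C2 B x unfolding Suc
          by (subst ennreal_mult[symmetric]) (auto simp: power_add power_mult_distrib
              powr_add[symmetric] mult_ac powr_diff powr_minus field_simps)
        finally show ?thesis .
      qed
      \<comment> \<open>The summand at the position of the largest entry already dominates the
        left-hand side.\<close>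
      have ptw: "indicator {h. \<forall>i\<in>S \<times> T. cmod (h i) \<le> B} h * ennreal (gram_det x (mat_of S T h) powr (- s))
          \<le> ennreal (c powr s) * (\<Sum>pq\<in>S \<times> T. FG pq h)" for h
      proof (cases "\<forall>i\<in>S \<times> T. cmod (h i) \<le> B")
        case True
        have "Max ((\<lambda>i. cmod (h i)) ` (S \<times> T)) \<in> (\<lambda>i. cmod (h i)) ` (S \<times> T)"
          using S T' by (intro Max_in) auto
        then obtain pq where pq_in: "pq \<in> S \<times> T" and pq_max: "Max ((\<lambda>i. cmod (h i)) ` (S \<times> T)) = cmod (h pq)"
          by auto
        obtain p q where Pair: "pq = (p, q)" by (cases pq)
        have pq: "p \<in> S" "q \<in> T" using pq_in Pair by auto
        have max: "cmod (h i) \<le> cmod (h (p, q))" if "i \<in> S \<times> T" for i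
          using Max_ge[of "(\<lambda>i. cmod (h i)) ` (S \<times> T)" "cmod (h i)"] that pq_max Pair by auto
        define H where "H = mat_of S T h"
        have H_pq: "H $ p $ q = h (p, q)" using pq by (simp add: H_def mat_of_def)
        have H_le: "cmod (H $ i $ j) \<le> cmod (H $ p $ q)" for i j
          unfolding H_pq using max by (auto simp: H_def mat_of_def)
        \<comment> \<open>If the largest entry is zero, all entries are, which is the second
          alternative of \<open>schur_mat_of\<close>.\<close>
        have schur_H: "schur p q H = mat_of (S - {p}) (T - {q}) (schur_fun p q S T h)"
          unfolding H_def by (rule schur_mat_of[OF pq]) (use max in force)
        have hB: "cmod (h (p, q)) \<le> B" using True pq by auto
        have sf: "cmod (schur_fun p q S T h i) \<le> 2 * B" if "i \<in> (S - {p}) \<times> (T - {q})" for i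
        proof -
          have "schur_fun p q S T h i = schur p q H $ fst i $ snd i"
            unfolding schur_H using that by (cases i) (auto simp: mat_of_def)
          hence "cmod (schur_fun p q S T h i) \<le> 2 * cmod (H $ p $ q)"
            using cmod_schur_le[OF H_le] by simp
          thus ?thesis using hB H_pq by simp
        qed
        have "(p, q) \<in> cross p q S T" "cross p q S T \<subseteq> S \<times> T" using pq by (auto simp: cross_def)
        hence F_eq: "F p q (restrict h (cross p q S T)) = ennreal (max 1 (x * (cmod (H $ p $ q))\<^sup>2) powr
            (- s))"
          using max hB by (auto simp: F_def \<phi>_def H_pq indicator_def)
        have G_eq: "G p q (schur_fun p q S T h) = ennreal (gram_det x (schur p q H) powr (- s))"
          using sf by (simp add: G_def schur_H)
        have "ennreal (gram_det x H powr (- s)) \<le>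
            ennreal (c powr s * (max 1 (x * (cmod (H $ p $ q))\<^sup>2) powr (- s) * gram_det x (schur p q H)
                powr (- s)))"
          unfolding c_def using x s by (intro ennreal_leI gram_det_powr_pivot_le H_le) auto
        also have "\<dots> = ennreal (c powr s) * FG pq h"
          unfolding FG_def Pair prod.case F_eq G_eq by (simp add: ennreal_mult)
        also have "FG pq h \<le> (\<Sum>pq\<in>S \<times> T. FG pq h)"
          using pq_in by (intro member_le_sum) auto
        finally have "ennreal (gram_det x H powr (- s)) \<le> ennreal (c powr s) * (\<Sum>pq\<in>S \<times> T. FG pq h)"
          by (simp add: mult_left_mono)
        thus ?thesis using True by (simp add: H_def)
      qed (auto simp: indicator_def)
      have "(\<integral>\<^sup>+h. indicator {h. \<forall>i\<in>S \<times> T. cmod (h i) \<le> B} h *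
          ennreal (gram_det x (mat_of S T h) powr (- s)) \<partial>cprod (S \<times> T))
        \<le> (\<integral>\<^sup>+h. ennreal (c powr s) * (\<Sum>pq\<in>S \<times> T. FG pq h) \<partial>cprod (S \<times> T))"
        by (intro nn_integral_mono ptw)
      also have "\<dots> = ennreal (c powr s) * (\<Sum>pq\<in>S \<times> T. \<integral>\<^sup>+h. FG pq h \<partial>cprod (S \<times> T))"
        by (subst nn_integral_cmult) (auto intro!: borel_measurable_sum FG_meas nn_integral_sum simp:
            nn_integral_sum FG_meas)
      also have "\<dots> \<le> ennreal (c powr s) * (\<Sum>pq\<in>S \<times> T.
          ennreal (C1 * (C2 * 2 ^ K2) * B ^ (K1 + K2) * x powr (- pivot_sum \<mu> (Suc m) n')))"
        by (intro mult_left_mono sum_mono FG_int) auto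
      also have "\<dots> = ennreal (C * B ^ (K1 + K2) * x powr (- pivot_sum \<mu> (Suc m) n'))"
      proof -
        have "real (card (S \<times> T)) = real (Suc m) * real (Suc n)"
          by (simp only: card_cartesian_product S T' of_nat_mult)
        thus ?thesis using C1 C2 B
          by (simp add: C_def ennreal_of_nat_eq_real_of_nat ennreal_mult'[symmetric] mult_ac del: of_nat_Suc)
      qed
      finally show ?thesis .
    qed
    thus ?thesis using C1 C2
      by (intro exI[of _ C] conjI exI[of _ "K1 + K2"]) (auto simp: C_def)
  qed
next
  case 0
  show ?case
    by (intro exI[of _ "1::real"] conjI exI[of _ "0::nat"] allI impI nn_integral_gram_det_powr_empty) auto
qed

section \<open>Matrices with prescribed pivots\<close>

text \<open>A pivot whose row and column have \<open>L\<close> entries has size about \<open>x powr (- \<alpha> L / 2)\<close>.\<close>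

definition pivot_event :: "(nat \<Rightarrow> real) \<Rightarrow> real \<Rightarrow> real \<Rightarrow> real \<Rightarrow> 'r::finite set \<Rightarrow> 't::finite set \<Rightarrow> bool" where
  "pivot_event \<alpha> C c x S T \<longleftrightarrow> (\<exists>E\<in>sets (cprod (S \<times> T)).
     (\<forall>h\<in>E. (\<forall>i\<in>S \<times> T. cmod (h i) \<le> C) \<and>
        gram_det x (mat_of S T h) \<le> C * x powr pivot_sum (\<lambda>L. 1 - \<alpha> L) (card S) (card T)) \<and>
     emeasure (cprod (S \<times> T)) E \<ge> ennreal (c * x powr (- pivot_sum (\<lambda>L. real L * \<alpha> L) (card S) (card T))))"

lemma pivot_event_empty:
  assumes e: "S \<times> T = {}" and x: "x \<ge> 1"
  shows "pivot_event \<alpha> 1 1 x S T"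
proof -
  have [simp]: "pivot_sum f (card S) (card T) = 0" for f
    using e by (cases "card S"; cases "card T") auto
  show ?thesis unfolding pivot_event_def mat_of_empty[OF e] unfolding e
    using x by (intro bexI[OF _ sets.top]) (auto simp: space_PiM)
qed

text \<open>With t = \<open>x powr (- \<alpha> L / 2)\<close>, keep the cross within radius
  \<open>t\<close> and let the Schur complement lie in the event of the smaller problem. The cross
  contributes volume of order \<open>t\<close> to the power 2 L, which is
  \<open>x powr (- L * \<alpha> L)\<close>, and the determinant gains at most a constant times
  \<open>x powr (1 - \<alpha> L)\<close>, the bound 1 of the maximum being harmless for \<alpha> L
  \<le> 1.\<close>

lemma ex_pivot_event:
  fixes \<alpha> :: "nat \<Rightarrow> real"
  assumes \<alpha>: "\<And>L. 0 \<le> \<alpha> L" "\<And>L. \<alpha> L \<le> 1"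
  shows "\<exists>C\<ge>1. \<exists>c>0. \<forall>(S :: 'r::finite set) (T :: 't::finite set) x.
    card S = m \<longrightarrow> card T = n \<longrightarrow> x \<ge> 1 \<longrightarrow> pivot_event \<alpha> C c x S T"
proof (induction m arbitrary: n)
  case 0
  have "pivot_event \<alpha> 1 1 x S T" if "card S = 0" "x \<ge> 1" for S :: "'r set" and T :: "'t set" and x
    using that by (intro pivot_event_empty) auto
  thus ?case by (intro exI[of _ "1::real"] conjI) auto
next
  case (Suc m n')
  show ?case
  proof (cases n')
    case 0
    have "pivot_event \<alpha> 1 1 x S T" if "card T = 0" "x \<ge> 1" for S :: "'r set" and T :: "'t set" and x
      using that by (intro pivot_event_empty) auto
    thus ?thesis unfolding 0 by (intro exI[of _ "1::real"] conjI) auto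
  next
    case (Suc n)
    define L where "L = Suc (m + n)"
    obtain C2 c2 where C2: "C2 \<ge> 1" and c2: "c2 > 0" and IH: "\<And>(S :: 'r set) (T :: 't set) x.
      card S = m \<Longrightarrow> card T = n \<Longrightarrow> x \<ge> 1 \<Longrightarrow> pivot_event \<alpha> C2 c2 x S T"
      using Suc.IH[of n] by blast
    define K where "K = (real CARD('r \<Rightarrow> 'r + 't))\<^sup>2 * 4 ^ CARD('r)"
    \<comment> \<open>The first argument bounds the entries, the second one the determinant.\<close>
    define C where "C = max (C2 + 2) (K * C2)"
    define c where "c = 3 / 4 * disc_vol ^ L * c2"
    have K: "K > 0" by (simp add: K_def)
    have "pivot_event \<alpha> C c x S T"
      if S: "card S = Suc m" and T: "card T = n'" and x: "x \<ge> 1" for S :: "'r set" and T :: "'t set" and x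
    proof -
      have T': "card T = Suc n" using T Suc by simp
      \<comment> \<open>For a lower bound on the volume, a single pivot position is enough.\<close>
      obtain p q where pq: "p \<in> S" "q \<in> T"
        using S T' by (metis card.empty ex_in_conv nat.distinct(1))
      note card = card_cross[OF finite finite pq S T']
      obtain E' where E': "E' \<in> sets (cprod (minor_idx p q S T))"
        and E'_le: "\<And>h i. h \<in> E' \<Longrightarrow> i \<in> minor_idx p q S T \<Longrightarrow> cmod (h i) \<le> C2"
        and E'_det: "\<And>h. h \<in> E' \<Longrightarrow> gram_det x (mat_of (S - {p}) (T - {q}) h) \<le> C2 * x powr pivot_sum (\<lambda>L.
            1 - \<alpha> L) m n"
        and E'_meas: "emeasure (cprod (minor_idx p q S T)) E' \<ge> ennreal (c2 * x powr (- pivot_sum (\<lambda>L.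
            real L * \<alpha> L) m n))"
        using IH[of "S - {p}" "T - {q}" x] S T' x pq by (auto simp: pivot_event_def minor_idx_def)
      define t where "t = x powr (- \<alpha> L / 2)"
      have t: "0 < t" "t \<le> 1"
        using x \<alpha>(1)[of L] powr_mono[of "- \<alpha> L / 2" 0 x] by (auto simp: t_def)
      have t2: "t\<^sup>2 = x powr (- \<alpha> L)"
        using x by (simp add: t_def power2_eq_square powr_add[symmetric])
      \<comment> \<open>The annulus keeps the pivot at least \<open>t / 2\<close>, so that it
        dominates its row and column up to the factor 2 required by
        \<open>gram_det_le_schur\<close>. The annulus has 3/4 of the area of the disc, whence the
        constant \<open>c\<close>.\<close>
      define A where "A = Pi\<^sub>E (cross p q S T) (\<lambda>i. if i = (p, q) then cball 0 t - ball 0 (t / 2) else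
          cball (0::complex) t)"
      have A: "A \<in> sets (cprod (cross p q S T))"
        unfolding A_def by (intro sets_PiM_I_finite) auto
      define E where "E = {h \<in> space (cprod (S \<times> T)). restrict h (cross p q S T) \<in> A \<and> schur_fun p q S T
          h \<in> E'}"
      have [measurable]: "(\<lambda>h. restrict h (cross p q S T)) \<in> measurable (cprod (S \<times> T)) (cprod (cross p
          q S T))"
        by (rule measurable_restrict_subset) (use pq in \<open>auto simp: cross_def\<close>)
      note measurable_schur_fun[OF pq, measurable] A [measurable] E' [measurable]
      have E: "E \<in> sets (cprod (S \<times> T))" unfolding E_def by measurable
      have em_A: "emeasure (cprod (cross p q S T)) A = ennreal (3 / 4 * disc_vol ^ L * x powr (- real L
          * \<alpha> L))"
      proof -
        have annulus: "emeasure lborel (cball 0 t - ball (0::complex) (t / 2)) = ennreal (3 / 4 *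
            disc_vol * t\<^sup>2)"
        proof -
          have "emeasure lborel (cball 0 t - ball (0::complex) (t / 2)) = emeasure lborel (cball
              (0::complex) t) - emeasure lborel (ball (0::complex) (t / 2))"
            using t by (intro emeasure_Diff) (auto simp: emeasure_ball)
          also have "\<dots> = ennreal (disc_vol * t\<^sup>2 - disc_vol * (t / 2)\<^sup>2)"
            using t by (simp add: emeasure_ball emeasure_cball ennreal_minus)
          also have "disc_vol * t\<^sup>2 - disc_vol * (t / 2)\<^sup>2 = 3 / 4 * disc_vol * t\<^sup>2"
            by (simp add: power2_eq_square field_simps)
          finally show ?thesis .
        qed
        have "emeasure (cprod (cross p q S T)) A =
            (\<Prod>i\<in>cross p q S T. emeasure lborel (if i = (p, q) then cball 0 t - ball 0 (t / 2) else cball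
                (0::complex) t))"
          unfolding A_def
          by (rule product_sigma_finite.emeasure_PiM[OF product_sigma_finite_lborel]) auto
        also have "\<dots> = ennreal (3 / 4 * disc_vol * t\<^sup>2) * (\<Prod>i\<in>cross p q S T - {(p, q)}. ennreal
            (disc_vol * t\<^sup>2))"
          using card(2) t by (subst cross_insert[OF pq], subst prod.insert) (auto simp: annulus
              emeasure_cball intro!: prod.cong)
        also have "\<dots> = ennreal (3 / 4 * disc_vol ^ L * (t\<^sup>2) ^ L)"
          using t by (simp add: card(1) ennreal_power ennreal_mult[symmetric] L_def power_mult_distrib
              mult_ac)
        also have "(t\<^sup>2) ^ L = x powr (- real L * \<alpha> L)"
          unfolding t2 using x by (simp add: powr_power mult.commute)
        finally show ?thesis .
      qed
      have "emeasure (cprod (S \<times> T)) E = (\<integral>\<^sup>+h. indicator E h \<partial>cprod (S \<times> T))"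
        using E by simp
      also have "\<dots> = (\<integral>\<^sup>+h. indicator A (restrict h (cross p q S T)) * indicator E' (schur_fun p q S T
          h) \<partial>cprod (S \<times> T))"
        by (intro nn_integral_cong) (auto simp: E_def indicator_def)
      also have "\<dots> = (\<integral>\<^sup>+h. indicator A h \<partial>cprod (cross p q S T)) * (\<integral>\<^sup>+h. indicator E' h \<partial>cprod
          (minor_idx p q S T))"
        by (rule nn_integral_cprod_pivot) (use pq in auto)
      also have "\<dots> = ennreal (3 / 4 * disc_vol ^ L * x powr (- real L * \<alpha> L)) * emeasure (cprod
          (minor_idx p q S T)) E'"
        using A E' by (simp add: em_A)
      also have "\<dots> \<ge> ennreal (3 / 4 * disc_vol ^ L * x powr (- real L * \<alpha> L)) *
            ennreal (c2 * x powr (- pivot_sum (\<lambda>L. real L * \<alpha> L) m n))"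
        by (intro mult_left_mono E'_meas) auto
      also have "ennreal (3 / 4 * disc_vol ^ L * x powr (- real L * \<alpha> L)) *
            ennreal (c2 * x powr (- pivot_sum (\<lambda>L. real L * \<alpha> L) m n)) =
          ennreal (c * x powr (- pivot_sum (\<lambda>L. real L * \<alpha> L) (Suc m) n'))"
        using c2 x unfolding Suc
        by (subst ennreal_mult[symmetric]) (auto simp: c_def L_def[symmetric] powr_add[symmetric] mult_ac)
      finally have E_meas: "emeasure (cprod (S \<times> T)) E \<ge> ennreal (c * x powr (- pivot_sum (\<lambda>L. real L *
          \<alpha> L) (Suc m) n'))" .
      have "(\<forall>i\<in>S \<times> T. cmod (h i) \<le> C) \<and>
          gram_det x (mat_of S T h) \<le> C * x powr pivot_sum (\<lambda>L. 1 - \<alpha> L) (Suc m) n'" if h: "h \<in> E" for h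
      proof
        have hA: "restrict h (cross p q S T) \<in> A" and hE': "schur_fun p q S T h \<in> E'"
          using h by (auto simp: E_def)
        have a: "t / 2 \<le> cmod (h (p, q))" "cmod (h (p, q)) \<le> t"
        proof -
          have "(p, q) \<in> cross p q S T" using pq by (simp add: cross_def)
          with hA have "h (p, q) \<in> cball 0 t - ball 0 (t / 2)"
            unfolding A_def by (auto simp: PiE_iff split: if_splits)
          thus "t / 2 \<le> cmod (h (p, q))" "cmod (h (p, q)) \<le> t" by auto
        qed
        have cross: "cmod (h i) \<le> t" if "i \<in> cross p q S T" for i
          using hA that a(2) by (cases "i = (p, q)") (auto simp: A_def PiE_iff)
        have a0: "h (p, q) \<noteq> 0" using a t by auto
        show "\<forall>i\<in>S \<times> T. cmod (h i) \<le> C"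
        proof
          fix i assume i: "i \<in> S \<times> T"
          show "cmod (h i) \<le> C"
          proof (cases "i \<in> cross p q S T")
            case True
            thus ?thesis using cross[OF True] t C2 by (simp add: C_def)
          next
            case False
            obtain k l where kl: "i = (k, l)" by (cases i)
            have im: "i \<in> minor_idx p q S T" and cr: "(k, q) \<in> cross p q S T" "(p, l) \<in> cross p q S T"
              using i False pq by (auto simp: kl cross_def minor_idx_def)
            \<comment> \<open>The original entry is recovered from the Schur complement. The
              correction is at most t * t / (t / 2) = 2 t, which explains the 2 in
              \<open>C\<close>.\<close>
            have "h i = schur_fun p q S T h i + h (k, q) * h (p, l) / h (p, q)"
              using im by (simp add: schur_fun_def kl)
            also have "cmod \<dots> \<le> cmod (schur_fun p q S T h i) + cmod (h (k, q)) * cmod (h (p, l)) / cmod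
                (h (p, q))"
              by (metis norm_triangle_ineq norm_mult norm_divide)
            also have "\<dots> \<le> C2 + t * t / (t / 2)"
              using t a im cr by (intro add_mono E'_le[OF hE'] frac_le mult_mono cross) auto
            also have "\<dots> \<le> C2 + 2" using t by simp
            finally show ?thesis by (simp add: C_def)
          qed
        qed
        define H where "H = mat_of S T h"
        have H_pq: "H $ p $ q = h (p, q)" using pq by (simp add: H_def mat_of_def)
        have tH: "t \<le> 2 * cmod (H $ p $ q)" using a by (simp add: H_pq)
        have col: "cmod (H $ i $ q) \<le> 2 * cmod (H $ p $ q)" for i
          using tH cross[of "(i, q)"] t by (auto simp: H_def mat_of_def cross_def intro: order.trans)
        have row: "cmod (H $ p $ j) \<le> 2 * cmod (H $ p $ q)" for j
          using tH cross[of "(p, j)"] t by (auto simp: H_def mat_of_def cross_def intro: order.trans)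
        have "x * (cmod (H $ p $ q))\<^sup>2 \<le> x * t\<^sup>2"
          using x a by (intro mult_left_mono power_mono) (auto simp: H_pq)
        also have "\<dots> = x powr (1 - \<alpha> L)"
          using x by (simp add: t2 powr_diff powr_minus field_simps)
        finally have max: "max 1 (x * (cmod (H $ p $ q))\<^sup>2) \<le> x powr (1 - \<alpha> L)"
          using x \<alpha>(2)[of L] by (simp add: ge_one_powr_ge_zero)
        have "gram_det x H \<le> K * max 1 (x * (cmod (H $ p $ q))\<^sup>2) * gram_det x (schur p q H)"
          unfolding K_def by (rule gram_det_le_schur) (use x a0 H_pq col row in auto)
        also have "schur p q H = mat_of (S - {p}) (T - {q}) (schur_fun p q S T h)"
          unfolding H_def by (rule schur_mat_of[OF pq]) (use a0 in auto)
        also have "K * max 1 (x * (cmod (H $ p $ q))\<^sup>2) * gram_det x \<dots> \<le>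
            K * x powr (1 - \<alpha> L) * (C2 * x powr pivot_sum (\<lambda>L. 1 - \<alpha> L) m n)"
          using K x C2 by (intro mult_mono max E'_det[OF hE'] gram_det_nonneg) auto
        also have "\<dots> = K * C2 * x powr pivot_sum (\<lambda>L. 1 - \<alpha> L) (Suc m) n'"
          unfolding Suc using x by (simp add: powr_add L_def mult_ac)
        also have "\<dots> \<le> C * x powr pivot_sum (\<lambda>L. 1 - \<alpha> L) (Suc m) n'"
          by (intro mult_right_mono) (auto simp: C_def)
        finally show "gram_det x (mat_of S T h) \<le> C * x powr pivot_sum (\<lambda>L. 1 - \<alpha> L) (Suc m) n'"
          unfolding H_def .
      qed
      thus ?thesis unfolding pivot_event_def S T using E E_meas by blast
    qed
    moreover have "C \<ge> 1" "c > 0" using C2 c2 by (auto simp: C_def c_def)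
    ultimately show ?thesis by (intro exI[of _ C] exI[of _ c] conjI) auto
  qed
qed

section \<open>Gaussian matrices\<close>

lemma Basis_matrix:
  "(Basis :: (complex^'t::finite^'r::finite) set) = (\<lambda>((i, j), z). axis i (axis j z)) ` (UNIV \<times> Basis)"
proof (intro equalityI subsetI)
  fix b :: "complex^'t^'r" assume "b \<in> Basis"
  then obtain i j z where "z \<in> Basis" "b = axis i (axis j z)" by (auto simp: Basis_vec_def)
  thus "b \<in> (\<lambda>((i, j), z). axis i (axis j z)) ` (UNIV \<times> Basis)"
    by (intro image_eqI[of _ _ "((i, j), z)"]) auto
next
  fix b :: "complex^'t^'r" assume "b \<in> (\<lambda>((i, j), z). axis i (axis j z)) ` (UNIV \<times> Basis)"
  thus "b \<in> Basis" by (auto simp: Basis_vec_def)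
qed

lemma measurable_mat_of [measurable]:
  "(mat_of UNIV UNIV :: ('r::finite \<times> 't::finite \<Rightarrow> complex) \<Rightarrow> complex^'t^'r) \<in> borel_measurable (cprod UNIV)"
proof -
  have "(\<lambda>h. h z) \<in> borel_measurable (cprod UNIV)" for z :: "'r \<times> 't"
    using measurable_component_singleton[of z UNIV "\<lambda>_. lborel :: complex measure"] by simp
  thus ?thesis
    unfolding borel_measurable_euclidean_space[of "mat_of UNIV UNIV"]
    by (auto simp: Basis_matrix inner_axis mat_of_def intro!: borel_measurable_inner)
qed

text \<open>Bridge between the measure on the matrix type, used to define the expected distortion,
  and products over entries, on which elimination acts. It suffices to compare boxes, and a box of
  matrices is a product of boxes of entries.\<close>

lemma lborel_matrix:
  "(lborel :: (complex^'t::finite^'r::finite) measure) = distr (cprod UNIV) borel (mat_of UNIV UNIV)"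
proof (rule lborel_eqI)
  have inner: "X \<bullet> axis i (axis j z) = X $ i $ j \<bullet> z" for X :: "complex^'t^'r" and i j z
    by (simp add: inner_axis)
  fix l u :: "complex^'t^'r"
  assume le: "\<And>b. b \<in> Basis \<Longrightarrow> l \<bullet> b \<le> u \<bullet> b"
  have le': "l $ i $ j \<bullet> z \<le> u $ i $ j \<bullet> z" if "z \<in> Basis" for i j z
  proof -
    have "axis i (axis j z) \<in> (Basis :: (complex^'t^'r) set)"
      using that by (auto simp: Basis_vec_def)
    from le[OF this] show ?thesis by (simp add: inner)
  qed
  have "emeasure (distr (cprod UNIV) borel (mat_of UNIV UNIV)) (box l u) =
      emeasure (cprod UNIV) (mat_of UNIV UNIV -` box l u \<inter> space (cprod UNIV))"
    by (rule emeasure_distr[OF measurable_mat_of]) auto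
  also have "mat_of UNIV UNIV -` box l u \<inter> space (cprod UNIV) =
      Pi\<^sub>E UNIV (\<lambda>(i, j). box (l $ i $ j) (u $ i $ j))"
    by (auto simp: box_def Basis_matrix inner mat_of_def space_PiM PiE_UNIV_domain)
  also have "emeasure (cprod UNIV) \<dots> = (\<Prod>y\<in>UNIV. emeasure lborel (case y of (i, j) \<Rightarrow> box (l $ i $ j) (u
      $ i $ j)))"
    by (rule product_sigma_finite.emeasure_PiM[OF product_sigma_finite_lborel]) auto
  also have "\<dots> = (\<Prod>y\<in>UNIV. ennreal (\<Prod>z\<in>Basis. (case y of (i, j) \<Rightarrow> u $ i $ j - l $ i $ j) \<bullet> z))"
    by (intro prod.cong refl) (auto simp: le' emeasure_lborel_box split: prod.splits)
  also have "\<dots> = ennreal (\<Prod>y\<in>UNIV. \<Prod>z\<in>Basis. (case y of (i, j) \<Rightarrow> u $ i $ j - l $ i $ j) \<bullet> z)"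
    by (intro prod_ennreal) (auto intro!: prod_nonneg simp: le' inner_diff_left)
  also have "(\<Prod>y\<in>UNIV. \<Prod>z\<in>Basis. (case y of (i, j) \<Rightarrow> u $ i $ j - l $ i $ j) \<bullet> z) =
      (\<Prod>(y, z)\<in>UNIV \<times> Basis. (case y of (i, j) \<Rightarrow> u $ i $ j - l $ i $ j) \<bullet> z)"
    by (rule prod.cartesian_product)
  also have "\<dots> = (\<Prod>b\<in>Basis. (u - l) \<bullet> b)"
    unfolding Basis_matrix
  proof (subst prod.reindex)
    show "inj_on (\<lambda>((i, j), z). axis i (axis j z)) (UNIV \<times> Basis :: (('r \<times> 't) \<times> complex) set)"
      by (auto simp: inj_on_def axis_eq_axis)
  qed (auto intro!: prod.cong simp: inner)
  finally show "emeasure (distr (cprod UNIV) borel (mat_of UNIV UNIV)) (box l u) = ennreal (\<Prod>b\<in>Basis. (u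
      - l) \<bullet> b)" .
qed simp

lemma nn_integral_lborel_matrix:
  fixes F :: "complex^'t::finite^'r::finite \<Rightarrow> ennreal"
  assumes "F \<in> borel_measurable borel"
  shows "(\<integral>\<^sup>+H. F H \<partial>lborel) = (\<integral>\<^sup>+h. F (mat_of UNIV UNIV h) \<partial>cprod UNIV)"
proof -
  have "F \<in> borel_measurable (distr (cprod UNIV) borel (mat_of UNIV UNIV))"
    using assms by (simp only: measurable_distr_eq1)
  from nn_integral_distr[OF measurable_mat_of this] show ?thesis
    by (simp only: lborel_matrix)
qed

lemma cgauss_density_pos: "cgauss_density H > 0"
  by (simp add: cgauss_density_def)

lemma borel_measurable_cgauss_density [measurable]: "cgauss_density \<in> borel_measurable borel"
  unfolding cgauss_density_def[abs_def] by measurable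

text \<open>The term with \<open>n\<close> equal to the integer part of the norm already suffices:
  all entries are at most n + 1, and the squared norm is at least n^2, hence at least n.\<close>

lemma cgauss_density_le_suminf:
  fixes H :: "complex^'t::finite^'r::finite"
  shows "ennreal (cgauss_density H) \<le>
    (\<Sum>n. ennreal (exp (- real n)) * indicator {H. \<forall>i j. cmod (H $ i $ j) \<le> real n + 1} H)"
proof -
  define n where "n = nat \<lfloor>norm H\<rfloor>"
  have n: "real n \<le> norm H" "norm H \<le> real n + 1"
    using of_int_floor_le[of "norm H"] real_of_int_floor_add_one_ge[of "norm H"] by (auto simp: n_def)
  have "cmod (H $ i $ j) \<le> norm H" for i j
    by (rule order.trans[OF Finite_Cartesian_Product.norm_nth_le Finite_Cartesian_Product.norm_nth_le])
  hence entries: "cmod (H $ i $ j) \<le> real n + 1" for i j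
    using n(2) order.trans by blast
  have "real n \<le> real n * real n" by (cases n) auto
  also have "\<dots> \<le> (norm H)\<^sup>2" unfolding power2_eq_square using n by (intro mult_mono) auto
  finally have "exp (- (norm H)\<^sup>2) \<le> exp (- real n)" by simp
  moreover have "(1 / pi) ^ (CARD('t) * CARD('r)) \<le> (1 :: real)"
    using pi_gt3 by (intro power_le_one) auto
  ultimately have "cgauss_density H \<le> 1 * exp (- real n)"
    unfolding cgauss_density_def by (intro mult_mono) auto
  hence "ennreal (cgauss_density H) \<le> ennreal (exp (- real n)) * indicator {H. \<forall>i j. cmod (H $ i $ j) \<le>
      real n + 1} H"
    using entries by (simp add: ennreal_leI)
  also have "\<dots> \<le> (\<Sum>n. ennreal (exp (- real n)) * indicator {H. \<forall>i j. cmod (H $ i $ j) \<le> real n + 1} H)"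
    using sum_le_suminf[of "\<lambda>n. ennreal (exp (- real n)) * indicator {H. \<forall>i j. cmod (H $ i $ j) \<le> real n
        + 1} H" "{n}"]
    by (simp only: sum.insert sum.empty finite.intros empty_iff simp_thms add_0_right) auto
  finally show ?thesis .
qed

text \<open>A single term of the exponential series bounds the power by a multiple of
  \<open>exp ((n + 1) / 2)\<close>, leaving a geometric series.\<close>

lemma summable_power_mult_exp: "summable (\<lambda>n. (real n + 1) ^ K * exp (- real n))"
proof (rule summable_comparison_test')
  show "summable (\<lambda>n. fact K * 2 ^ K * exp (1 / 2) * exp (- 1 / 2 :: real) ^ n)"
    by (intro summable_mult summable_geometric) auto
  fix n :: nat
  have "((real n + 1) / 2) ^ K / fact K \<le> exp ((real n + 1) / 2)"
  proof -
    have "(\<Sum>k\<in>{K}. ((real n + 1) / 2) ^ k /\<^sub>R fact k) \<le> (\<Sum>k. ((real n + 1) / 2) ^ k /\<^sub>R fact k)"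
      by (intro sum_le_suminf summable_exp_generic) auto
    thus ?thesis by (simp add: exp_def field_simps)
  qed
  hence "(real n + 1) ^ K \<le> fact K * 2 ^ K * exp ((real n + 1) / 2)"
    by (simp add: power_divide field_simps)
  hence "(real n + 1) ^ K * exp (- real n) \<le> fact K * 2 ^ K * exp ((real n + 1) / 2) * exp (- real n)"
    by (intro mult_right_mono) auto
  also have "\<dots> = fact K * 2 ^ K * (exp ((real n + 1) / 2) * exp (- real n))" by simp
  also have "exp ((real n + 1) / 2) * exp (- real n) = exp (1 / 2) * exp (- 1 / 2) ^ n"
    by (simp add: exp_of_nat_mult[symmetric] exp_add[symmetric] field_simps)
  finally show "norm ((real n + 1) ^ K * exp (- real n)) \<le> fact K * 2 ^ K * exp (1 / 2) * exp (- 1 / 2) ^ n"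
    by (simp add: mult_ac)
qed

lemma borel_measurable_gram_det_borel [measurable]:
  "(gram_det x :: complex^'t::finite^'r::finite \<Rightarrow> real) \<in> borel_measurable borel"
proof -
  have "(\<lambda>H. H $ i $ j) \<in> borel_measurable borel" for i :: 'r and j :: 't
    by (intro borel_measurable_continuous_onI continuous_intros)
  from borel_measurable_gram_det[where M = "\<lambda>H. H", OF this] show ?thesis .
qed

lemma nn_integral_cgauss_gram_det_powr_le:
  fixes s :: real and \<mu> :: "nat \<Rightarrow> real"
  assumes mu: "\<And>L. L \<ge> 1 \<Longrightarrow> 0 \<le> \<mu> L \<and> \<mu> L \<le> s \<and> \<mu> L < real L"
  shows "\<exists>C\<ge>0. \<forall>x>0. (\<integral>\<^sup>+H. ennreal (cgauss_density H) *
        ennreal (gram_det x (H :: complex^'t::finite^'r::finite) powr (- s)) \<partial>lborel)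
      \<le> ennreal (C * x powr (- pivot_sum \<mu> CARD('r) CARD('t)))"
proof -
  obtain C K where C: "C \<ge> 0" and CK: "\<And>x B. x > 0 \<Longrightarrow> B \<ge> 1 \<Longrightarrow>
    (\<integral>\<^sup>+h. indicator {h. \<forall>i\<in>(UNIV :: 'r set) \<times> (UNIV :: 't set). cmod (h i) \<le> B} h *
        ennreal (gram_det x (mat_of UNIV UNIV h :: complex^'t^'r) powr (- s)) \<partial>cprod (UNIV \<times> UNIV))
      \<le> ennreal (C * B ^ K * x powr (- pivot_sum \<mu> CARD('r) CARD('t)))"
    using nn_integral_gram_det_powr_le[OF mu, where 'r = 'r and 't = 't and m = "CARD('r)" and n = "CARD('t)"]
    by blast
  define Z where "Z = (\<Sum>n. (real n + 1) ^ K * exp (- real n))"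
  have "(\<integral>\<^sup>+H. ennreal (cgauss_density H) *
        ennreal (gram_det x (H :: complex^'t::finite^'r::finite) powr (- s)) \<partial>lborel)
      \<le> ennreal (C * Z * x powr (- pivot_sum \<mu> CARD('r) CARD('t)))" if x: "x > 0" for x
  proof -
    define f where "f n H = ennreal (exp (- real n)) * (indicator {H. \<forall>i j. cmod (H $ i $ j) \<le> real n + 1} H *
        ennreal (gram_det x H powr (- s)))" for n and H :: "complex^'t^'r"
    have entry [measurable]: "(\<lambda>H. H $ i $ j) \<in> borel_measurable borel" for i :: 'r and j :: 't
      by (intro borel_measurable_continuous_onI continuous_intros)
    have pred [measurable]: "Measurable.pred borel (\<lambda>H::complex^'t^'r. \<forall>i j. cmod (H $ i $ j) \<le> real n +
        1)" for n
      by measurable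
    have f_meas [measurable]: "f n \<in> borel_measurable borel" for n
      unfolding f_def by measurable
    have "(\<integral>\<^sup>+H. ennreal (cgauss_density H) * ennreal (gram_det x (H :: complex^'t^'r) powr (- s)) \<partial>lborel)
        \<le> (\<integral>\<^sup>+H. (\<Sum>n. f n H) \<partial>lborel)"
    proof (rule nn_integral_mono)
      fix H :: "complex^'t^'r"
      have "ennreal (cgauss_density H) * ennreal (gram_det x H powr (- s)) \<le>
        (\<Sum>n. ennreal (exp (- real n)) * indicator {H. \<forall>i j. cmod (H $ i $ j) \<le> real n + 1} H) * ennreal
            (gram_det x H powr (- s))"
        by (intro mult_right_mono cgauss_density_le_suminf) auto
      also have "\<dots> = (\<Sum>n. f n H)"
        by (simp add: f_def mult.assoc flip: ennreal_suminf_multc)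
      finally show "ennreal (cgauss_density H) * ennreal (gram_det x H powr (- s)) \<le> (\<Sum>n. f n H)" .
    qed
    also have "\<dots> = (\<Sum>n. \<integral>\<^sup>+H. f n H \<partial>lborel)"
      by (intro nn_integral_suminf) simp
    also have "\<dots> \<le> (\<Sum>n. ennreal ((C * x powr (- pivot_sum \<mu> CARD('r) CARD('t))) * ((real n + 1) ^ K *
        exp (- real n))))"
    proof (intro suminf_le summableI)
      fix n
      have m: "(\<lambda>h. indicator {h. \<forall>i\<in>(UNIV :: 'r set) \<times> (UNIV :: 't set). cmod (h i) \<le> real n + 1} h *
              ennreal (gram_det x (mat_of UNIV UNIV h :: complex^'t^'r) powr (- s))) \<in> borel_measurable
                  (cprod (UNIV \<times> UNIV))"
      proof -
        have [measurable]: "Measurable.pred (cprod (UNIV \<times> UNIV))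
            (\<lambda>h. \<forall>i\<in>(UNIV :: 'r set) \<times> (UNIV :: 't set). cmod (h i) \<le> real n + 1)"
          by (rule pred_cmod_le) auto
        note borel_measurable_gram_det_mat_of [measurable]
        show ?thesis by measurable
      qed
      have "(\<integral>\<^sup>+H. f n H \<partial>lborel) = (\<integral>\<^sup>+h. f n (mat_of UNIV UNIV h) \<partial>cprod UNIV)"
        by (rule nn_integral_lborel_matrix) simp
      also have "\<dots> = (\<integral>\<^sup>+h. ennreal (exp (- real n)) *
          (indicator {h. \<forall>i\<in>(UNIV :: 'r set) \<times> (UNIV :: 't set). cmod (h i) \<le> real n + 1} h *
              ennreal (gram_det x (mat_of UNIV UNIV h :: complex^'t^'r) powr (- s))) \<partial>cprod (UNIV \<times> UNIV))"
        unfolding UNIV_Times_UNIV by (intro nn_integral_cong) (auto simp: f_def mat_of_def indicator_def)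
      also have "\<dots> = ennreal (exp (- real n)) * (\<integral>\<^sup>+h.
          indicator {h. \<forall>i\<in>(UNIV :: 'r set) \<times> (UNIV :: 't set). cmod (h i) \<le> real n + 1} h *
              ennreal (gram_det x (mat_of UNIV UNIV h :: complex^'t^'r) powr (- s)) \<partial>cprod (UNIV \<times> UNIV))"
        using m by (rule nn_integral_cmult)
      also have "\<dots> \<le> ennreal (exp (- real n)) * ennreal (C * (real n + 1) ^ K * x powr (- pivot_sum \<mu>
          CARD('r) CARD('t)))"
        by (intro mult_left_mono CK x) auto
      also have "\<dots> = ennreal ((C * x powr (- pivot_sum \<mu> CARD('r) CARD('t))) * ((real n + 1) ^ K * exp
          (- real n)))"
        using C by (subst ennreal_mult[symmetric]) (auto simp: mult_ac)
      finally show "(\<integral>\<^sup>+H. f n H \<partial>lborel) \<le> ennreal ((C * x powr (- pivot_sum \<mu> CARD('r) CARD('t))) *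
          ((real n + 1) ^ K * exp (- real n)))" .
    qed
    also have "\<dots> = ennreal ((C * x powr (- pivot_sum \<mu> CARD('r) CARD('t))) * Z)"
      using C unfolding Z_def
      by (intro suminf_ennreal_eq sums_mult summable_sums summable_power_mult_exp) auto
    finally show ?thesis by (simp add: mult_ac)
  qed
  moreover have "Z \<ge> 0" unfolding Z_def by (intro suminf_nonneg summable_power_mult_exp) auto
  ultimately show ?thesis using C by (intro exI[of _ "C * Z"]) auto
qed

section \<open>The diversity-multiplexing exponent\<close>

definition unit_clamp :: "real \<Rightarrow> real" where
  "unit_clamp x = max 0 (min 1 x)"

text \<open>The minimum of the cost (sum of L_i * \<alpha>_i) over \<alpha>_i in [0, 1] whose
  complements 1 - \<alpha>_i add up to at most r. As the cross sizes L_i decrease with i, the budget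
  r is spent on the first pivots, which gives \<alpha>_i =
  \<open>unit_clamp (i + 1 - r)\<close>.\<close>

definition dmt :: "nat \<Rightarrow> nat \<Rightarrow> real \<Rightarrow> real" where
  "dmt m n r = (\<Sum>i<min m n. real (m + n - 1 - 2 * i) * unit_clamp (real i + 1 - r))"

lemma pivot_sum_eq_sum: "pivot_sum f m n = (\<Sum>i<min m n. f (m + n - 1 - 2 * i))"
proof (induction f m n rule: pivot_sum.induct)
  case (1 f m n)
  have "(\<Sum>i<Suc (min m n). f (Suc m + Suc n - 1 - 2 * i)) =
      f (Suc (m + n)) + (\<Sum>i<min m n. f (Suc m + Suc n - 1 - 2 * Suc i))"
    by (subst sum.lessThan_Suc_shift) simp
  thus ?case using 1 by simp
qed auto

lemma sum_unit_clamp: "r \<ge> 0 \<Longrightarrow> (\<Sum>i<K. unit_clamp (r - real i)) = min r (real K)"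
  by (induction K) (auto simp: unit_clamp_def min_def max_def)

lemma unit_clamp_diff: "unit_clamp (real i + 1 - r) = 1 - unit_clamp (r - real i)"
  by (auto simp: unit_clamp_def min_def max_def)

text \<open>Summed over \<open>i\<close>, this is \<open>d(r) = (\<Sum>i. min s L\<^sub>i) - r s\<close> for the slope \<open>s = L\<^sub>k\<close> of the segment
containing \<open>r\<close>, which is what makes the Chernoff bound with parameter \<open>s\<close> sharp.\<close>

lemma min_eq_dmt_summand:
  fixes s :: real
  assumes "real k \<le> r" "r < real k + 1" "i < K" "k < K" "2 * K \<le> T + 2"
  defines "s \<equiv> real (T - 2 * k)"
  shows "min s (real (T - 2 * i)) = real (T - 2 * i) * unit_clamp (real i + 1 - r) + s * unit_clamp (r -
      real i)"
proof -
  consider "i < k" | "i = k" | "k < i" by linarith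
  thus ?thesis
  proof cases
    case 1
    hence "unit_clamp (real i + 1 - r) = 0" "unit_clamp (r - real i) = 1"
      using assms(1) by (auto simp: unit_clamp_def)
    thus ?thesis using 1 by (simp add: s_def)
  next
    case 2
    hence u: "unit_clamp (real i + 1 - r) = real k + 1 - r" "unit_clamp (r - real i) = r - real k"
      using assms(1,2) by (auto simp: unit_clamp_def)
    have "min a a = a * (real k + 1 - r) + a * (r - real k)" for a :: real
      by (simp add: algebra_simps)
    thus ?thesis unfolding u unfolding 2 s_def .
  next
    case 3
    hence "unit_clamp (real i + 1 - r) = 1" "unit_clamp (r - real i) = 0"
      using assms(2) by (auto simp: unit_clamp_def)
    thus ?thesis using 3 by (simp add: s_def)
  qed
qed

lemma dmt_eq_0: "r \<ge> real (min m n) \<Longrightarrow> dmt m n r = 0"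
  unfolding dmt_def by (intro sum.neutral) (auto simp: unit_clamp_def)

lemma dmt_nonneg: "dmt m n r \<ge> 0"
  unfolding dmt_def by (intro sum_nonneg) (auto simp: unit_clamp_def)

lemma dmt_antimono: "r \<le> r' \<Longrightarrow> dmt m n r' \<le> dmt m n r"
  unfolding dmt_def by (intro sum_mono mult_left_mono) (auto simp: unit_clamp_def)

lemma dmt_lipschitz:
  assumes "r \<le> r'"
  shows "dmt m n r \<le> dmt m n r' + (r' - r) * (\<Sum>i<min m n. real (m + n - 1 - 2 * i))"
proof -
  have "dmt m n r \<le> (\<Sum>i<min m n. real (m + n - 1 - 2 * i) * (unit_clamp (real i + 1 - r') + (r' - r)))"
    unfolding dmt_def using assms by (intro sum_mono mult_left_mono) (auto simp: unit_clamp_def)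
  also have "\<dots> = dmt m n r' + (r' - r) * (\<Sum>i<min m n. real (m + n - 1 - 2 * i))"
    unfolding dmt_def sum_distrib_left sum.distrib[symmetric] by (simp only: distrib_left distrib_right
        mult.commute)
  finally show ?thesis .
qed

section \<open>Probabilities of small determinants under the Gaussian measure\<close>

definition cgauss :: "(complex^'t::finite^'r::finite) measure" where
  "cgauss = density lborel (\<lambda>H. ennreal (cgauss_density H))"

lemma sets_cgauss [simp, measurable_cong]: "sets cgauss = sets borel"
  by (simp add: cgauss_def)

lemma space_cgauss [simp]: "space cgauss = UNIV"
  by (simp add: cgauss_def)

lemma emeasure_cgauss:
  "A \<in> sets borel \<Longrightarrow> emeasure cgauss A = (\<integral>\<^sup>+H. ennreal (cgauss_density H) * indicator A H \<partial>lborel)"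
  unfolding cgauss_def by (rule emeasure_density) auto

text \<open>The total mass is the negative moment of order 0, so the moment bound with s = 0 covers
  it.\<close>

lemma finite_measure_cgauss: "finite_measure (cgauss :: (complex^'t::finite^'r::finite) measure)"
proof
  obtain C where C: "\<And>x. x > 0 \<Longrightarrow> (\<integral>\<^sup>+H. ennreal (cgauss_density H) *
        ennreal (gram_det x (H :: complex^'t^'r) powr (- 0)) \<partial>lborel)
      \<le> ennreal (C * x powr (- pivot_sum (\<lambda>_. 0) CARD('r) CARD('t)))"
    using nn_integral_cgauss_gram_det_powr_le[of "\<lambda>_. 0" 0] by auto
  have "gram_det 1 H \<noteq> 0" for H :: "complex^'t^'r"
    using gram_det_pos[of 1 H] by simp
  hence "emeasure (cgauss :: (complex^'t^'r) measure) (space cgauss) \<le> ennreal (C * 1)"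
    using C[of 1] by (simp add: emeasure_cgauss)
  thus "emeasure (cgauss :: (complex^'t^'r) measure) (space cgauss) \<noteq> \<infinity>"
    by (metis ennreal_neq_top infinity_ennreal_def neq_top_trans)
qed

lemma measure_gram_det_le_upper:
  assumes r: "r \<ge> 0" and Y: "Y > 0" and \<delta>: "\<delta> > 0"
  shows "\<exists>C\<ge>0. \<forall>x\<ge>1. measure cgauss {H :: complex^'t::finite^'r::finite. gram_det x H \<le> Y * x powr r}
           \<le> C * x powr (- dmt CARD('r) CARD('t) r + \<delta>)"
proof -
  interpret finite_measure "cgauss :: (complex^'t^'r) measure"
    by (rule finite_measure_cgauss)
  define K where "K = min CARD('r) CARD('t)"
  show ?thesis
  proof (cases "r \<ge> real K")
    \<comment> \<open>Here \<open>dmt\<close> vanishes, and the total mass is a bound of the right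
      order.\<close>
    case True
    have "measure cgauss {H :: complex^'t^'r. gram_det x H \<le> Y * x powr r}
        \<le> measure (cgauss :: (complex^'t^'r) measure) UNIV * x powr (- dmt CARD('r) CARD('t) r + \<delta>)" if
            "x \<ge> 1" for x
    proof -
      have "measure cgauss {H :: complex^'t^'r. gram_det x H \<le> Y * x powr r} \<le> measure (cgauss ::
          (complex^'t^'r) measure) UNIV * 1"
        using bounded_measure by simp
      also have "\<dots> \<le> measure (cgauss :: (complex^'t^'r) measure) UNIV * x powr (- dmt CARD('r) CARD('t)
          r + \<delta>)"
        using True that \<delta> by (intro mult_left_mono) (auto simp: dmt_eq_0 K_def ge_one_powr_ge_zero)
      finally show ?thesis .
    qed
    thus ?thesis by (intro exI[of _ "measure (cgauss :: (complex^'t^'r) measure) UNIV"]) auto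
  next
    case False
    define T where "T = CARD('r) + CARD('t) - 1"
    define k where "k = nat \<lfloor>r\<rfloor>"
    have k: "real k \<le> r" "r < real k + 1"
      using r of_int_floor_le[of r] by (auto simp: k_def)
    have kK: "k < K" using k(1) False by linarith
    have KT: "2 * K \<le> T + 1" by (auto simp: K_def T_def)
    define s where "s = real (T - 2 * k)"
    have s: "s \<ge> 0" by (simp add: s_def)
    \<comment> \<open>The moment bound needs exponents strictly below \<open>L\<close>.\<close>
    define \<eta> where "\<eta> = min (1 / 2) (\<delta> / real K)"
    have \<eta>: "0 < \<eta>" "\<eta> < 1" "real K * \<eta> \<le> \<delta>"
      using \<delta> kK by (auto simp: \<eta>_def min_def field_simps)
    define \<mu> where "\<mu> L = max 0 (min s (real L - \<eta>))" for L :: nat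
    have mu: "0 \<le> \<mu> L \<and> \<mu> L \<le> s \<and> \<mu> L < real L" if "L \<ge> 1" for L
      using that s \<eta> by (auto simp: \<mu>_def)
    obtain C where C: "C \<ge> 0" and int_le: "\<And>x. x > 0 \<Longrightarrow> (\<integral>\<^sup>+H. ennreal (cgauss_density H) *
        ennreal (gram_det x (H :: complex^'t^'r) powr (- s)) \<partial>lborel)
      \<le> ennreal (C * x powr (- pivot_sum \<mu> CARD('r) CARD('t)))"
      using nn_integral_cgauss_gram_det_powr_le[OF mu] by blast
    \<comment> \<open>Each of the \<open>K\<close> terms loses at most \<eta> against
      \<open>min s L\<close>, and K * \<eta> \<le> \<delta>. The clamps of r - i add up to r because
      r < K, which produces the term r * s.\<close>
    have P: "pivot_sum \<mu> CARD('r) CARD('t) \<ge> dmt CARD('r) CARD('t) r + r * s - \<delta>"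
    proof -
      have "dmt CARD('r) CARD('t) r + r * s - \<delta> \<le>
          (\<Sum>i<K. real (T - 2 * i) * unit_clamp (real i + 1 - r)) + s * (\<Sum>i<K. unit_clamp (r - real i)) -
              real K * \<eta>"
      proof -
        have "dmt CARD('r) CARD('t) r = (\<Sum>i<K. real (T - 2 * i) * unit_clamp (real i + 1 - r))"
          by (simp only: dmt_def K_def T_def)
        moreover have "(\<Sum>i<K. unit_clamp (r - real i)) = r"
          using False r by (simp add: sum_unit_clamp)
        ultimately show ?thesis using \<eta>(3) by (simp only: mult.commute)
      qed
      also have "\<dots> = (\<Sum>i<K. real (T - 2 * i) * unit_clamp (real i + 1 - r) + s * unit_clamp (r - real i) - \<eta>)"
        by (simp add: sum.distrib sum_subtractf sum_distrib_left)
      also have "\<dots> = (\<Sum>i<K. min s (real (T - 2 * i)) - \<eta>)"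
        unfolding s_def using min_eq_dmt_summand[OF k _ kK, of _ T] KT by (intro sum.cong refl) auto
      also have "\<dots> \<le> (\<Sum>i<K. \<mu> (T - 2 * i))"
        using \<eta> by (intro sum_mono) (auto simp: \<mu>_def)
      also have "\<dots> = pivot_sum \<mu> CARD('r) CARD('t)"
        by (simp add: pivot_sum_eq_sum K_def T_def)
      finally show ?thesis .
    qed
    have "measure cgauss {H :: complex^'t^'r. gram_det x H \<le> Y * x powr r}
        \<le> Y powr s * C * x powr (- dmt CARD('r) CARD('t) r + \<delta>)" if x: "x \<ge> 1" for x
    proof -
      let ?A = "{H :: complex^'t^'r. gram_det x H \<le> Y * x powr r}"
      have "ennreal (measure cgauss ?A) = emeasure cgauss ?A"
        by (simp add: emeasure_eq_measure)
      also have "\<dots> = (\<integral>\<^sup>+H. ennreal (cgauss_density H) * indicator ?A H \<partial>lborel)"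
        by (rule emeasure_cgauss) measurable
      also have "\<dots> \<le> (\<integral>\<^sup>+H. ennreal ((Y * x powr r) powr s) * (ennreal (cgauss_density H) *
          ennreal (gram_det x (H :: complex^'t^'r) powr (- s))) \<partial>lborel)"
      proof (rule nn_integral_mono)
        fix H :: "complex^'t^'r"
        \<comment> \<open>Markov's inequality for the power -s of the determinant.\<close>
        have "1 \<le> (Y * x powr r) powr s * gram_det x H powr (- s)" if "H \<in> ?A"
        proof -
          have pos: "gram_det x H > 0" using x by (intro gram_det_pos) auto
          have "gram_det x H powr s \<le> (Y * x powr r) powr s"
            using that pos s by (intro powr_mono2) auto
          thus ?thesis using pos by (simp add: powr_minus field_simps)
        qed
        hence "indicator ?A H \<le> ennreal ((Y * x powr r) powr s * gram_det x H powr (- s))"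
          by (cases "H \<in> ?A") (auto simp del: ennreal_1 simp flip: ennreal_1 intro: ennreal_leI)
        hence "ennreal (cgauss_density H) * indicator ?A H \<le>
            ennreal (cgauss_density H) * ennreal ((Y * x powr r) powr s * gram_det x H powr (- s))"
          by (intro mult_left_mono) auto
        thus "ennreal (cgauss_density H) * indicator ?A H \<le> ennreal ((Y * x powr r) powr s) * (ennreal
            (cgauss_density H) *
          ennreal (gram_det x H powr (- s)))"
          by (simp add: ennreal_mult mult_ac)
      qed
      also have "\<dots> = ennreal ((Y * x powr r) powr s) * (\<integral>\<^sup>+H. ennreal (cgauss_density H) *
          ennreal (gram_det x (H :: complex^'t^'r) powr (- s)) \<partial>lborel)"
        by (rule nn_integral_cmult) measurable
      also have "\<dots> \<le> ennreal ((Y * x powr r) powr s) * ennreal (C * x powr (- pivot_sum \<mu> CARD('r) CARD('t)))"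
        using x by (intro mult_left_mono int_le) auto
      also have "\<dots> = ennreal (Y powr s * C * x powr (r * s - pivot_sum \<mu> CARD('r) CARD('t)))"
        using Y x C by (subst ennreal_mult[symmetric]) (auto simp: powr_mult powr_powr powr_diff
            powr_minus field_simps)
      also have "\<dots> \<le> ennreal (Y powr s * C * x powr (- dmt CARD('r) CARD('t) r + \<delta>))"
        using P x C by (intro ennreal_leI mult_left_mono powr_mono) auto
      finally show ?thesis using C by (subst (asm) ennreal_le_iff) auto
    qed
    thus ?thesis using C by (intro exI[of _ "Y powr s * C"]) auto
  qed
qed

lemma norm_matrix_le:
  fixes H :: "complex^'t::finite^'r::finite"
  assumes "\<And>i j. cmod (H $ i $ j) \<le> C"
  shows "norm H \<le> real (CARD('r) * CARD('t)) * C"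
proof -
  have "norm H \<le> (\<Sum>i\<in>UNIV. norm (H $ i))"
    unfolding norm_vec_def[of H] by (rule L2_set_le_sum) auto
  also have "\<dots> \<le> (\<Sum>i\<in>(UNIV::'r set). \<Sum>j\<in>(UNIV::'t set). C)"
  proof (rule sum_mono)
    fix i
    have "norm (H $ i) \<le> (\<Sum>j\<in>UNIV. norm (H $ i $ j))"
      unfolding norm_vec_def[of "H $ i"] by (rule L2_set_le_sum) auto
    also have "\<dots> \<le> (\<Sum>j\<in>(UNIV::'t set). C)" by (intro sum_mono assms)
    finally show "norm (H $ i) \<le> (\<Sum>j\<in>(UNIV::'t set). C)" .
  qed
  finally show ?thesis by simp
qed

text \<open>The entries are at most \<open>C\<close> on the event, so the Gaussian density is at
  least the constant \<open>g\<close> there, and the Lebesgue volume transfers.\<close>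

lemma measure_gram_det_le_event:
  fixes \<alpha> :: "nat \<Rightarrow> real"
  assumes \<alpha>: "\<And>L. 0 \<le> \<alpha> L" "\<And>L. \<alpha> L \<le> 1"
  shows "\<exists>C\<ge>1. \<exists>c>0. \<forall>x\<ge>1. measure cgauss {H :: complex^'t::finite^'r::finite.
      gram_det x H \<le> C * x powr pivot_sum (\<lambda>L. 1 - \<alpha> L) CARD('r) CARD('t)}
    \<ge> c * x powr (- pivot_sum (\<lambda>L. real L * \<alpha> L) CARD('r) CARD('t))"
proof -
  interpret finite_measure "cgauss :: (complex^'t^'r) measure"
    by (rule finite_measure_cgauss)
  obtain C c where C: "C \<ge> 1" and c: "c > 0"
    and ev: "\<And>(S :: 'r set) (T :: 't set) x. card S = CARD('r) \<Longrightarrow> card T = CARD('t) \<Longrightarrow> x \<ge> 1 \<Longrightarrow> pivot_event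
        \<alpha> C c x S T"
    using ex_pivot_event[where \<alpha> = \<alpha> and 'r = 'r and 't = 't and m = "CARD('r)" and n = "CARD('t)", OF
        \<alpha>] by blast
  define g where "g = (1 / pi) ^ (CARD('t) * CARD('r)) * exp (- (real (CARD('r) * CARD('t)) * C)\<^sup>2)"
  have g: "g > 0" by (simp add: g_def)
  have "measure cgauss {H :: complex^'t^'r.
      gram_det x H \<le> C * x powr pivot_sum (\<lambda>L. 1 - \<alpha> L) CARD('r) CARD('t)}
    \<ge> g * c * x powr (- pivot_sum (\<lambda>L. real L * \<alpha> L) CARD('r) CARD('t))" if x: "x \<ge> 1" for x
  proof -
    let ?A = "{H :: complex^'t^'r. gram_det x H \<le> C * x powr pivot_sum (\<lambda>L. 1 - \<alpha> L) CARD('r) CARD('t)}"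
    obtain E where E: "E \<in> sets (cprod (UNIV :: ('r \<times> 't) set))"
      and E_le: "\<And>h i. h \<in> E \<Longrightarrow> cmod (h i) \<le> C"
      and E_det: "\<And>h. h \<in> E \<Longrightarrow> (mat_of UNIV UNIV h :: complex^'t^'r) \<in> ?A"
      and E_meas: "emeasure (cprod UNIV) E \<ge> ennreal (c * x powr (- pivot_sum (\<lambda>L. real L * \<alpha> L)
          CARD('r) CARD('t)))"
      using ev[OF refl refl x] unfolding pivot_event_def UNIV_Times_UNIV by auto
    have "ennreal (g * c * x powr (- pivot_sum (\<lambda>L. real L * \<alpha> L) CARD('r) CARD('t))) =
        ennreal g * ennreal (c * x powr (- pivot_sum (\<lambda>L. real L * \<alpha> L) CARD('r) CARD('t)))"
      using g c by (simp add: ennreal_mult[symmetric] mult_ac)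
    also have "\<dots> \<le> ennreal g * emeasure (cprod UNIV) E"
      by (intro mult_left_mono E_meas) auto
    also have "\<dots> = (\<integral>\<^sup>+h. ennreal g * indicator E h \<partial>cprod UNIV)"
      using E by (rule nn_integral_cmult_indicator[symmetric])
    also have "\<dots> \<le> (\<integral>\<^sup>+h. ennreal (cgauss_density (mat_of UNIV UNIV h :: complex^'t^'r)) * indicator ?A
        (mat_of UNIV UNIV h) \<partial>cprod UNIV)"
    proof (rule nn_integral_mono)
      fix h :: "'r \<times> 't \<Rightarrow> complex"
      show "ennreal g * indicator E h \<le> ennreal (cgauss_density (mat_of UNIV UNIV h :: complex^'t^'r)) *
          indicator ?A (mat_of UNIV UNIV h)"
      proof (cases "h \<in> E")
        case True
        have "norm (mat_of UNIV UNIV h :: complex^'t^'r) \<le> real (CARD('r) * CARD('t)) * C"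
          by (rule norm_matrix_le) (use E_le[OF True] in \<open>simp add: mat_of_def\<close>)
        hence "(norm (mat_of UNIV UNIV h :: complex^'t^'r))\<^sup>2 \<le> (real (CARD('r) * CARD('t)) * C)\<^sup>2"
          by (intro power_mono) auto
        hence "g \<le> cgauss_density (mat_of UNIV UNIV h :: complex^'t^'r)"
          unfolding g_def cgauss_density_def by (intro mult_left_mono) auto
        thus ?thesis using E_det[OF True] True by (simp add: ennreal_leI)
      qed auto
    qed
    also have "\<dots> = (\<integral>\<^sup>+H. ennreal (cgauss_density H) * indicator ?A H \<partial>lborel)"
      by (rule nn_integral_lborel_matrix[symmetric]) measurable
    also have "\<dots> = emeasure cgauss ?A"
      by (rule emeasure_cgauss[symmetric]) measurable
    also have "\<dots> = ennreal (measure cgauss ?A)"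
      by (simp add: emeasure_eq_measure)
    finally show ?thesis by (subst (asm) ennreal_le_iff) auto
  qed
  thus ?thesis using C g c by (intro exI[of _ C] conjI exI[of _ "g * c"]) auto
qed

text \<open>The pivots are prescribed for a slightly smaller rate r' = r - d. The factor
  \<open>x powr d\<close> gained in this way eventually absorbs C / Y; room for r' is the reason for
  assuming r > 0.\<close>

lemma measure_gram_det_le_lower:
  assumes r: "r > 0" and Y: "Y > 0" and \<delta>: "\<delta> > 0"
  shows "\<exists>c>0. \<forall>\<^sub>F x in at_top. measure cgauss {H :: complex^'t::finite^'r::finite. gram_det x H \<le> Y * x
      powr r}
           \<ge> c * x powr (- dmt CARD('r) CARD('t) r - \<delta>)"
proof -
  interpret finite_measure "cgauss :: (complex^'t^'r) measure"
    by (rule finite_measure_cgauss)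
  define K where "K = min CARD('r) CARD('t)"
  define T where "T = CARD('r) + CARD('t) - 1"
  define Z where "Z = (\<Sum>i<K. real (T - 2 * i))"
  have Z: "Z \<ge> 0" unfolding Z_def by (intro sum_nonneg) auto
  \<comment> \<open>\<open>Z\<close> is the Lipschitz constant of \<open>dmt\<close>, so moving from
    r to r' costs at most d * Z \<le> \<delta>.\<close>
  define d where "d = min r (\<delta> / (1 + Z))"
  have d: "0 < d" "d \<le> r" "d * Z \<le> \<delta>"
  proof -
    show "0 < d" "d \<le> r" using r \<delta> Z by (auto simp: d_def)
    have "d * Z \<le> \<delta> / (1 + Z) * Z" using Z by (intro mult_right_mono) (auto simp: d_def)
    also have "\<dots> \<le> \<delta>" using Z \<delta> by (simp add: field_simps)
    finally show "d * Z \<le> \<delta>" .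
  qed
  define r' where "r' = r - d"
  have r': "r' \<ge> 0" "r' < r" using d by (auto simp: r'_def)
  \<comment> \<open>The pivot number is recovered from its cross size as i = (T - L) / 2.\<close>
  define \<alpha> where "\<alpha> L = unit_clamp ((real T - real L) / 2 + 1 - r')" for L :: nat
  have \<alpha>: "0 \<le> \<alpha> L" "\<alpha> L \<le> 1" for L by (auto simp: \<alpha>_def unit_clamp_def)
  have \<alpha>_eq: "\<alpha> (T - 2 * i) = unit_clamp (real i + 1 - r')" if "i < K" for i
  proof -
    have "2 * i \<le> T" using that by (auto simp: K_def T_def)
    thus ?thesis by (simp add: \<alpha>_def of_nat_diff)
  qed
  have e1: "pivot_sum (\<lambda>L. 1 - \<alpha> L) CARD('r) CARD('t) \<le> r'"
  proof -
    have "pivot_sum (\<lambda>L. 1 - \<alpha> L) CARD('r) CARD('t) = (\<Sum>i<K. unit_clamp (r' - real i))"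
      unfolding pivot_sum_eq_sum K_def[symmetric] T_def[symmetric]
      by (intro sum.cong refl) (simp add: \<alpha>_eq unit_clamp_diff)
    also have "\<dots> \<le> r'" using r' by (simp add: sum_unit_clamp)
    finally show ?thesis .
  qed
  have e2: "pivot_sum (\<lambda>L. real L * \<alpha> L) CARD('r) CARD('t) \<le> dmt CARD('r) CARD('t) r + \<delta>"
  proof -
    have "pivot_sum (\<lambda>L. real L * \<alpha> L) CARD('r) CARD('t) = dmt CARD('r) CARD('t) r'"
      unfolding pivot_sum_eq_sum dmt_def K_def[symmetric] T_def[symmetric]
      by (intro sum.cong refl) (simp add: \<alpha>_eq)
    also have "\<dots> \<le> dmt CARD('r) CARD('t) r + d * Z"
      using dmt_lipschitz[of r' r "CARD('r)" "CARD('t)"] r'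
      by (simp add: Z_def K_def T_def r'_def)
    finally show ?thesis using d by simp
  qed
  obtain C c where C: "C \<ge> 1" and c: "c > 0" and ev: "\<And>x. x \<ge> 1 \<Longrightarrow> measure cgauss {H :: complex^'t^'r.
      gram_det x H \<le> C * x powr pivot_sum (\<lambda>L. 1 - \<alpha> L) CARD('r) CARD('t)}
    \<ge> c * x powr (- pivot_sum (\<lambda>L. real L * \<alpha> L) CARD('r) CARD('t))"
    using measure_gram_det_le_event[where \<alpha> = \<alpha> and 't = 't and 'r = 'r, OF \<alpha>] by blast
  have "\<forall>\<^sub>F x in at_top. x powr d \<ge> C / Y"
    using eventually_ge_at_top[of "(C / Y) powr (1 / d)"]
  proof eventually_elim
    case (elim x)
    have "((C / Y) powr (1 / d)) powr d \<le> x powr d"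
      using elim d by (intro powr_mono2) auto
    thus ?case using d C Y by (simp add: powr_powr)
  qed
  moreover have "\<forall>\<^sub>F x in at_top. x \<ge> (1 :: real)" by (rule eventually_ge_at_top)
  ultimately have "\<forall>\<^sub>F x in at_top. measure cgauss {H :: complex^'t^'r. gram_det x H \<le> Y * x powr r}
           \<ge> c * x powr (- dmt CARD('r) CARD('t) r - \<delta>)"
  proof eventually_elim
    case (elim x)
    have "C * x powr pivot_sum (\<lambda>L. 1 - \<alpha> L) CARD('r) CARD('t) \<le> C * x powr r'"
      using C elim e1 by (intro mult_left_mono powr_mono) auto
    also have "\<dots> \<le> (Y * x powr d) * x powr r'"
      using elim Y by (intro mult_right_mono) (auto simp: field_simps)
    also have "\<dots> = Y * x powr r" by (simp add: r'_def powr_add[symmetric] mult.assoc)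
    finally have le: "C * x powr pivot_sum (\<lambda>L. 1 - \<alpha> L) CARD('r) CARD('t) \<le> Y * x powr r" .
    have "c * x powr (- dmt CARD('r) CARD('t) r - \<delta>) \<le> c * x powr (- pivot_sum (\<lambda>L. real L * \<alpha> L)
        CARD('r) CARD('t))"
      using c elim e2 by (intro mult_left_mono powr_mono) auto
    also have "\<dots> \<le> measure cgauss {H :: complex^'t^'r.
      gram_det x H \<le> C * x powr pivot_sum (\<lambda>L. 1 - \<alpha> L) CARD('r) CARD('t)}"
      using ev elim by simp
    also have "\<dots> \<le> measure cgauss {H :: complex^'t^'r. gram_det x H \<le> Y * x powr r}"
      using le by (intro finite_measure_mono) auto
    finally show ?case .
  qed
  thus ?thesis using c by blast
qed

section \<open>The expected distortion\<close>

definition expw :: "real \<Rightarrow> real" where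
  "expw \<gamma> = indicator {0..} \<gamma> * exp (- \<gamma>)"

lemma expw_nonneg: "expw \<gamma> \<ge> 0"
  by (simp add: expw_def)

lemma borel_measurable_expw [measurable]: "expw \<in> borel_measurable borel"
  unfolding expw_def[abs_def] by measurable

lemma integrable_expw_powr:
  assumes "\<theta> < 1"
  shows "integrable lborel (\<lambda>\<gamma>. expw \<gamma> * \<gamma> powr (- \<theta>))"
proof -
  have "((\<lambda>t. t powr ((1 - \<theta>) - 1) / exp t) has_integral Gamma (1 - \<theta>)) {0..}"
    using assms by (intro Gamma_integral_real) simp
  hence "(\<lambda>t. t powr (- \<theta>) / exp t) integrable_on {0..}"
    by (auto simp: integrable_on_def)
  hence "(\<lambda>t. t powr (- \<theta>) / exp t) absolutely_integrable_on {0..}"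
    by (rule nonnegative_absolutely_integrable_1) auto
  hence "integrable lebesgue (\<lambda>t. expw t * t powr (- \<theta>))"
    by (simp add: set_integrable_def expw_def exp_minus field_simps)
  thus ?thesis by (subst (asm) integrable_completion) auto
qed

lemma integrable_expw: "integrable lborel expw"
proof (rule Bochner_Integration.integrable_cong_AE_imp[OF integrable_expw_powr[of 0]])
  show "AE \<gamma> in lborel. expw \<gamma> * \<gamma> powr (- 0) = expw \<gamma>"
    using AE_lborel_singleton[of "0::real"] by eventually_elim auto
qed auto

lemma integrable_expw_mult:
  assumes "g \<in> borel_measurable borel" "\<And>\<gamma>. \<gamma> \<ge> 0 \<Longrightarrow> \<bar>g \<gamma>\<bar> \<le> B"
  shows "integrable lborel (\<lambda>\<gamma>. expw \<gamma> * g \<gamma>)"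
proof (rule Bochner_Integration.integrable_bound)
  show "integrable lborel (\<lambda>\<gamma>. expw \<gamma> * B)"
    by (intro integrable_mult_left integrable_expw)
  have "norm (expw \<gamma> * g \<gamma>) \<le> norm (expw \<gamma> * B)" for \<gamma>
  proof (cases "\<gamma> \<ge> 0")
    case True
    hence "\<bar>g \<gamma>\<bar> \<le> \<bar>B\<bar>" using assms(2)[OF True] by linarith
    thus ?thesis by (simp add: abs_mult mult_left_mono)
  qed (simp add: expw_def)
  thus "AE \<gamma> in lborel. norm (expw \<gamma> * g \<gamma>) \<le> norm (expw \<gamma> * B)" by simp
qed (use assms(1) in measurable)

definition mean_dist :: "real \<Rightarrow> real \<Rightarrow> real" where
  "mean_dist s y = (\<integral>\<gamma>. expw \<gamma> * (1 / (s * \<gamma> + y)) \<partial>lborel)"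

lemma integrable_mean_dist:
  assumes "s \<ge> 0" "y \<ge> 1"
  shows "integrable lborel (\<lambda>\<gamma>. expw \<gamma> * (1 / (s * \<gamma> + y)))"
  by (rule integrable_expw_mult[where B = 1]) (use assms in \<open>auto simp: divide_simps add_increasing\<close>)

lemma mean_dist_nonneg: "s \<ge> 0 \<Longrightarrow> y \<ge> 1 \<Longrightarrow> mean_dist s y \<ge> 0"
  unfolding mean_dist_def by (intro integral_nonneg_AE AE_I2) (auto simp: expw_def indicator_def)

lemma mean_dist_le_inverse:
  assumes "s \<ge> 0" "y \<ge> 1"
  shows "mean_dist s y \<le> (\<integral>\<gamma>. expw \<gamma> \<partial>lborel) * (1 / y)"
proof -
  have "mean_dist s y \<le> (\<integral>\<gamma>. expw \<gamma> * (1 / y) \<partial>lborel)"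
    unfolding mean_dist_def
  proof (intro integral_mono integrable_mean_dist assms integrable_mult_left integrable_expw)
    fix \<gamma>
    show "expw \<gamma> * (1 / (s * \<gamma> + y)) \<le> expw \<gamma> * (1 / y)"
    proof (cases "\<gamma> \<ge> 0")
      case True
      hence "1 / (s * \<gamma> + y) \<le> 1 / y" using assms by (intro divide_left_mono) (auto simp: add_nonneg_pos)
      thus ?thesis by (intro mult_left_mono expw_nonneg)
    qed (simp add: expw_def)
  qed
  thus ?thesis by simp
qed

text \<open>With z = s * \<gamma>, \<open>z powr \<theta> \<le> z + y\<close> holds since y \<ge> 1
  and 0 \<le> \<theta> \<le> 1. The value \<theta> = 1 is out of reach, as 1 / \<gamma> is not
  integrable at 0; for y = 1 the mean really carries a factor of order log s.\<close>

lemma mean_dist_le_powr: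
  assumes "s > 0" "y \<ge> 1" "0 \<le> \<theta>" "\<theta> < 1"
  shows "mean_dist s y \<le> (\<integral>\<gamma>. expw \<gamma> * \<gamma> powr (- \<theta>) \<partial>lborel) * s powr (- \<theta>)"
proof -
  have "mean_dist s y \<le> (\<integral>\<gamma>. expw \<gamma> * \<gamma> powr (- \<theta>) * s powr (- \<theta>) \<partial>lborel)"
    unfolding mean_dist_def
  proof (rule integral_mono_AE)
    show "integrable lborel (\<lambda>\<gamma>. expw \<gamma> * (1 / (s * \<gamma> + y)))"
      using assms by (intro integrable_mean_dist) auto
    show "integrable lborel (\<lambda>\<gamma>. expw \<gamma> * \<gamma> powr (- \<theta>) * s powr (- \<theta>))"
      using assms by (intro integrable_mult_left integrable_expw_powr) auto
    show "AE \<gamma> in lborel. expw \<gamma> * (1 / (s * \<gamma> + y)) \<le> expw \<gamma> * \<gamma> powr (- \<theta>) * s powr (- \<theta>)"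
      using AE_lborel_singleton[of "0::real"]
    proof eventually_elim
      case (elim \<gamma>)
      show ?case
      proof (cases "\<gamma> > 0")
        case True
        define z where "z = s * \<gamma>"
        have z: "z > 0" using True assms by (simp add: z_def)
        have "z powr \<theta> \<le> z + y"
        proof (cases "z \<ge> 1")
          case True
          hence "z powr \<theta> \<le> z powr 1" using assms by (intro powr_mono) auto
          thus ?thesis using True assms by simp
        next
          case False
          hence "z powr \<theta> \<le> 1 powr \<theta>" using assms z by (intro powr_mono2) auto
          thus ?thesis using z assms by simp
        qed
        hence "1 / (z + y) \<le> 1 / z powr \<theta>" using z assms by (intro divide_left_mono mult_pos_pos) auto
        also have "\<dots> = \<gamma> powr (- \<theta>) * s powr (- \<theta>)"
          using True assms by (simp add: z_def powr_mult powr_minus field_simps)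
        finally have "expw \<gamma> * (1 / (z + y)) \<le> expw \<gamma> * (\<gamma> powr (- \<theta>) * s powr (- \<theta>))"
          by (intro mult_left_mono expw_nonneg)
        thus ?thesis by (simp add: z_def mult.assoc)
      next
        case False
        thus ?thesis using elim by (simp add: expw_def)
      qed
    qed
  qed
  thus ?thesis by simp
qed

lemma integral_expw_indicator_ge:
  assumes "0 \<le> t" "t \<le> 1"
  shows "(\<integral>\<gamma>. expw \<gamma> * indicator {0..t} \<gamma> \<partial>lborel) \<ge> exp (-1) * t"
proof -
  have "exp (-1) * t = (\<integral>\<gamma>. exp (-1) * indicator {0..t} \<gamma> \<partial>lborel)"
    using assms by simp
  also have "\<dots> \<le> (\<integral>\<gamma>. expw \<gamma> * indicator {0..t} \<gamma> \<partial>lborel)"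
  proof (rule integral_mono)
    show "integrable lborel (\<lambda>\<gamma>. exp (-1) * indicator {0..t} \<gamma> :: real)"
      using assms by (intro integrable_mult_right) (simp add: integrable_indicator_iff)
    show "integrable lborel (\<lambda>\<gamma>. expw \<gamma> * indicator {0..t} \<gamma>)"
      by (rule integrable_expw_mult[where B = 1]) (auto simp: indicator_def)
  qed (use assms in \<open>auto simp: expw_def indicator_def\<close>)
  finally show ?thesis .
qed

lemma mean_dist_ge:
  assumes "s > 0" "y \<ge> 1"
  shows "mean_dist s y \<ge> exp (-1) / (s + y)"
proof -
  have "exp (-1) / (s + y) \<le> (\<integral>\<gamma>. expw \<gamma> * indicator {0..1} \<gamma> \<partial>lborel) * (1 / (s + y))"
    using integral_expw_indicator_ge[of 1] assms by (simp add: divide_right_mono)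
  also have "\<dots> = (\<integral>\<gamma>. expw \<gamma> * indicator {0..1} \<gamma> * (1 / (s + y)) \<partial>lborel)" by simp
  also have "\<dots> \<le> mean_dist s y"
    unfolding mean_dist_def
  proof (rule integral_mono)
    show "integrable lborel (\<lambda>\<gamma>. expw \<gamma> * indicator {0..1} \<gamma> * (1 / (s + y)))"
      by (intro integrable_mult_left integrable_expw_mult[where B = 1]) (auto simp: indicator_def)
    show "integrable lborel (\<lambda>\<gamma>. expw \<gamma> * (1 / (s * \<gamma> + y)))"
      using assms by (intro integrable_mean_dist) auto
    fix \<gamma>
    show "expw \<gamma> * indicator {0..1} \<gamma> * (1 / (s + y)) \<le> expw \<gamma> * (1 / (s * \<gamma> + y))"
    proof (cases "\<gamma> \<in> {0..1}")
      case True
      hence "s * \<gamma> \<le> s" using assms by (simp add: mult_left_le)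
      hence "1 / (s + y) \<le> 1 / (s * \<gamma> + y)"
        using assms True by (intro divide_left_mono) (auto simp: add_nonneg_pos)
      thus ?thesis using True by (simp add: mult_left_mono expw_nonneg del: times_divide_eq_right)
    next
      case False
      thus ?thesis using assms by (auto simp: expw_def indicator_def)
    qed
  qed
  finally show ?thesis .
qed

section \<open>Outage as an event on the determinant\<close>

lemma two_powr_mult_log: "\<rho> > 0 \<Longrightarrow> 2 powr (c * (r * log 2 \<rho>)) = \<rho> powr (c * r)"
  by (simp add: powr_def log_def mult_ac)

text \<open>1 + (u - 1) / y is a convex combination of 1 and \<open>u\<close>. The maximum with 0
  covers u < 1, which the slack \<epsilon> causes at rates near 0.\<close>

lemma log_one_plus_div_le:
  assumes u: "u > 0" and y: "y \<ge> (1 :: real)"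
  shows "log 2 (1 + (u - 1) / y) \<le> max 0 (log 2 u)"
proof (cases "u \<ge> 1")
  case True
  have "(u - 1) / y \<le> (u - 1) / 1" using True y by (intro divide_left_mono) auto
  hence "log 2 (1 + (u - 1) / y) \<le> log 2 u"
    using True y by (subst log_le_cancel_iff) (auto intro: add_pos_nonneg)
  thus ?thesis by simp
next
  case False
  hence "(u - 1) / y \<le> 0" using y by (simp add: divide_nonpos_pos)
  moreover have "1 + (u - 1) / y > 0"
  proof -
    have "1 + (u - 1) / y = (y - 1 + u) / y" using y by (simp add: field_simps)
    thus ?thesis using u y by simp
  qed
  ultimately have "log 2 (1 + (u - 1) / y) \<le> log 2 1"
    by (subst log_le_cancel_iff) auto
  thus ?thesis by simp
qed

lemma log_one_plus_div_ge:
  assumes u: "u > 0" and y: "y \<ge> (1 :: real)" "y \<le> 2"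
  shows "log 2 (1 + (u - 1) / y) \<ge> log 2 u - 1"
proof -
  have "log 2 u - 1 = log 2 (u / 2)" using u by (simp add: log_divide)
  also have "u / 2 \<le> u / y" using u y by (intro divide_left_mono) auto
  hence "log 2 (u / 2) \<le> log 2 (u / y)" using u y by (subst log_le_cancel_iff) auto
  also have "u / y \<le> (y - 1 + u) / y" using y by (intro divide_right_mono) auto
  hence "log 2 (u / y) \<le> log 2 ((y - 1 + u) / y)" using u y by (subst log_le_cancel_iff) auto
  also have "(y - 1 + u) / y = 1 + (u - 1) / y" using y by (simp add: field_simps)
  finally show ?thesis .
qed

context
  fixes b \<epsilon> \<rho> s r :: real and H :: "complex^'t::finite^'r::finite"
  assumes b: "b > 0" and eps: "\<epsilon> > 0" and \<rho>: "\<rho> \<ge> 1" and s: "s > 0" and r: "r \<ge> 0"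
begin

private definition "x = \<rho> / real (min CARD('t) CARD('r))"

private lemma x_nonneg: "x \<ge> 0"
  using \<rho> by (simp add: x_def)

private lemma outage_iff:
  "outage_ld b \<rho> s \<epsilon> (r * log 2 \<rho>) H \<gamma> \<longleftrightarrow>
     log 2 (1 + (\<rho> powr (b * r) * 2 powr (- \<epsilon>) - 1) / (\<gamma> * s + 1)) \<ge> b * log 2 (gram_det x H)"
proof -
  have "2 powr (b * (r * log 2 \<rho>) - \<epsilon>) = \<rho> powr (b * r) * 2 powr (- \<epsilon>)"
    using \<rho> two_powr_mult_log[of \<rho> b r] by (simp add: powr_diff powr_minus field_simps)
  thus ?thesis by (simp add: outage_ld_def gram_det_def x_def)
qed

private lemma log_u: "log 2 (\<rho> powr (b * r) * 2 powr (- \<epsilon>)) = b * (r * log 2 \<rho>) - \<epsilon>"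
  using \<rho> by (simp add: log_mult log_powr)

text \<open>Side information of any quality only shrinks the threshold, so the bound is uniform in
  \<gamma>.\<close>

lemma outage_imp_gram_det_le:
  assumes "outage_ld b \<rho> s \<epsilon> (r * log 2 \<rho>) H \<gamma>" "\<gamma> \<ge> 0"
  shows "gram_det (\<rho> / real (min CARD('t) CARD('r))) H \<le> \<rho> powr r"
proof -
  have "b * log 2 (gram_det x H) \<le> max 0 (log 2 (\<rho> powr (b * r) * 2 powr (- \<epsilon>)))"
    using assms s \<rho> unfolding outage_iff
    by (intro order.trans[OF _ log_one_plus_div_le[of _ "\<gamma> * s + 1"]]) auto
  also have "\<dots> \<le> b * (r * log 2 \<rho>)"
    using b r \<rho> eps unfolding log_u by simp
  finally have "log 2 (gram_det x H) \<le> log 2 (\<rho> powr r)"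
    using b \<rho> by (simp add: log_powr)
  thus ?thesis
    using \<rho> gram_det_pos[OF x_nonneg, of H] by (subst (asm) log_le_cancel_iff) (auto simp: x_def)
qed

text \<open>When \<gamma> * s \<le> 1, side information lowers the required rate by at most one bit.
  Together with \<epsilon> and after division by \<open>b\<close>, this bit is the constant in front
  of \<open>\<rho> powr r\<close>.\<close>

lemma outage_if_gram_det_le:
  assumes "gram_det (\<rho> / real (min CARD('t) CARD('r))) H \<le> 2 powr (- (\<epsilon> + 1) / b) * \<rho> powr r"
    and "0 \<le> \<gamma>" "\<gamma> * s \<le> 1"
  shows "outage_ld b \<rho> s \<epsilon> (r * log 2 \<rho>) H \<gamma>"
proof -
  have "log 2 (gram_det x H) \<le> log 2 (2 powr (- (\<epsilon> + 1) / b) * \<rho> powr r)"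
    using assms(1) \<rho> gram_det_pos[OF x_nonneg, of H] by (subst log_le_cancel_iff) (auto simp: x_def)
  also have "\<dots> = - (\<epsilon> + 1) / b + r * log 2 \<rho>"
    using \<rho> by (simp add: log_mult log_powr)
  finally have "b * log 2 (gram_det x H) \<le> b * (- (\<epsilon> + 1) / b + r * log 2 \<rho>)"
    using b by (intro mult_left_mono) auto
  also have "\<dots> = log 2 (\<rho> powr (b * r) * 2 powr (- \<epsilon>)) - 1"
    unfolding log_u using b by (simp add: field_simps)
  also have "\<dots> \<le> log 2 (1 + (\<rho> powr (b * r) * 2 powr (- \<epsilon>) - 1) / (\<gamma> * s + 1))"
    using assms s \<rho> by (intro log_one_plus_div_ge) auto
  finally show ?thesis unfolding outage_iff .
qed

end

section \<open>Averaging over the side-information gain\<close>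

definition cond_dist :: "real \<Rightarrow> real \<Rightarrow> real \<Rightarrow> real \<Rightarrow> real \<Rightarrow> complex^'t::finite^'r::finite \<Rightarrow> real \<Rightarrow> real" where
  "cond_dist b \<rho> s \<epsilon> r H \<gamma> =
     (if outage_ld b \<rho> s \<epsilon> (r * log 2 \<rho>) H \<gamma> then 1 / (s * \<gamma> + 1) else 1 / (s * \<gamma> + \<rho> powr (b * r)))"

lemma ED_ld_eq:
  assumes "\<rho> > 0"
  shows "ED_ld TYPE('t::finite) TYPE('r::finite) b \<rho> s \<epsilon> (r * log 2 \<rho>) =
    (\<integral>H. cgauss_density H *\<^sub>R (\<integral>\<gamma>. expw \<gamma> * cond_dist b \<rho> s \<epsilon> r (H :: complex^'t^'r) \<gamma> \<partial>lborel) \<partial>lborel)"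
  unfolding ED_ld_def Dd_def cond_dist_def expw_def using two_powr_mult_log[OF assms, of b r]
  by (simp cong: if_cong)

lemma borel_measurable_cond_dist:
  "(\<lambda>(H, \<gamma>). cond_dist b \<rho> s \<epsilon> r (H :: complex^'t::finite^'r::finite) \<gamma>) \<in> borel_measurable (borel \<Otimes>\<^sub>M borel)"
proof -
  have g: "(\<lambda>y. gram_det x (fst y :: complex^'t^'r)) \<in> borel_measurable (borel \<Otimes>\<^sub>M (borel :: real
      measure))" for x
    by (rule measurable_compose[OF measurable_fst borel_measurable_gram_det_borel])
  have l: "(\<lambda>y. log 2 (1 + c / (snd y * s + 1))) \<in> borel_measurable ((borel :: (complex^'t^'r) measure)
      \<Otimes>\<^sub>M borel)" for c
    by measurable
  have "{y \<in> space (borel \<Otimes>\<^sub>M borel). outage_ld b \<rho> s \<epsilon> (r * log 2 \<rho>) (fst y :: complex^'t^'r) (snd y)}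
      \<in> sets (borel \<Otimes>\<^sub>M borel)"
    unfolding outage_ld_def gram_det_def[symmetric]
    by (intro borel_measurable_le borel_measurable_times borel_measurable_const borel_measurable_log g l)
  thus ?thesis unfolding cond_dist_def split_beta
    by (intro measurable_If) (measurable, simp)
qed

lemma cond_dist_bounds:
  assumes "b > 0" "\<rho> \<ge> 1" "s > 0" "r \<ge> 0" "\<gamma> \<ge> 0"
  shows "1 / (s * \<gamma> + \<rho> powr (b * r)) \<le> cond_dist b \<rho> s \<epsilon> r H \<gamma>"
    and "cond_dist b \<rho> s \<epsilon> r H \<gamma> \<le> 1 / (s * \<gamma> + 1)"
    and "0 \<le> cond_dist b \<rho> s \<epsilon> r H \<gamma>" "cond_dist b \<rho> s \<epsilon> r H \<gamma> \<le> 1"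
proof -
  have y: "\<rho> powr (b * r) \<ge> 1" using assms by (intro ge_one_powr_ge_zero) auto
  have le: "1 / (s * \<gamma> + \<rho> powr (b * r)) \<le> 1 / (s * \<gamma> + 1)"
    using y assms by (intro divide_left_mono) (auto intro!: mult_pos_pos add_nonneg_pos)
  have 1: "1 / (s * \<gamma> + 1) \<le> 1" using assms by (simp add: divide_simps)
  have 0: "0 \<le> 1 / (s * \<gamma> + \<rho> powr (b * r))" using assms by simp
  show "1 / (s * \<gamma> + \<rho> powr (b * r)) \<le> cond_dist b \<rho> s \<epsilon> r H \<gamma>"
    and "cond_dist b \<rho> s \<epsilon> r H \<gamma> \<le> 1 / (s * \<gamma> + 1)"
    and "0 \<le> cond_dist b \<rho> s \<epsilon> r H \<gamma>" "cond_dist b \<rho> s \<epsilon> r H \<gamma> \<le> 1"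
    using le 1 0 assms by (auto simp: cond_dist_def)
qed

definition cond_mean :: "real \<Rightarrow> real \<Rightarrow> real \<Rightarrow> real \<Rightarrow> real \<Rightarrow> complex^'t::finite^'r::finite \<Rightarrow> real" where
  "cond_mean b \<rho> s \<epsilon> r H = (\<integral>\<gamma>. expw \<gamma> * cond_dist b \<rho> s \<epsilon> r H \<gamma> \<partial>lborel)"

lemma borel_measurable_cond_mean [measurable]:
  "(cond_mean b \<rho> s \<epsilon> r :: complex^'t::finite^'r::finite \<Rightarrow> real) \<in> borel_measurable borel"
proof -
  note borel_measurable_cond_dist[of b \<rho> s \<epsilon> r, measurable]
  have "(\<lambda>H :: complex^'t^'r. \<integral>\<gamma>. expw \<gamma> * cond_dist b \<rho> s \<epsilon> r H \<gamma> \<partial>lborel) \<in> borel_measurable borel"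
  proof (rule lborel.borel_measurable_lebesgue_integral)
    have "(\<lambda>y. expw (snd y) * (case y of (H, \<gamma>) \<Rightarrow> cond_dist b \<rho> s \<epsilon> r (H :: complex^'t^'r) \<gamma>)) \<in>
        borel_measurable (borel \<Otimes>\<^sub>M borel)"
      by (intro borel_measurable_times borel_measurable_cond_dist measurable_compose[OF measurable_snd
          borel_measurable_expw])
    thus "(\<lambda>(H :: complex^'t^'r, \<gamma>). expw \<gamma> * cond_dist b \<rho> s \<epsilon> r H \<gamma>) \<in> borel_measurable (borel \<Otimes>\<^sub>M lborel)"
      by (simp add: split_beta cong: measurable_cong_sets)
  qed
  thus ?thesis unfolding cond_mean_def[abs_def] .
qed

lemma ED_ld_eq_integral_cgauss:
  assumes "\<rho> > 0"
  shows "ED_ld TYPE('t::finite) TYPE('r::finite) b \<rho> s \<epsilon> (r * log 2 \<rho>) =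
    (\<integral>H. cond_mean b \<rho> s \<epsilon> r (H :: complex^'t^'r) \<partial>cgauss)"
  unfolding ED_ld_eq[OF assms] cgauss_def cond_mean_def[symmetric]
  by (rule integral_density[symmetric]) (auto simp: cgauss_density_pos less_imp_le)

context
  fixes b \<epsilon> \<rho> s r :: real
  assumes b: "b > 0" and eps: "\<epsilon> > 0" and \<rho>: "\<rho> \<ge> 1" and s: "s > 0" and r: "r \<ge> 0"
begin

private lemma y_ge_1: "\<rho> powr (b * r) \<ge> 1"
  using b \<rho> r by (intro ge_one_powr_ge_zero) auto

private lemma integrable_cond_dist: "integrable lborel (\<lambda>\<gamma>. expw \<gamma> * cond_dist b \<rho> s \<epsilon> r (H ::
    complex^'t::finite^'r::finite) \<gamma>)"
proof (rule integrable_expw_mult[where B = 1])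
  show "(\<lambda>\<gamma>. cond_dist b \<rho> s \<epsilon> r H \<gamma>) \<in> borel_measurable borel"
  proof -
    have "(\<lambda>\<gamma>. case (H, \<gamma>) of (H, \<gamma>) \<Rightarrow> cond_dist b \<rho> s \<epsilon> r H \<gamma>) \<in> borel_measurable borel"
      by (rule measurable_compose[OF _ borel_measurable_cond_dist]) measurable
    thus ?thesis by simp
  qed
  fix \<gamma> :: real assume "\<gamma> \<ge> 0"
  thus "\<bar>cond_dist b \<rho> s \<epsilon> r H \<gamma>\<bar> \<le> 1"
    using cond_dist_bounds(3,4)[OF b \<rho> s r, of \<gamma> \<epsilon> H] by simp
qed

private lemma cond_mean_ge: "cond_mean b \<rho> s \<epsilon> r (H :: complex^'t::finite^'r::finite) \<ge> mean_dist s (\<rho>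
    powr (b * r))"
  unfolding cond_mean_def mean_dist_def
proof (intro integral_mono integrable_cond_dist integrable_mean_dist[OF less_imp_le[OF s] y_ge_1])
  fix \<gamma>
  show "expw \<gamma> * (1 / (s * \<gamma> + \<rho> powr (b * r))) \<le> expw \<gamma> * cond_dist b \<rho> s \<epsilon> r H \<gamma>"
  proof (cases "\<gamma> \<ge> 0")
    case True
    thus ?thesis by (intro mult_left_mono expw_nonneg cond_dist_bounds(1) b \<rho> s r)
  qed (simp add: expw_def)
qed

text \<open>Outage is replaced by an event on \<open>H\<close> alone, so its indicator factors out
  of the integral over \<gamma>.\<close>

private lemma cond_mean_le:
  "cond_mean b \<rho> s \<epsilon> r (H :: complex^'t::finite^'r::finite) \<le> mean_dist s (\<rho> powr (b * r)) +
     indicator {H. gram_det (\<rho> / real (min CARD('t) CARD('r))) H \<le> \<rho> powr r} H * mean_dist s 1"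
proof -
  let ?i = "indicator {H :: complex^'t^'r. gram_det (\<rho> / real (min CARD('t) CARD('r))) H \<le> \<rho> powr r} H
      :: real"
  have int: "integrable lborel (\<lambda>\<gamma>. expw \<gamma> * (1 / (s * \<gamma> + \<rho> powr (b * r))))" "integrable lborel (\<lambda>\<gamma>.
      expw \<gamma> * (1 / (s * \<gamma> + 1)))"
    using integrable_mean_dist[of s "\<rho> powr (b * r)"] integrable_mean_dist[of s 1] y_ge_1 s by auto
  have "cond_mean b \<rho> s \<epsilon> r H \<le> (\<integral>\<gamma>. expw \<gamma> * (1 / (s * \<gamma> + \<rho> powr (b * r))) + ?i * (expw \<gamma> * (1 / (s *
      \<gamma> + 1))) \<partial>lborel)"
    unfolding cond_mean_def
  proof (intro integral_mono integrable_cond_dist Bochner_Integration.integrable_add int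
      integrable_mult_right)
    fix \<gamma>
    show "expw \<gamma> * cond_dist b \<rho> s \<epsilon> r H \<gamma> \<le> expw \<gamma> * (1 / (s * \<gamma> + \<rho> powr (b * r))) + ?i * (expw \<gamma> * (1
        / (s * \<gamma> + 1)))"
    proof (cases "\<gamma> \<ge> 0")
      case True
      have "cond_dist b \<rho> s \<epsilon> r H \<gamma> \<le> 1 / (s * \<gamma> + \<rho> powr (b * r)) + ?i * (1 / (s * \<gamma> + 1))"
        using outage_imp_gram_det_le[OF b eps \<rho> s r, of H \<gamma>] True s by (auto simp: cond_dist_def)
      hence "expw \<gamma> * cond_dist b \<rho> s \<epsilon> r H \<gamma> \<le> expw \<gamma> * (1 / (s * \<gamma> + \<rho> powr (b * r)) + ?i * (1 / (s *
          \<gamma> + 1)))"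
        by (intro mult_left_mono expw_nonneg)
      thus ?thesis by (simp add: algebra_simps)
    qed (simp add: expw_def)
  qed
  also have "\<dots> = mean_dist s (\<rho> powr (b * r)) + ?i * mean_dist s 1"
    unfolding mean_dist_def
    by (subst Bochner_Integration.integral_add[OF int(1) integrable_mult_right[OF int(2)]])
       (simp only: integral_mult_right_zero)
  finally show ?thesis .
qed

text \<open>Only \<gamma> \<le> min 1 (1 / s) is kept. There outage occurs, the distortion is at
  least 1/2, and this window has probability at least its length divided by e.\<close>

private lemma cond_mean_ge_outage:
  assumes "gram_det (\<rho> / real (min CARD('t) CARD('r))) H \<le> 2 powr (- (\<epsilon> + 1) / b) * \<rho> powr r"
  shows "cond_mean b \<rho> s \<epsilon> r (H :: complex^'t::finite^'r::finite) \<ge> exp (-1) / 2 * min 1 (1 / s)"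
proof -
  define t where "t = min 1 (1 / s)"
  have t: "0 \<le> t" "t \<le> 1" "t * s \<le> 1"
    using s by (auto simp: t_def min_def field_simps)
  have "exp (-1) / 2 * t \<le> (\<integral>\<gamma>. expw \<gamma> * indicator {0..t} \<gamma> \<partial>lborel) * (1 / 2)"
    using integral_expw_indicator_ge[OF t(1,2)] by simp
  also have "\<dots> = (\<integral>\<gamma>. expw \<gamma> * indicator {0..t} \<gamma> * (1 / 2) \<partial>lborel)" by simp
  also have "\<dots> \<le> cond_mean b \<rho> s \<epsilon> r H"
    unfolding cond_mean_def
  proof (intro integral_mono integrable_cond_dist integrable_mult_left)
    show "integrable lborel (\<lambda>\<gamma>. expw \<gamma> * indicator {0..t} \<gamma>)"
      by (rule integrable_expw_mult[where B = 1]) (auto simp: indicator_def)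
    fix \<gamma>
    show "expw \<gamma> * indicator {0..t} \<gamma> * (1 / 2) \<le> expw \<gamma> * cond_dist b \<rho> s \<epsilon> r H \<gamma>"
    proof (cases "\<gamma> \<in> {0..t}")
      case True
      have "\<gamma> * s \<le> t * s" using True s by (intro mult_right_mono) auto
      hence gs: "\<gamma> * s \<le> 1" using t by linarith
      have "outage_ld b \<rho> s \<epsilon> (r * log 2 \<rho>) H \<gamma>"
        using outage_if_gram_det_le[OF b eps \<rho> s r assms _ gs] True by simp
      moreover have "1 / 2 \<le> 1 / (s * \<gamma> + 1)"
        using gs True s by (intro frac_le) (auto simp: mult.commute add_nonneg_pos)
      ultimately have "1 / 2 \<le> cond_dist b \<rho> s \<epsilon> r H \<gamma>"
        by (simp add: cond_dist_def)
      thus ?thesis using True by (simp add: mult_left_mono expw_nonneg del: times_divide_eq_right)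
    next
      case False
      show ?thesis
      proof (cases "\<gamma> \<ge> 0")
        case True
        thus ?thesis using False cond_dist_bounds(3)[OF b \<rho> s r True, of \<epsilon> H] expw_nonneg[of \<gamma>] by simp
      qed (simp add: expw_def)
    qed
  qed
  finally show ?thesis by (simp add: t_def)
qed

private lemma integrable_cond_mean: "integrable cgauss (cond_mean b \<rho> s \<epsilon> r ::
    complex^'t::finite^'r::finite \<Rightarrow> real)"
proof -
  interpret finite_measure "cgauss :: (complex^'t^'r) measure"
    by (rule finite_measure_cgauss)
  have "norm (cond_mean b \<rho> s \<epsilon> r H) \<le> mean_dist s (\<rho> powr (b * r)) + mean_dist s 1" for H :: "complex^'t^'r"
  proof -
    have "0 \<le> mean_dist s (\<rho> powr (b * r))" "0 \<le> mean_dist s 1"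
      using y_ge_1 s by (auto intro: mean_dist_nonneg)
    thus ?thesis using cond_mean_ge[of H] cond_mean_le[of H]
      by (cases "gram_det (\<rho> / real (min CARD('t) CARD('r))) H \<le> \<rho> powr r") auto
  qed
  thus ?thesis by (intro integrable_const_bound) auto
qed

lemma ED_ld_le:
  "ED_ld TYPE('t::finite) TYPE('r::finite) b \<rho> s \<epsilon> (r * log 2 \<rho>) \<le>
     mean_dist s (\<rho> powr (b * r)) * measure (cgauss :: (complex^'t^'r) measure) UNIV +
     mean_dist s 1 * measure cgauss {H :: complex^'t^'r. gram_det (\<rho> / real (min CARD('t) CARD('r))) H \<le>
         \<rho> powr r}"
proof -
  interpret finite_measure "cgauss :: (complex^'t^'r) measure"
    by (rule finite_measure_cgauss)
  let ?A = "{H :: complex^'t^'r. gram_det (\<rho> / real (min CARD('t) CARD('r))) H \<le> \<rho> powr r}"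
  have int: "integrable cgauss (indicator ?A :: complex^'t^'r \<Rightarrow> real)"
    by (simp add: integrable_indicator_iff emeasure_eq_measure)
  have "ED_ld TYPE('t::finite) TYPE('r::finite) b \<rho> s \<epsilon> (r * log 2 \<rho>) =
      (\<integral>H. cond_mean b \<rho> s \<epsilon> r (H :: complex^'t^'r) \<partial>cgauss)"
    using \<rho> by (intro ED_ld_eq_integral_cgauss) auto
  also have "\<dots> \<le> (\<integral>H. mean_dist s (\<rho> powr (b * r)) + indicator ?A H * mean_dist s 1 \<partial>cgauss)"
    by (intro integral_mono integrable_cond_mean Bochner_Integration.integrable_add integrable_mult_left
        int cond_mean_le) auto
  also have "\<dots> = mean_dist s (\<rho> powr (b * r)) * measure (cgauss :: (complex^'t^'r) measure) UNIV +
      mean_dist s 1 * measure cgauss ?A"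
    using int by (subst Bochner_Integration.integral_add) (auto simp: mult.commute)
  finally show ?thesis .
qed

lemma ED_ld_ge:
  "ED_ld TYPE('t::finite) TYPE('r::finite) b \<rho> s \<epsilon> (r * log 2 \<rho>) \<ge>
     mean_dist s (\<rho> powr (b * r)) * measure (cgauss :: (complex^'t^'r) measure) UNIV"
proof -
  interpret finite_measure "cgauss :: (complex^'t^'r) measure"
    by (rule finite_measure_cgauss)
  have "mean_dist s (\<rho> powr (b * r)) * measure (cgauss :: (complex^'t^'r) measure) UNIV =
      (\<integral>H. mean_dist s (\<rho> powr (b * r)) \<partial>(cgauss :: (complex^'t^'r) measure))"
    by simp
  also have "\<dots> \<le> (\<integral>H. cond_mean b \<rho> s \<epsilon> r (H :: complex^'t^'r) \<partial>cgauss)"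
    by (intro integral_mono integrable_cond_mean cond_mean_ge) auto
  also have "\<dots> = ED_ld TYPE('t::finite) TYPE('r::finite) b \<rho> s \<epsilon> (r * log 2 \<rho>)"
    using \<rho> by (intro ED_ld_eq_integral_cgauss[symmetric]) auto
  finally show ?thesis .
qed

lemma ED_ld_ge_outage:
  "ED_ld TYPE('t::finite) TYPE('r::finite) b \<rho> s \<epsilon> (r * log 2 \<rho>) \<ge>
     exp (-1) / 2 * min 1 (1 / s) * measure cgauss {H :: complex^'t^'r.
       gram_det (\<rho> / real (min CARD('t) CARD('r))) H \<le> 2 powr (- (\<epsilon> + 1) / b) * \<rho> powr r}"
proof -
  interpret finite_measure "cgauss :: (complex^'t^'r) measure"
    by (rule finite_measure_cgauss)
  let ?A = "{H :: complex^'t^'r. gram_det (\<rho> / real (min CARD('t) CARD('r))) H \<le> 2 powr (- (\<epsilon> + 1) / b)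
      * \<rho> powr r}"
  have int: "integrable cgauss (indicator ?A :: complex^'t^'r \<Rightarrow> real)"
    by (simp add: integrable_indicator_iff emeasure_eq_measure)
  have "exp (-1) / 2 * min 1 (1 / s) * measure cgauss ?A = (\<integral>H. exp (-1) / 2 * min 1 (1 / s) * indicator
      ?A H \<partial>cgauss)"
    by simp
  also have "\<dots> \<le> (\<integral>H. cond_mean b \<rho> s \<epsilon> r (H :: complex^'t^'r) \<partial>cgauss)"
  proof (intro integral_mono integrable_cond_mean integrable_mult_right int)
    fix H :: "complex^'t^'r"
    have "cond_mean b \<rho> s \<epsilon> r H \<ge> 0"
      using cond_mean_ge[of H] mean_dist_nonneg[of s "\<rho> powr (b * r)"] y_ge_1 s by simp
    thus "exp (-1) / 2 * min 1 (1 / s) * indicator ?A H \<le> cond_mean b \<rho> s \<epsilon> r H"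
      using cond_mean_ge_outage[of H] by (auto simp: indicator_def)
  qed
  also have "\<dots> = ED_ld TYPE('t::finite) TYPE('r::finite) b \<rho> s \<epsilon> (r * log 2 \<rho>)"
    using \<rho> by (intro ED_ld_eq_integral_cgauss[symmetric]) auto
  finally show ?thesis .
qed

end

section \<open>Exponents\<close>

lemma log_ratio_tendsto:
  fixes f :: "real \<Rightarrow> real"
  assumes lower: "\<And>\<delta>. \<delta> > 0 \<Longrightarrow> \<exists>c>0. \<forall>\<^sub>F \<rho> in at_top. f \<rho> \<ge> c * \<rho> powr (- e - \<delta>)"
    and upper: "\<And>\<delta>. \<delta> > 0 \<Longrightarrow> \<exists>C. \<forall>\<^sub>F \<rho> in at_top. f \<rho> \<le> C * \<rho> powr (- e + \<delta>)"
  shows "((\<lambda>\<rho>. - log 2 (f \<rho>) / log 2 \<rho>) \<longlongrightarrow> e) at_top"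
proof (rule tendstoI)
  fix \<eta> :: real assume \<eta>: "\<eta> > 0"
  obtain c where c: "c > 0" and lo: "\<forall>\<^sub>F \<rho> in at_top. f \<rho> \<ge> c * \<rho> powr (- e - \<eta> / 3)"
    using lower[of "\<eta> / 3"] \<eta> by auto
  obtain C where up: "\<forall>\<^sub>F \<rho> in at_top. f \<rho> \<le> C * \<rho> powr (- e + \<eta> / 3)"
    using upper[of "\<eta> / 3"] \<eta> by auto
  \<comment> \<open>\<open>C\<close> may be nonpositive; the maximum gives it a logarithm.\<close>
  define B where "B = max 1 C"
  \<comment> \<open>Bounds both logarithms of constants, so that for large \<open>\<rho>\<close>
    they stay below \<eta> / 3 times log \<rho>.\<close>
  define Q where "Q = max \<bar>log 2 c\<bar> \<bar>log 2 B\<bar>"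
  have "\<forall>\<^sub>F \<rho> in at_top. log 2 \<rho> \<ge> 3 * (Q + 1) / \<eta>"
    using eventually_ge_at_top[of "2 powr (3 * (Q + 1) / \<eta>)"] by eventually_elim (subst le_log_iff, auto
        intro: less_le_trans[rotated])
  moreover have "\<forall>\<^sub>F \<rho> in at_top. \<rho> > (1 :: real)" by (rule eventually_gt_at_top)
  ultimately show "\<forall>\<^sub>F \<rho> in at_top. dist (- log 2 (f \<rho>) / log 2 \<rho>) e < \<eta>"
    using lo up
  proof eventually_elim
    case (elim \<rho>)
    define l where "l = log 2 \<rho>"
    have l: "l > 0" using elim by (simp add: l_def)
    have Ql: "Q < \<eta> / 3 * l"
    proof -
      have "\<eta> / 3 * (3 * (Q + 1) / \<eta>) \<le> \<eta> / 3 * l"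
        using elim(1) \<eta> unfolding l_def by (intro mult_left_mono) auto
      thus ?thesis using \<eta> by simp
    qed
    have pos: "c * \<rho> powr (- e - \<eta> / 3) > 0" using c elim by simp
    hence fpos: "f \<rho> > 0" using elim(3) by linarith
    have "log 2 (c * \<rho> powr (- e - \<eta> / 3)) \<le> log 2 (f \<rho>)"
      using pos fpos elim by (subst log_le_cancel_iff) auto
    moreover have "log 2 (c * \<rho> powr (- e - \<eta> / 3)) = log 2 c + (- e - \<eta> / 3) * l"
      using c elim by (simp add: log_mult log_powr l_def)
    moreover have "\<bar>log 2 c\<bar> \<le> Q" by (simp add: Q_def)
    ultimately have a: "- log 2 (f \<rho>) < (e + \<eta>) * l"
      using Ql \<eta> l by (simp add: algebra_simps abs_le_iff)
    have "f \<rho> \<le> B * \<rho> powr (- e + \<eta> / 3)"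
      using elim(4) by (rule order.trans) (auto simp: B_def intro!: mult_right_mono)
    hence "log 2 (f \<rho>) \<le> log 2 (B * \<rho> powr (- e + \<eta> / 3))"
      using fpos elim by (subst log_le_cancel_iff) auto
    moreover have "log 2 (B * \<rho> powr (- e + \<eta> / 3)) = log 2 B + (- e + \<eta> / 3) * l"
      using elim by (simp add: log_mult log_powr l_def B_def)
    moreover have "\<bar>log 2 B\<bar> \<le> Q" by (simp add: Q_def)
    ultimately have b: "- log 2 (f \<rho>) > (e - \<eta>) * l"
      using Ql \<eta> l by (simp add: algebra_simps abs_le_iff)
    have "- log 2 (f \<rho>) / l < e + \<eta>" "e - \<eta> < - log 2 (f \<rho>) / l"
      using a b l by (simp_all only: pos_divide_less_eq pos_less_divide_eq)
    thus ?case unfolding l_def[symmetric] by (simp add: dist_real_def abs_less_iff)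
  qed
qed

lemma eventually_powr_bounds:
  fixes rs :: "real \<Rightarrow> real"
  assumes rs_pos: "\<forall>\<rho>>0. rs \<rho> > 0"
    and rs_exp: "((\<lambda>\<rho>. log 2 (rs \<rho>) / log 2 \<rho>) \<longlongrightarrow> \<nu>) at_top" and \<delta>: "\<delta> > 0"
  shows "\<forall>\<^sub>F \<rho> in at_top. \<rho> powr (\<nu> - \<delta>) \<le> rs \<rho> \<and> rs \<rho> \<le> \<rho> powr (\<nu> + \<delta>)"
  using tendstoD[OF rs_exp \<delta>] eventually_gt_at_top[of 1]
proof eventually_elim
  case (elim \<rho>)
  have l: "log 2 \<rho> > 0" using elim by simp
  have rs: "rs \<rho> > 0" using rs_pos elim by simp
  have "\<nu> - \<delta> < log 2 (rs \<rho>) / log 2 \<rho>" "log 2 (rs \<rho>) / log 2 \<rho> < \<nu> + \<delta>"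
    using elim(1) by (auto simp: dist_real_def abs_less_iff)
  hence "(\<nu> - \<delta>) * log 2 \<rho> \<le> log 2 (rs \<rho>)" "log 2 (rs \<rho>) \<le> (\<nu> + \<delta>) * log 2 \<rho>"
    using l by (simp_all add: field_simps)
  hence "log 2 (\<rho> powr (\<nu> - \<delta>)) \<le> log 2 (rs \<rho>)" "log 2 (rs \<rho>) \<le> log 2 (\<rho> powr (\<nu> + \<delta>))"
    using elim by (simp_all add: log_powr)
  thus ?case using rs elim by (simp add: log_le_cancel_iff)
qed

section \<open>Asymptotics in the SNR of outage probability and mean distortion\<close>

lemma measure_outage_upper:
  assumes r: "r \<ge> 0" and M: "M \<ge> (1 :: real)" and \<delta>: "\<delta> > 0"
  shows "\<exists>C\<ge>0. \<forall>\<^sub>F \<rho> in at_top. measure cgauss {H :: complex^'t::finite^'r::finite. gram_det (\<rho> / M) H \<le>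
      \<rho> powr r}
           \<le> C * \<rho> powr (- dmt CARD('r) CARD('t) r + \<delta>)"
proof -
  define d where "d = dmt CARD('r) CARD('t) r"
  \<comment> \<open>Since \<open>\<rho> powr r\<close> is \<open>M powr r\<close> times
    \<open>(\<rho> / M) powr r\<close>, passing from x to \<rho> = M * x affects constants
    only.\<close>
  obtain C where C: "C \<ge> 0" and le: "\<And>x. x \<ge> 1 \<Longrightarrow>
      measure cgauss {H :: complex^'t^'r. gram_det x H \<le> M powr r * x powr r} \<le> C * x powr (- d + \<delta>)"
    using measure_gram_det_le_upper[OF r _ \<delta>, of "M powr r", where 'r = 'r and 't = 't] M unfolding
        d_def by auto
  have "\<forall>\<^sub>F \<rho> in at_top. measure cgauss {H :: complex^'t^'r. gram_det (\<rho> / M) H \<le> \<rho> powr r}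
           \<le> C * M powr (d - \<delta>) * \<rho> powr (- d + \<delta>)"
    using eventually_ge_at_top[of M]
  proof eventually_elim
    case (elim \<rho>)
    have "M powr r * (\<rho> / M) powr r = \<rho> powr r"
      using elim M by (simp add: powr_divide)
    moreover have "(\<rho> / M) powr (- d + \<delta>) = M powr (d - \<delta>) * \<rho> powr (- d + \<delta>)"
    proof -
      have "(\<rho> / M) powr (- d + \<delta>) = \<rho> powr (- d + \<delta>) / M powr (- d + \<delta>)"
        using elim M by (simp add: powr_divide)
      also have "\<dots> = \<rho> powr (- d + \<delta>) * M powr (- (- d + \<delta>))"
        by (simp only: powr_minus divide_inverse)
      finally show ?thesis by (simp add: mult.commute add.commute)
    qed
    ultimately show ?case using le[of "\<rho> / M"] elim M by (simp add: mult.assoc)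
  qed
  thus ?thesis unfolding d_def using C by (intro exI[of _ "C * M powr (d - \<delta>)"]) (auto simp: d_def)
qed

lemma measure_outage_lower:
  assumes r: "r > 0" and M: "M \<ge> (1 :: real)" and Y: "Y > 0" and \<delta>: "\<delta> > 0"
  shows "\<exists>c>0. \<forall>\<^sub>F \<rho> in at_top. measure cgauss {H :: complex^'t::finite^'r::finite. gram_det (\<rho> / M) H \<le>
      Y * \<rho> powr r}
           \<ge> c * \<rho> powr (- dmt CARD('r) CARD('t) r - \<delta>)"
proof -
  define d where "d = dmt CARD('r) CARD('t) r"
  have Y': "Y * M powr r > 0" using Y M by simp
  obtain c where c: "c > 0" and ge: "\<forall>\<^sub>F x in at_top.
      measure cgauss {H :: complex^'t^'r. gram_det x H \<le> Y * M powr r * x powr r} \<ge> c * x powr (- d - \<delta>)"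
    using measure_gram_det_le_lower[OF r Y' \<delta>, where 'r = 'r and 't = 't] unfolding d_def by auto
  have "filterlim (\<lambda>\<rho>. \<rho> / M) at_top at_top"
    unfolding divide_inverse
    by (rule filterlim_at_top_mult_tendsto_pos[OF tendsto_const _ filterlim_ident]) (use M in auto)
  from eventually_compose_filterlim[OF ge this] eventually_ge_at_top[of M]
  have "\<forall>\<^sub>F \<rho> in at_top. measure cgauss {H :: complex^'t^'r. gram_det (\<rho> / M) H \<le> Y * \<rho> powr r}
           \<ge> c * M powr (d + \<delta>) * \<rho> powr (- d - \<delta>)"
  proof eventually_elim
    case (elim \<rho>)
    have "M powr r * (\<rho> / M) powr r = \<rho> powr r"
      using elim M by (simp add: powr_divide)
    moreover have "(\<rho> / M) powr (- d - \<delta>) = M powr (d + \<delta>) * \<rho> powr (- d - \<delta>)"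
    proof -
      have "(\<rho> / M) powr (- d - \<delta>) = \<rho> powr (- d - \<delta>) / M powr (- d - \<delta>)"
        using elim M by (simp add: powr_divide)
      also have "\<dots> = \<rho> powr (- d - \<delta>) * M powr (- (- d - \<delta>))"
        by (simp only: powr_minus divide_inverse)
      finally show ?thesis by (simp add: mult.commute add.commute)
    qed
    ultimately show ?case using elim by (simp add: mult.assoc)
  qed
  thus ?thesis using c M unfolding d_def by (intro exI[of _ "c * M powr (d + \<delta>)"]) (auto simp: d_def)
qed

lemma measure_cgauss_UNIV_pos: "measure (cgauss :: (complex^'t::finite^'r::finite) measure) UNIV > 0"
proof -
  interpret finite_measure "cgauss :: (complex^'t^'r) measure"
    by (rule finite_measure_cgauss)
  obtain C c where c: "c > 0" and ge: "\<And>x. x \<ge> 1 \<Longrightarrow> measure cgauss {H :: complex^'t^'r.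
      gram_det x H \<le> C * x powr pivot_sum (\<lambda>L. 1 - 0) CARD('r) CARD('t)}
    \<ge> c * x powr (- pivot_sum (\<lambda>L. real L * 0) CARD('r) CARD('t))"
    using measure_gram_det_le_event[where \<alpha> = "\<lambda>_. 0" and 'r = 'r and 't = 't] by auto
  have "0 < c * 1 powr (- pivot_sum (\<lambda>L. real L * 0) CARD('r) CARD('t))" using c by simp
  also have "\<dots> \<le> measure (cgauss :: (complex^'t^'r) measure) UNIV"
    by (rule order.trans[OF ge]) (auto intro: finite_measure_mono)
  finally show ?thesis .
qed

context
  fixes rs :: "real \<Rightarrow> real" and \<nu> :: real
  assumes nu: "\<nu> \<ge> 0" and rs_pos: "\<forall>\<rho>>0. rs \<rho> > 0"
    and rs_exp: "((\<lambda>\<rho>. log 2 (rs \<rho>) / log 2 \<rho>) \<longlongrightarrow> \<nu>) at_top"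
begin

text \<open>For a \<ge> \<nu> the rate term dominates the denominator. Otherwise side information
  does, and its exponent \<nu> is approached through \<theta> = 1 - d.\<close>

lemma mean_dist_upper:
  assumes a: "a \<ge> 0" and \<delta>: "\<delta> > 0"
  shows "\<exists>C\<ge>0. \<forall>\<^sub>F \<rho> in at_top. mean_dist (rs \<rho>) (\<rho> powr a) \<le> C * \<rho> powr (- max a \<nu> + \<delta>)"
proof (cases "a \<ge> \<nu>")
  case True
  define W where "W = (\<integral>\<gamma>. expw \<gamma> \<partial>lborel)"
  have W: "W \<ge> 0" unfolding W_def by (simp add: expw_nonneg)
  have "\<forall>\<^sub>F \<rho> in at_top. mean_dist (rs \<rho>) (\<rho> powr a) \<le> W * \<rho> powr (- max a \<nu> + \<delta>)"
    using eventually_ge_at_top[of 1]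
  proof eventually_elim
    case (elim \<rho>)
    have "mean_dist (rs \<rho>) (\<rho> powr a) \<le> W * (1 / \<rho> powr a)"
      unfolding W_def using elim a rs_pos by (intro mean_dist_le_inverse ge_one_powr_ge_zero) (auto
          intro: less_imp_le)
    also have "1 / \<rho> powr a = \<rho> powr (- a)" by (simp add: powr_minus_divide)
    also have "W * \<rho> powr (- a) \<le> W * \<rho> powr (- max a \<nu> + \<delta>)"
      using True elim \<delta> W by (intro mult_left_mono powr_mono) auto
    finally show ?case .
  qed
  thus ?thesis using W by blast
next
  case False
  \<comment> \<open>Chosen for (\<nu> - d) (1 - d) = \<nu> - d (1 + \<nu>) + d^2 to be at least
    \<nu> - \<delta>.\<close>
  define d where "d = min (1 / 2) (\<delta> / (1 + \<nu>))"
  have d: "0 < d" "d < 1" using \<delta> nu by (auto simp: d_def)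
  have d_le: "d * (1 + \<nu>) \<le> \<delta>"
  proof -
    have "d * (1 + \<nu>) \<le> \<delta> / (1 + \<nu>) * (1 + \<nu>)" using nu by (intro mult_right_mono) (auto simp: d_def)
    thus ?thesis using nu by simp
  qed
  define W where "W = (\<integral>\<gamma>. expw \<gamma> * \<gamma> powr (- (1 - d)) \<partial>lborel)"
  have W: "W \<ge> 0" unfolding W_def by (simp add: expw_nonneg)
  have "\<forall>\<^sub>F \<rho> in at_top. mean_dist (rs \<rho>) (\<rho> powr a) \<le> W * \<rho> powr (- max a \<nu> + \<delta>)"
    using eventually_ge_at_top[of 1] eventually_powr_bounds[OF rs_pos rs_exp d(1)]
  proof eventually_elim
    case (elim \<rho>)
    have "mean_dist (rs \<rho>) (\<rho> powr a) \<le> W * rs \<rho> powr (- (1 - d))"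
      unfolding W_def using elim a rs_pos d by (intro mean_dist_le_powr ge_one_powr_ge_zero) auto
    also have "rs \<rho> powr (- (1 - d)) \<le> (\<rho> powr (\<nu> - d)) powr (- (1 - d))"
      using elim d by (intro powr_mono2') auto
    also have "\<dots> = \<rho> powr ((\<nu> - d) * (- (1 - d)))" by (simp only: powr_powr)
    also have "\<dots> \<le> \<rho> powr (- max a \<nu> + \<delta>)"
    proof (rule powr_mono)
      have "(\<nu> - d) * (- (1 - d)) = - \<nu> + d * (1 + \<nu>) - d * d" by (simp add: algebra_simps)
      also have "\<dots> \<le> - \<nu> + \<delta>" using d_le d by (smt (verit) mult_nonneg_nonneg)
      finally show "(\<nu> - d) * (- (1 - d)) \<le> - max a \<nu> + \<delta>" using False by simp
    qed (use elim in auto)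
    finally show ?case using W by (simp add: mult_left_mono)
  qed
  thus ?thesis using W by blast
qed

lemma mean_dist_lower:
  assumes a: "a \<ge> 0" and \<delta>: "\<delta> > 0"
  shows "\<exists>c>0. \<forall>\<^sub>F \<rho> in at_top. mean_dist (rs \<rho>) (\<rho> powr a) \<ge> c * \<rho> powr (- max a \<nu> - \<delta>)"
proof -
  have "\<forall>\<^sub>F \<rho> in at_top. mean_dist (rs \<rho>) (\<rho> powr a) \<ge> exp (-1) / 2 * \<rho> powr (- max a \<nu> - \<delta>)"
    using eventually_ge_at_top[of 1] eventually_powr_bounds[OF rs_pos rs_exp \<delta>]
  proof eventually_elim
    case (elim \<rho>)
    have rs: "rs \<rho> > 0" using rs_pos elim by simp
    have "rs \<rho> \<le> \<rho> powr (max a \<nu> + \<delta>)"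
      using elim by (intro order.trans[OF conjunct2[OF elim(2)]] powr_mono) auto
    moreover have "\<rho> powr a \<le> \<rho> powr (max a \<nu> + \<delta>)"
      using elim \<delta> by (intro powr_mono) auto
    ultimately have sum_le: "rs \<rho> + \<rho> powr a \<le> 2 * \<rho> powr (max a \<nu> + \<delta>)" by simp
    have "exp (-1) / 2 * \<rho> powr (- max a \<nu> - \<delta>) = exp (-1) / (2 * \<rho> powr (max a \<nu> + \<delta>))"
    proof -
      have "\<rho> powr (- max a \<nu> - \<delta>) = \<rho> powr (- (max a \<nu> + \<delta>))" by simp
      also have "\<dots> = 1 / \<rho> powr (max a \<nu> + \<delta>)" by (rule powr_minus_divide)
      finally show ?thesis by simp
    qed
    also have "\<dots> \<le> exp (-1) / (rs \<rho> + \<rho> powr a)"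
      using sum_le rs elim by (intro divide_left_mono) (auto intro!: mult_pos_pos add_pos_nonneg)
    also have "\<dots> \<le> mean_dist (rs \<rho>) (\<rho> powr a)"
      using rs elim a by (intro mean_dist_ge ge_one_powr_ge_zero) auto
    finally show ?case .
  qed
  thus ?thesis by (intro exI[of _ "exp (-1) / 2"]) auto
qed

lemma min_inverse_lower:
  assumes \<delta>: "\<delta> > 0"
  shows "\<forall>\<^sub>F \<rho> in at_top. min 1 (1 / rs \<rho>) \<ge> \<rho> powr (- \<nu> - \<delta>)"
  using eventually_ge_at_top[of 1] eventually_powr_bounds[OF rs_pos rs_exp \<delta>]
proof eventually_elim
  case (elim \<rho>)
  have rs: "rs \<rho> > 0" using rs_pos elim by simp
  have "\<rho> powr (- \<nu> - \<delta>) \<le> \<rho> powr 0" using elim nu \<delta> by (intro powr_mono) auto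
  moreover have "\<rho> powr (- \<nu> - \<delta>) \<le> 1 / rs \<rho>"
  proof -
    have "\<rho> powr (- \<nu> - \<delta>) = \<rho> powr (- (\<nu> + \<delta>))" by simp
    also have "\<dots> = 1 / \<rho> powr (\<nu> + \<delta>)" by (rule powr_minus_divide)
    also have "\<dots> \<le> 1 / rs \<rho>" using elim rs by (intro divide_left_mono) auto
    finally show ?thesis .
  qed
  ultimately show ?case using elim by simp
qed

text \<open>The upper bound is a sum, so its smaller exponent decides. For the lower bound it is
  enough to treat the branch attaining the minimum: the decoded distortion bounds the expectation
  from below for every \<open>H\<close>, and the outage event with small \<gamma> gives the other
  branch.\<close>

lemma ED_ld_exponent:
  assumes b: "b > 0" and eps: "\<epsilon> > 0" and r: "r \<ge> 0"
  shows "((\<lambda>\<rho>. - log 2 (ED_ld TYPE('t::finite) TYPE('r::finite) b \<rho> (rs \<rho>) \<epsilon> (r * log 2 \<rho>)) / log 2 \<rho>)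
     \<longlongrightarrow> min (max (b * r) \<nu>) (\<nu> + dmt CARD('r) CARD('t) r)) at_top"
proof -
  define d where "d = dmt CARD('r) CARD('t) r"
  define e where "e = min (max (b * r) \<nu>) (\<nu> + d)"
  define G where "G = measure (cgauss :: (complex^'t^'r) measure) UNIV"
  define M where "M = real (min CARD('t) CARD('r))"
  have M: "M \<ge> 1" unfolding M_def by (simp add: Suc_le_eq)
  have G: "G > 0" unfolding G_def by (rule measure_cgauss_UNIV_pos)
  have d0: "d \<ge> 0" unfolding d_def by (rule dmt_nonneg)
  have br: "b * r \<ge> 0" using b r by simp
  show ?thesis
    unfolding d_def[symmetric] e_def[symmetric]
  proof (rule log_ratio_tendsto)
    fix \<delta> :: real assume \<delta>: "\<delta> > 0"
    hence \<delta>2: "\<delta> / 2 > 0" by simp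
    obtain C1 where C1: "C1 \<ge> 0" and B1: "\<forall>\<^sub>F \<rho> in at_top. mean_dist (rs \<rho>) (\<rho> powr (b * r)) \<le> C1 * \<rho>
        powr (- max (b * r) \<nu> + \<delta>)"
      using mean_dist_upper[OF br \<delta>] by blast
    \<comment> \<open>The exponent a = 0 stands for y = 1, the distortion from side information
      alone. It and the outage probability are multiplied, so each gets \<delta> / 2.\<close>
    obtain C2 where C2: "C2 \<ge> 0" and B2: "\<forall>\<^sub>F \<rho> in at_top. mean_dist (rs \<rho>) (\<rho> powr 0) \<le> C2 * \<rho> powr (-
        max 0 \<nu> + \<delta> / 2)"
      using mean_dist_upper[OF order_refl \<delta>2] by blast
    obtain C3 where C3: "C3 \<ge> 0" and B3: "\<forall>\<^sub>F \<rho> in at_top.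
        measure cgauss {H :: complex^'t^'r. gram_det (\<rho> / M) H \<le> \<rho> powr r} \<le> C3 * \<rho> powr (- d + \<delta> / 2)"
      using measure_outage_upper[OF r M \<delta>2, where 'r = 'r and 't = 't] unfolding d_def by blast
    have "\<forall>\<^sub>F \<rho> in at_top. ED_ld TYPE('t::finite) TYPE('r::finite) b \<rho> (rs \<rho>) \<epsilon> (r * log 2 \<rho>)
        \<le> (C1 * G + C2 * C3) * \<rho> powr (- e + \<delta>)"
      using B1 B2 B3 eventually_ge_at_top[of 1]
    proof eventually_elim
      case (elim \<rho>)
      have rs: "rs \<rho> > 0" using rs_pos elim by simp
      have "ED_ld TYPE('t::finite) TYPE('r::finite) b \<rho> (rs \<rho>) \<epsilon> (r * log 2 \<rho>) \<le>
          mean_dist (rs \<rho>) (\<rho> powr (b * r)) * G + mean_dist (rs \<rho>) 1 *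
          measure cgauss {H :: complex^'t^'r. gram_det (\<rho> / M) H \<le> \<rho> powr r}"
        unfolding G_def M_def using elim by (intro ED_ld_le b eps rs r) auto
      also have "\<dots> \<le> (C1 * \<rho> powr (- max (b * r) \<nu> + \<delta>)) * G + (C2 * \<rho> powr (- \<nu> + \<delta> / 2)) * (C3 * \<rho>
          powr (- d + \<delta> / 2))"
        using elim G C1 C2 nu by (intro add_mono mult_mono) auto
      also have "\<dots> = C1 * G * \<rho> powr (- max (b * r) \<nu> + \<delta>) + C2 * C3 * \<rho> powr (- (\<nu> + d) + \<delta>)"
      proof -
        have "\<rho> powr (- \<nu> + \<delta> / 2) * \<rho> powr (- d + \<delta> / 2) = \<rho> powr (- (\<nu> + d) + \<delta>)"
          by (simp add: powr_add[symmetric] algebra_simps)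
        thus ?thesis by (simp add: mult_ac)
      qed
      also have "\<dots> \<le> C1 * G * \<rho> powr (- e + \<delta>) + C2 * C3 * \<rho> powr (- e + \<delta>)"
        using elim C1 C2 C3 G by (intro add_mono mult_left_mono powr_mono) (auto simp: e_def)
      finally show ?case by (simp add: algebra_simps)
    qed
    thus "\<exists>C. \<forall>\<^sub>F \<rho> in at_top. ED_ld TYPE('t::finite) TYPE('r::finite) b \<rho> (rs \<rho>) \<epsilon> (r * log 2 \<rho>)
        \<le> C * \<rho> powr (- e + \<delta>)" by blast
  next
    fix \<delta> :: real assume \<delta>: "\<delta> > 0"
    hence \<delta>2: "\<delta> / 2 > 0" by simp
    show "\<exists>c>0. \<forall>\<^sub>F \<rho> in at_top. ED_ld TYPE('t::finite) TYPE('r::finite) b \<rho> (rs \<rho>) \<epsilon> (r * log 2 \<rho>)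
        \<ge> c * \<rho> powr (- e - \<delta>)"
    proof (cases "max (b * r) \<nu> \<le> \<nu> + d")
      case True
      hence e: "e = max (b * r) \<nu>" by (simp add: e_def)
      obtain c where c: "c > 0" and B: "\<forall>\<^sub>F \<rho> in at_top. mean_dist (rs \<rho>) (\<rho> powr (b * r)) \<ge> c * \<rho> powr
          (- max (b * r) \<nu> - \<delta>)"
        using mean_dist_lower[OF br \<delta>] by blast
      have "\<forall>\<^sub>F \<rho> in at_top. ED_ld TYPE('t::finite) TYPE('r::finite) b \<rho> (rs \<rho>) \<epsilon> (r * log 2 \<rho>)
          \<ge> c * G * \<rho> powr (- e - \<delta>)"
        using B eventually_ge_at_top[of 1]
      proof eventually_elim
        case (elim \<rho>)
        have rs: "rs \<rho> > 0" using rs_pos elim by simp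
        have "c * G * \<rho> powr (- e - \<delta>) = (c * \<rho> powr (- max (b * r) \<nu> - \<delta>)) * G" by (simp add: e)
        also have "\<dots> \<le> mean_dist (rs \<rho>) (\<rho> powr (b * r)) * G"
          using elim G by (intro mult_right_mono) auto
        also have "\<dots> \<le> ED_ld TYPE('t::finite) TYPE('r::finite) b \<rho> (rs \<rho>) \<epsilon> (r * log 2 \<rho>)"
          unfolding G_def using elim by (intro ED_ld_ge b eps rs r) auto
        finally show ?case .
      qed
      thus ?thesis using c G by (intro exI[of _ "c * G"]) auto
    next
      case False
      hence e: "e = \<nu> + d" unfolding e_def by (intro min.absorb2) linarith
      \<comment> \<open>At r = 0 the first branch is \<nu>, which cannot exceed \<nu> + d; hence
        \<open>measure_outage_lower\<close> applies.\<close>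
      have r0: "r > 0" using False r d0 nu by (cases "r = 0") auto
      define Y where "Y = 2 powr (- (\<epsilon> + 1) / b)"
      have Y: "Y > 0" by (simp add: Y_def)
      obtain c where c: "c > 0" and B: "\<forall>\<^sub>F \<rho> in at_top.
          measure cgauss {H :: complex^'t^'r. gram_det (\<rho> / M) H \<le> Y * \<rho> powr r} \<ge> c * \<rho> powr (- d - \<delta> / 2)"
        using measure_outage_lower[OF r0 M Y \<delta>2, where 'r = 'r and 't = 't] unfolding d_def by blast
      have "\<forall>\<^sub>F \<rho> in at_top. ED_ld TYPE('t::finite) TYPE('r::finite) b \<rho> (rs \<rho>) \<epsilon> (r * log 2 \<rho>)
          \<ge> exp (-1) / 2 * c * \<rho> powr (- e - \<delta>)"
        using B min_inverse_lower[OF \<delta>2] eventually_ge_at_top[of 1]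
      proof eventually_elim
        case (elim \<rho>)
        have rs: "rs \<rho> > 0" using rs_pos elim by simp
        have "\<rho> powr (- e - \<delta>) = \<rho> powr (- \<nu> - \<delta> / 2) * \<rho> powr (- d - \<delta> / 2)"
          by (simp add: powr_add[symmetric] e algebra_simps)
        hence "exp (-1) / 2 * c * \<rho> powr (- e - \<delta>) = exp (-1) / 2 * \<rho> powr (- \<nu> - \<delta> / 2) * (c * \<rho> powr
            (- d - \<delta> / 2))"
          by (simp add: mult_ac)
        also have "\<dots> \<le> exp (-1) / 2 * min 1 (1 / rs \<rho>) *
            measure cgauss {H :: complex^'t^'r. gram_det (\<rho> / M) H \<le> Y * \<rho> powr r}"
          using elim c rs by (intro mult_mono) auto
        also have "\<dots> \<le> ED_ld TYPE('t::finite) TYPE('r::finite) b \<rho> (rs \<rho>) \<epsilon> (r * log 2 \<rho>)"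
          unfolding M_def Y_def using elim by (intro ED_ld_ge_outage b eps rs r) auto
        finally show ?case .
      qed
      thus ?thesis using c by (intro exI[of _ "exp (-1) / 2 * c"]) auto
    qed
  qed
qed

end

text \<open>After \<open>k\<close> eliminations, the remaining crosses partition the entries of an
  (m - k) x (n - k) block.\<close>

lemma sum_pivot_dims:
  assumes "k \<le> min m n"
  shows "(\<Sum>i=k..<min m n. real (m + n - 1 - 2 * i)) = (real m - real k) * (real n - real k)"
  using assms
proof (induction k rule: inc_induct)
  case base
  show ?case by (auto simp: min_def)
next
  case (step k)
  have "real (m + n - 1 - 2 * k) = real m + real n - 1 - 2 * real k"
    using step.hyps by (simp add: of_nat_diff)
  thus ?case using step by (simp add: sum.atLeast_Suc_lessThan algebra_simps)
qed

text \<open>On this segment the clamps are 0 for i < k and 1 for i > k; only the term i = k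
  varies.\<close>

lemma dmt_segment:
  assumes k: "k < min m n" and r: "real k \<le> r" "r \<le> real k + 1"
  shows "dmt m n r = (real m - real k) * (real n - real k) - (r - real k) * (real m + real n - 2 * real
      k - 1)"
proof -
  let ?f = "\<lambda>i. real (m + n - 1 - 2 * i) * unit_clamp (real i + 1 - r)"
  have "dmt m n r = (\<Sum>i<k. ?f i) + (?f k + (\<Sum>i=Suc k..<min m n. ?f i))"
  proof -
    have "{..<min m n} = {..<k} \<union> {k..<min m n}" using k by auto
    hence "dmt m n r = (\<Sum>i<k. ?f i) + (\<Sum>i=k..<min m n. ?f i)"
      unfolding dmt_def by (simp add: sum.union_disjoint ivl_disj_int)
    thus ?thesis using k by (simp add: sum.atLeast_Suc_lessThan)
  qed
  also have "(\<Sum>i<k. ?f i) = 0"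
    using r by (intro sum.neutral) (auto simp: unit_clamp_def)
  also have "(\<Sum>i=Suc k..<min m n. ?f i) = (\<Sum>i=Suc k..<min m n. real (m + n - 1 - 2 * i))"
    using r by (intro sum.cong refl) (auto simp: unit_clamp_def)
  also have "\<dots> = (real m - real (Suc k)) * (real n - real (Suc k))"
    using k by (intro sum_pivot_dims) auto
  also have "?f k = (real m + real n - 1 - 2 * real k) * (real k + 1 - r)"
    using k r by (simp add: of_nat_diff unit_clamp_def)
  finally show ?thesis by (simp add: algebra_simps)
qed

theorem theorem2:
  fixes b \<nu> \<epsilon> :: real and rs :: "real \<Rightarrow> real" and k :: nat
  assumes b_pos: "b > 0" and nu: "\<nu> \<ge> 0" and eps: "\<epsilon> > 0"
    and rs_pos: "\<forall>\<rho>>0. rs \<rho> > 0"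
    and rs_exp: "((\<lambda>\<rho>. log 2 (rs \<rho>) / log 2 \<rho>) \<longlongrightarrow> \<nu>) at_top"
    and k: "k < Mmin TYPE('t::finite) TYPE('r::finite)"
    and lo: "(Phi (Mmax TYPE('t) TYPE('r)) (Mmin TYPE('t) TYPE('r)) (k + 1) + \<nu>) / real (k + 1) \<le> b"
    and hi: "k = 0 \<or> b < (Phi (Mmax TYPE('t) TYPE('r)) (Mmin TYPE('t) TYPE('r)) k + \<nu>) / real k"
  shows "(\<forall>r\<ge>0. exponent_exists (\<lambda>\<rho>. ED_ld TYPE('t) TYPE('r) b \<rho> (rs \<rho>) \<epsilon> (r * log 2 \<rho>)))
       \<and> LD_exponent TYPE('t) TYPE('r) b rs \<epsilon> =
         max \<nu> (b * (Phi (Mmax TYPE('t) TYPE('r)) (Mmin TYPE('t) TYPE('r)) k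
                    + real k * Ups (Mmax TYPE('t) TYPE('r)) (Mmin TYPE('t) TYPE('r)) k + \<nu>)
                 / (Ups (Mmax TYPE('t) TYPE('r)) (Mmin TYPE('t) TYPE('r)) k + b))"
proof -
  define F where "F r = min (max (b * r) \<nu>) (\<nu> + dmt CARD('r) CARD('t) r)" for r
  note lim = ED_ld_exponent[OF nu rs_pos rs_exp b_pos eps, where 'r = 'r and 't = 't, folded F_def]
  define P where "P = (real CARD('r) - real k) * (real CARD('t) - real k)"
  define U where "U = real CARD('r) + real CARD('t) - 2 * real k - 1"
  \<comment> \<open>The solution of b * r = \<nu> + P - (r - k) * U, the crossing of both branches
    on the line that extends segment \<open>k\<close>.\<close>
  define rk where "rk = (P + real k * U + \<nu>) / (U + b)"
  have kmin: "k < min CARD('r) CARD('t)" using k by (simp add: Mmin_def min.commute)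
  have Phi_eq: "Phi (Mmax TYPE('t) TYPE('r)) (Mmin TYPE('t) TYPE('r)) j =
      (real CARD('r) - real j) * (real CARD('t) - real j)" for j
    by (auto simp: Phi_def Mmax_def Mmin_def max_def min_def mult.commute)
  have Ups_eq: "Ups (Mmax TYPE('t) TYPE('r)) (Mmin TYPE('t) TYPE('r)) k = U"
    by (auto simp: Ups_def Mmax_def Mmin_def U_def max_def min_def)
  have U: "U \<ge> 1"
  proof -
    have "real k + 1 \<le> real CARD('r)" "real k + 1 \<le> real CARD('t)" using kmin by auto
    thus ?thesis unfolding U_def by linarith
  qed
  have Ub: "U + b > 0" using U b_pos by simp
  have P_nonneg: "P \<ge> 0" using kmin by (simp add: P_def)
  have rk_ge: "real k \<le> rk"
  proof -
    have "b * real k \<le> P + \<nu>"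
      using hi P_nonneg nu by (cases "k = 0") (auto simp: Phi_eq P_def field_simps)
    thus ?thesis using Ub by (simp add: rk_def field_simps)
  qed
  have rk_le: "rk \<le> real k + 1"
  proof -
    \<comment> \<open>\<open>P - U\<close> is the value of \<open>Phi\<close> at k + 1, so this is
      the lower end of the interval for \<open>b\<close>.\<close>
    have "P - U + \<nu> \<le> b * (real k + 1)"
      using lo by (simp add: Phi_eq P_def U_def field_simps)
    thus ?thesis using Ub by (simp add: rk_def field_simps)
  qed
  have cross: "b * rk = \<nu> + dmt CARD('r) CARD('t) rk"
  proof -
    have "dmt CARD('r) CARD('t) rk = P - (rk - real k) * U"
      unfolding P_def U_def by (rule dmt_segment[OF kmin rk_ge rk_le])
    moreover have "rk * (U + b) = P + real k * U + \<nu>"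
      using Ub by (simp add: rk_def)
    ultimately show ?thesis by (simp add: algebra_simps)
  qed
  have rk0: "rk \<ge> 0" using rk_ge by simp
  have max_eq: "max \<nu> (b * rk) = b * rk"
    using cross dmt_nonneg[of "CARD('r)" "CARD('t)" rk] by simp
  have F_rk: "F rk = b * rk"
    using max_eq cross by (simp add: F_def max.commute)
  \<comment> \<open>The first branch is nondecreasing and the second one nonincreasing in
    \<open>r\<close>, so one of them is at most the crossing value on either side of
    \<open>rk\<close>.\<close>
  have F_le: "F r \<le> b * rk" for r
  proof (cases "r \<le> rk")
    case True
    hence "max (b * r) \<nu> \<le> b * rk"
      using max_eq b_pos by (simp add: max_def split: if_splits)
    thus ?thesis unfolding F_def by (rule min.coboundedI1)
  next
    case False
    hence "\<nu> + dmt CARD('r) CARD('t) r \<le> b * rk"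
      unfolding cross using dmt_antimono[of rk r] by simp
    thus ?thesis by (simp add: F_def)
  qed
  have exp_eq: "distortion_exponent (\<lambda>\<rho>. ED_ld TYPE('t) TYPE('r) b \<rho> (rs \<rho>) \<epsilon> (r * log 2 \<rho>)) = F r"
    if "r \<ge> 0" for r
    unfolding distortion_exponent_def by (rule tendsto_Lim[OF _ lim[OF that]]) simp
  have "LD_exponent TYPE('t) TYPE('r) b rs \<epsilon> = (SUP r\<in>{0..}. F r)"
    unfolding LD_exponent_def by (intro SUP_cong refl) (simp add: exp_eq)
  also have "\<dots> = b * rk"
  proof (rule cSup_eq_maximum)
    show "b * rk \<in> F ` {0..}" using F_rk rk0 by (metis atLeast_iff image_eqI)
  qed (auto simp: F_le)
  also have "b * rk = max \<nu> (b * (P + real k * U + \<nu>) / (U + b))"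
    using max_eq by (simp add: rk_def)
  finally show ?thesis
    unfolding Ups_eq Phi_eq P_def[symmetric] using lim unfolding exponent_exists_def by blast
qed

end
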